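(* Let $d\ge2$, $\alpha\in[0,(d+1)/2)$ and $\beta=(d+1-2\alpha)/(2d)$. There is a constant $N=N(d,\alpha)$ such that the following holds. Let $a(x)=(a^{ij}(x))$ be a measurable function on $B$ with values in symmetric nonnegative definite $d\times d$ matrices such that $\mathrm{tr}\,a>0$ in $B$. Let $u\in W^2_{d,\mathrm{loc}}(B)\cap C(\bar B)$ and $L_0u=a^{ij}D_{ij}u$. Then for every $x_0\in B$ $$u(x_0)\le\sup_{\partial B}u+N\psi^{\beta}(x_0)\Big(\int_B\psi^{\alpha}\,I_{L_0u<0}\,(\det a)^{-1}|L_0u|^d\,dx\Big)^{1/d}.$$
   Context: $B=\{x\in\mathbb{R}^d:|x|<1\}$, $\psi(x)=1-|x|^2$, $D_{ij}=\partial^2/\partial x^i\partial x^j$, summation over repeated indices is understood. $I_{L_0u<0}$ is the indicator function of the set $\{x\in B:L_0u(x)<0\}$. In the integrand, regarded as the quotient $I_{L_0u<0}|L_0u|^d/\det a$, one uses $0/0:=0$ (and a positive number divided by $0$ is $+\infty$; the right-hand side may be $+\infty$). *)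

theory Defs
  imports "HOL-Analysis.Analysis"
begin

definition partial_deriv :: "'n::finite \<Rightarrow> (real^'n \<Rightarrow> real) \<Rightarrow> real^'n \<Rightarrow> real" where
  "partial_deriv i f x = frechet_derivative f (at x) (axis i 1)"

(* The list [i1, ..., ik] stands for the operator D_i1 ... D_ik; the empty list is the identity. *)
definition partial_derivs :: "'n::finite list \<Rightarrow> (real^'n \<Rightarrow> real) \<Rightarrow> real^'n \<Rightarrow> real" where
  "partial_derivs is f = foldr partial_deriv is f"

(* C_c^infinity(U).  Requiring every iterated partial derivative to be (Frechet) differentiable
   everywhere makes all of them continuous, so this is the usual smoothness. *)
definition test_function :: "(real^'n::finite) set \<Rightarrow> (real^'n \<Rightarrow> real) \<Rightarrow> bool" where
  "test_function U \<phi> \<longleftrightarrow>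
     (\<forall>is x. partial_derivs is \<phi> differentiable (at x)) \<and>
     (\<exists>K. compact K \<and> K \<subseteq> U \<and> (\<forall>x. x \<notin> K \<longrightarrow> \<phi> x = 0))"

(* L_{p,loc}(U), meant for p \<ge> 1; values outside U are irrelevant. *)
definition Lp_loc :: "real \<Rightarrow> (real^'n::finite) set \<Rightarrow> (real^'n \<Rightarrow> real) set" where
  "Lp_loc p U = {f. f \<in> borel_measurable (lebesgue_on U) \<and>
     (\<forall>K. compact K \<and> K \<subseteq> U \<longrightarrow> integrable (lebesgue_on K) (\<lambda>x. \<bar>f x\<bar> powr p))}"

(* v is a version of the weak (distributional) derivative D_is u on U. *)
definition has_weak_deriv ::
  "(real^'n::finite) set \<Rightarrow> 'n list \<Rightarrow> (real^'n \<Rightarrow> real) \<Rightarrow> (real^'n \<Rightarrow> real) \<Rightarrow> bool" where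
  "has_weak_deriv U is u v \<longleftrightarrow> u \<in> Lp_loc 1 U \<and> v \<in> Lp_loc 1 U \<and>
     (\<forall>\<phi>. test_function U \<phi> \<longrightarrow>
        (LINT x|lebesgue_on U. u x * partial_derivs is \<phi> x) =
        (-1) ^ length is * (LINT x|lebesgue_on U. v x * \<phi> x))"

(* The Sobolev space W^k_{p,loc}(U).  The case of the empty list says that u itself is in
   L_{p,loc}(U). *)
definition sobolev_loc :: "nat \<Rightarrow> real \<Rightarrow> (real^'n::finite) set \<Rightarrow> (real^'n \<Rightarrow> real) set" where
  "sobolev_loc k p U = {u. \<forall>is. length is \<le> k \<longrightarrow> (\<exists>v \<in> Lp_loc p U. has_weak_deriv U is u v)}"

definition sym_nonneg_definite :: "real^'n::finite^'n \<Rightarrow> bool" where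
  "sym_nonneg_definite A \<longleftrightarrow> transpose A = A \<and> (\<forall>v. 0 \<le> v \<bullet> (A *v v))"

(* H x is the matrix of (weak) second derivatives D_ij u(x). *)
definition L0 :: "(real^'n::finite \<Rightarrow> real^'n^'n) \<Rightarrow> (real^'n \<Rightarrow> real^'n^'n) \<Rightarrow> real^'n \<Rightarrow> real" where
  "L0 a H x = (\<Sum>i\<in>UNIV. \<Sum>j\<in>UNIV. a x $ i $ j * H x $ i $ j)"

definition psi :: "real^'n::finite \<Rightarrow> real" where
  "psi x = 1 - (norm x)\<^sup>2"

(* x^p for p > 0, with top^p = top. *)
definition ennreal_powr :: "ennreal \<Rightarrow> real \<Rightarrow> ennreal" where
  "ennreal_powr x p = (if x = top then top else ennreal (enn2real x powr p))"

(* The integral of psi^alpha * I_{L0 u < 0} * (det a)^{-1} * |L0 u|^d over the unit ball.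
   Division in ennreal gives 0 / 0 = 0 and c / 0 = top for c > 0. *)
definition weighted_integral ::
  "real \<Rightarrow> (real^'n::finite \<Rightarrow> real^'n^'n) \<Rightarrow> (real^'n \<Rightarrow> real^'n^'n) \<Rightarrow> ennreal" where
  "weighted_integral \<alpha> a H =
     (\<integral>\<^sup>+ x. ennreal (psi x powr \<alpha>) *
        (ennreal (indicator {y \<in> ball 0 1. L0 a H y < 0} x * \<bar>L0 a H x\<bar> ^ CARD('n))
           / ennreal (det (a x)))
      \<partial>lebesgue_on (ball 0 1))"

end

theory Submission
  imports Defs
begin

text \<open>
The proof combines Aleksandrov's contact argument with a choice of the point at which it is applied.
Let \<open>n\<close> be the dimension, and subtract from \<open>u\<close> a constant slightly larger than its maximum over the
sphere, so that the difference \<open>w\<close> is negative on the sphere.  Suppose that \<open>w\<close> is positive somewhere,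
and let \<open>x1\<close> maximize \<open>w / \<psi>\<^sup>\<beta>\<close> over \<open>{w \<ge> 0}\<close>, with maximum \<open>K\<close>; write \<open>M = w(x1)\<close>.

For a slope \<open>p\<close> in the set \<open>P = {p. |p| + p \<bullet> x1 \<le> M/2}\<close>, which is the dual body of the ball with respect
to \<open>x1\<close>, the function \<open>w(x) - p \<bullet> x\<close> can have its maximum only at points \<open>x\<close> with \<open>w(x) \<ge> M/2\<close>.  At such
a point \<open>K \<psi>(x)\<^sup>\<beta> \<ge> w(x) \<ge> K \<psi>(x1)\<^sup>\<beta> / 2\<close>, so that \<open>\<psi>(x)\<close> is at least a fixed multiple of \<open>\<psi>(x1)\<close>: the
contact points cannot approach the sphere, where the weight degenerates.  Since \<open>P\<close> contains an ellipsoid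
of volume \<open>\<omega> (M/2)\<^sup>n \<psi>(x1) powr (-(n+1)/2)\<close>, where \<open>\<omega>\<close> is the volume of the unit ball
(\<open>polar_set_volume\<close>), and is covered by the gradients at the contact points, the area inequality gives
\<open>|P| \<le> \<integral> det (- D\<^sup>2 u)\<close> over the contact points with \<open>- D\<^sup>2 u \<ge> 0\<close>.  There
\<open>det a * det (- D\<^sup>2 u) \<le> (- L0 u)\<^sup>n\<close> (\<open>det_mult_le_trace_power\<close>), whence the weighted integral is at
least a constant times \<open>\<psi>(x1)\<^sup>\<alpha> |P|\<close>, which is at least a constant times
\<open>K\<^sup>n \<psi>(x1) powr (\<alpha> + n \<beta> - (n+1)/2) = K\<^sup>n\<close>; the exponent vanishes by the choice of \<open>\<beta>\<close>.  This is
\<open>maximal_growth_bound\<close>, and \<open>w \<le> K \<psi>\<^sup>\<beta>\<close> is the assertion.  Where \<open>det a = 0\<close> the integrand is infinite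
unless \<open>L0 u \<ge> 0\<close>; in the latter case \<open>tr a > 0\<close> forces \<open>det (- D\<^sup>2 u) = 0\<close> on the set where
\<open>- D\<^sup>2 u \<ge> 0\<close>, so the inequality survives.

The area inequality needs a differentiable gradient, which \<open>u\<close> itself lacks.  It is applied to mollifications
\<open>u\<^sub>\<epsilon>\<close>, whose slopes in \<open>P\<close> are also attained where \<open>w > M/4\<close>, and whose Hessians are the mollified weak second
derivatives.  The passage to the limit rests on two facts: the function
equal to \<open>det A\<close> on nonnegative definite matrices and to \<open>0\<close> elsewhere is upper semicontinuous, and by
Jensen's inequality its value at \<open>- D\<^sup>2 u\<^sub>\<epsilon>\<close> is at most the mollification of \<open>|tr D\<^sup>2 u|\<^sup>n\<close>, which converges
in L1 (\<open>measure_gradient_image_limit\<close>).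
\<close>

section \<open>Determinant and trace of nonnegative definite matrices\<close>

lemma inner_matrix_symmetric:
  fixes A :: "real^'n::finite^'n"
  assumes "transpose A = A"
  shows "x \<bullet> (A *v y) = (A *v x) \<bullet> y"
  by (metis assms dot_lmul_matrix vector_transpose_matrix)

lemma linear_le_quadratic_imp_zero:
  fixes b c :: real
  assumes "\<And>t. t * b \<le> t\<^sup>2 * c"
  shows "b = 0"
proof (rule ccontr)
  assume b: "b \<noteq> 0"
  define D where "D = \<bar>c\<bar> + 1"
  have D: "D > 0" "c < D" by (auto simp: D_def)
  have "(b / D) * b \<le> (b/D)\<^sup>2 * c" using assms[of "b/D"] .
  also have "\<dots> < (b/D)\<^sup>2 * D" using D b by (intro mult_strict_left_mono) auto
  also have "\<dots> = (b/D) * b" using D by (simp add: power2_eq_square)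
  finally show False by simp
qed

text \<open>A maximizer \<open>v\<close> of the quadratic form \<open>x \<bullet> A x\<close> on the unit sphere of \<open>S\<close> is an eigenvector: moving from \<open>v\<close> in
a direction \<open>w\<close> orthogonal to \<open>v\<close> changes the form to first order by \<open>2 t w \<bullet> A v\<close>, so \<open>A v\<close> is orthogonal to every such
\<open>w\<close>, in particular to its own component orthogonal to \<open>v\<close>.\<close>

lemma symmetric_eigenvector_in_subspace:
  fixes A :: "real^'n::finite^'n"
  assumes sym: "transpose A = A" and S: "subspace S" and ne: "S \<noteq> {0}"
    and inv: "\<And>x. x \<in> S \<Longrightarrow> A *v x \<in> S"
  shows "\<exists>v\<in>S. \<exists>l. norm v = 1 \<and> A *v v = l *\<^sub>R v"
proof -
  define U where "U = S \<inter> sphere 0 1"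
  have "compact U"
    unfolding U_def by (intro closed_Int_compact closed_subspace S compact_sphere)
  moreover have "U \<noteq> {}"
  proof -
    obtain x where x: "x \<in> S" "x \<noteq> 0" using ne S subspace_0 by blast
    have "x /\<^sub>R norm x \<in> U" using x S by (auto simp: U_def subspace_scale)
    then show ?thesis by auto
  qed
  moreover have "continuous_on U (\<lambda>x. x \<bullet> (A *v x))"
    by (intro continuous_intros linear_continuous_on matrix_vector_mul_bounded_linear)
  ultimately obtain v where v: "v \<in> U" and vmax: "\<And>x. x \<in> U \<Longrightarrow> x \<bullet> (A *v x) \<le> v \<bullet> (A *v v)"
    using continuous_attains_sup by metis
  define l where "l = v \<bullet> (A *v v)"
  have vS: "v \<in> S" and nv: "norm v = 1" using v by (auto simp: U_def)
  have vv: "v \<bullet> v = 1" using nv by (simp add: dot_square_norm)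
  \<comment> \<open>Maximality on the unit sphere, in homogeneous form.\<close>
  have q: "x \<bullet> (A *v x) \<le> l * (x \<bullet> x)" if "x \<in> S" for x
  proof (cases "x = 0")
    case False
    have "x /\<^sub>R norm x \<in> U" using that S False by (auto simp: U_def subspace_scale)
    from vmax[OF this] have "(x \<bullet> (A *v x)) / (norm x * norm x) \<le> l"
      by (simp add: l_def divide_simps matrix_vector_mult_scaleR)
    then show ?thesis using False by (simp add: divide_simps dot_square_norm power2_eq_square)
  qed simp
  have orth: "w \<bullet> (A *v v) = 0" if w: "w \<in> S" "w \<bullet> v = 0" for w
  proof (rule linear_le_quadratic_imp_zero)
    fix t :: real
    have vw: "v \<bullet> (A *v w) = w \<bullet> (A *v v)"
      using inner_matrix_symmetric[OF sym, of v w] by (simp add: inner_commute)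
    have "v + t *\<^sub>R w \<in> S" using w vS S by (simp add: subspace_add subspace_scale)
    from q[OF this] have "l + 2 * t * (w \<bullet> (A *v v)) + t\<^sup>2 * (w \<bullet> (A *v w)) \<le> l * (1 + t\<^sup>2 * (w \<bullet> w))"
      using w vw by (simp add: matrix_vector_right_distrib matrix_vector_mult_scaleR inner_add_left
         inner_add_right vv l_def[symmetric] power2_eq_square inner_commute[of v w] algebra_simps)
    then show "t * (w \<bullet> (A *v v)) \<le> t\<^sup>2 * ((l * (w \<bullet> w) - w \<bullet> (A *v w)) / 2)"
      by (simp add: algebra_simps)
  qed
  \<comment> \<open>The component of \<open>A v\<close> orthogonal to \<open>v\<close>.\<close>
  define w where "w = A *v v - l *\<^sub>R v"
  have "w \<in> S" unfolding w_def using vS S inv by (simp add: subspace_diff subspace_scale)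
  moreover have wv: "w \<bullet> v = 0"
    by (simp add: w_def inner_diff_left vv) (simp add: l_def inner_commute)
  ultimately have "w \<bullet> (A *v v) = 0" using orth by blast
  moreover have "w \<bullet> w = w \<bullet> (A *v v) - l * (w \<bullet> v)"
    unfolding inner_scaleR_right[symmetric] inner_diff_right[symmetric] w_def ..
  ultimately have "w = 0" using wv by simp
  then have "A *v v = l *\<^sub>R v" by (simp add: w_def)
  then show ?thesis using vS nv by blast
qed

text \<open>The orthogonal complement of an eigenvector in an invariant subspace is again invariant, so eigenvectors can be
split off one at a time.\<close>

lemma symmetric_orthonormal_eigenvectors:
  fixes A :: "real^'n::finite^'n"
  assumes sym: "transpose A = A"
  shows "subspace S \<Longrightarrow> (\<And>x. x \<in> S \<Longrightarrow> A *v x \<in> S) \<Longrightarrow> dim S = k \<Longrightarrow>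
    \<exists>B. B \<subseteq> S \<and> finite B \<and> card B = k \<and> pairwise orthogonal B \<and>
        (\<forall>v\<in>B. norm v = 1 \<and> (\<exists>l. A *v v = l *\<^sub>R v))"
proof (induction k arbitrary: S)
  case 0
  then show ?case by (intro exI[of _ "{}"]) auto
next
  case (Suc k)
  have "S \<noteq> {0}" using Suc.prems(3) by auto
  from symmetric_eigenvector_in_subspace[OF sym Suc.prems(1) this Suc.prems(2)]
  obtain v l where v: "v \<in> S" "norm v = 1" "A *v v = l *\<^sub>R v" by blast
  define S' where "S' = {y \<in> S. \<forall>x\<in>span {v}. orthogonal x y}"
  have S'_eq: "S' = {y \<in> S. v \<bullet> y = 0}"
    unfolding S'_def orthogonal_def by (auto simp: span_singleton span_base)
  have "dim S' + dim (span {v}) = dim S"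
    unfolding S'_def
    using v Suc.prems by (intro dim_subspace_orthogonal_to_vectors span_minimal) auto
  moreover have "dim (span {v}) = 1" using v by (auto simp: dim_insert)
  ultimately have dim: "dim S' = k" using Suc.prems by simp
  have sub: "subspace S'"
    using Suc.prems(1) unfolding S'_eq subspace_def by (auto simp: inner_add_right)
  have inv: "A *v x \<in> S'" if "x \<in> S'" for x
    using that Suc.prems(2) inner_matrix_symmetric[OF sym, of v x] v by (auto simp: S'_eq)
  obtain B where B: "B \<subseteq> S'" "finite B" "card B = k" "pairwise orthogonal B"
        "\<forall>v\<in>B. norm v = 1 \<and> (\<exists>l. A *v v = l *\<^sub>R v)"
    using Suc.IH[OF sub inv dim] by blast
  have "v \<notin> B" using B(1) v by (auto simp: S'_eq)
  moreover have "pairwise orthogonal (insert v B)"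
    using B(1,4) by (auto simp: pairwise_insert S'_eq orthogonal_def inner_commute)
  ultimately show ?case
    using B v by (intro exI[of _ "insert v B"]) (auto simp: S'_eq)
qed

definition diag :: "('n \<Rightarrow> real) \<Rightarrow> real^'n::finite^'n" where
  "diag m = (\<chi> i j. if i = j then m i else 0)"

lemma diag_mult: "diag m ** diag k = diag (\<lambda>i. m i * k i)"
  by (simp add: diag_def matrix_matrix_mult_def vec_eq_iff if_distrib[of "\<lambda>x. x * _"] sum.delta cong: if_cong)

lemma transpose_diag: "transpose (diag m) = diag m"
  by (simp add: diag_def transpose_def vec_eq_iff)

lemma det_diag: "det (diag m) = prod m UNIV"
  unfolding diag_def by (subst det_diagonal) auto

lemma symmetric_diagonalizable:
  fixes A :: "real^'n::finite^'n"
  assumes sym: "transpose A = A"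
  obtains Q m where "orthogonal_matrix Q" "A = Q ** diag m ** transpose Q"
proof -
  obtain B :: "(real^'n) set" where B: "finite B" "card B = CARD('n)" "pairwise orthogonal B"
        "\<forall>v\<in>B. norm v = 1 \<and> (\<exists>l. A *v v = l *\<^sub>R v)"
    using symmetric_orthonormal_eigenvectors[OF sym, of UNIV "CARD('n)"] by auto
  obtain f :: "'n \<Rightarrow> real^'n" where f: "bij_betw f UNIV B"
    using finite_same_card_bij[of "UNIV :: 'n set" B] B by auto
  then have fB: "f i \<in> B" for i by (auto simp: bij_betw_def)
  have "\<forall>i. \<exists>l. A *v f i = l *\<^sub>R f i" using B(4) fB by blast
  then obtain m where m: "\<And>i. A *v f i = m i *\<^sub>R f i" by metis
  have ff: "f i \<bullet> f j = (if i = j then 1 else 0)" for i j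
  proof (cases "i = j")
    case True then show ?thesis using B(4) fB[of i] by (simp add: dot_square_norm)
  next
    case False
    then have "f i \<noteq> f j" using f by (auto simp: bij_betw_def inj_on_def)
    then show ?thesis using B(3) fB False by (auto simp: pairwise_def orthogonal_def)
  qed
  define Q :: "real^'n^'n" where "Q = (\<chi> i j. f j $ i)"
  have QQ: "transpose Q ** Q = mat 1"
    using ff by (simp add: Q_def transpose_def matrix_matrix_mult_def mat_def vec_eq_iff inner_vec_def)
  then have Q: "orthogonal_matrix Q" by (simp add: orthogonal_matrix)
  have "A ** Q = Q ** diag m"
  proof -
    have "(A ** Q) $ i $ j = (A *v f j) $ i" for i j
      by (simp add: Q_def matrix_matrix_mult_def matrix_vector_mult_def)
    moreover have "(Q ** diag m) $ i $ j = m j * f j $ i" for i j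
      by (simp add: Q_def diag_def matrix_matrix_mult_def if_distrib[of "\<lambda>x. _ * x"] sum.delta cong: if_cong)
    ultimately show ?thesis by (simp add: vec_eq_iff m)
  qed
  then have "A ** (Q ** transpose Q) = Q ** diag m ** transpose Q"
    by (simp add: matrix_mul_assoc)
  then have "A = Q ** diag m ** transpose Q"
    using Q by (simp add: orthogonal_matrix_def)
  with Q that show thesis by blast
qed

lemma orthogonal_conjugate_cancel:
  fixes Q :: "real^'n::finite^'n"
  assumes "orthogonal_matrix Q"
  shows "transpose Q ** (Q ** D ** transpose Q) ** Q = D"
  using assms by (simp add: orthogonal_matrix_def matrix_mul_assoc[symmetric])
    (simp add: matrix_mul_assoc)

lemma trace_orthogonal_conjugate:
  fixes Q :: "real^'n::finite^'n"
  assumes "orthogonal_matrix Q"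
  shows "trace (Q ** D ** transpose Q) = trace D"
  by (metis assms matrix_mul_assoc matrix_mul_lid orthogonal_matrix_def trace_mul_sym)

lemma det_orthogonal_conjugate:
  fixes Q :: "real^'n::finite^'n"
  assumes "orthogonal_matrix Q"
  shows "det (Q ** D ** transpose Q) = det D"
proof -
  have "det Q * det Q = 1" using det_orthogonal_matrix[OF assms] by auto
  then show ?thesis by (simp add: det_mul det_transpose)
qed

lemma nonneg_definite_conjugate:
  fixes A Q :: "real^'n::finite^'n"
  assumes "sym_nonneg_definite A"
  shows "sym_nonneg_definite (transpose Q ** A ** Q)"
proof -
  have "v \<bullet> (transpose Q ** A ** Q *v v) = (Q *v v) \<bullet> (A *v (Q *v v))" for v
    by (metis dot_lmul_matrix matrix_vector_mul_assoc vector_transpose_matrix)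
  then show ?thesis
    using assms by (auto simp: sym_nonneg_definite_def matrix_transpose_mul matrix_mul_assoc)
qed

lemma nonneg_definite_diagonal_entry:
  assumes "sym_nonneg_definite (A :: real^'n::finite^'n)"
  shows "0 \<le> A $ i $ i"
proof -
  have "axis i 1 \<bullet> (A *v axis i 1) = A $ i $ i"
    by (simp add: inner_axis' matrix_vector_mult_basis column_def)
  then show ?thesis using assms unfolding sym_nonneg_definite_def by metis
qed

lemma nonneg_definite_diagonalizable:
  fixes A :: "real^'n::finite^'n"
  assumes A: "sym_nonneg_definite A"
  obtains Q m where "orthogonal_matrix Q" "A = Q ** diag m ** transpose Q" "\<And>i. 0 \<le> m i"
proof -
  obtain Q m where Q: "orthogonal_matrix Q" "A = Q ** diag m ** transpose Q"
    using symmetric_diagonalizable A unfolding sym_nonneg_definite_def by metis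
  have "diag m = transpose Q ** A ** Q"
    using orthogonal_conjugate_cancel[OF Q(1), of "diag m"] Q(2) by simp
  then have "sym_nonneg_definite (diag m)" using nonneg_definite_conjugate[OF A] by metis
  then have "0 \<le> m i" for i using nonneg_definite_diagonal_entry[of "diag m" i] by (simp add: diag_def)
  with Q that show thesis by blast
qed

lemma prod_le_sum_power:
  fixes m :: "'n::finite \<Rightarrow> real"
  assumes "\<And>i. 0 \<le> m i"
  shows "prod m UNIV \<le> (sum m UNIV) ^ CARD('n)"
proof -
  have "prod m UNIV \<le> prod (\<lambda>_::'n. sum m UNIV) UNIV"
    by (intro prod_mono) (auto simp: assms intro: member_le_sum)
  then show ?thesis by simp
qed

text \<open>The crude bound \<open>tr\<^sup>n\<close>, without the constant of the arithmetic-geometric mean inequality, suffices because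
constants are absorbed in \<open>N\<close>.\<close>

lemma nonneg_definite_det_bounds:
  fixes A :: "real^'n::finite^'n"
  assumes A: "sym_nonneg_definite A"
  shows "0 \<le> det A" "det A \<le> trace A ^ CARD('n)"
proof -
  obtain Q m where Q: "orthogonal_matrix Q" "A = Q ** diag m ** transpose Q" "\<And>i. 0 \<le> m i"
    using nonneg_definite_diagonalizable[OF A] by blast
  have "det A = prod m UNIV" using Q by (simp add: det_orthogonal_conjugate det_diag)
  moreover have "trace A = sum m UNIV"
    using Q by (simp add: trace_orthogonal_conjugate) (simp add: trace_def diag_def)
  ultimately show "0 \<le> det A" "det A \<le> trace A ^ CARD('n)"
    using Q prod_le_sum_power[of m] by (auto intro: prod_nonneg)
qed

lemma nonneg_definite_sqrt:
  fixes A :: "real^'n::finite^'n"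
  assumes A: "sym_nonneg_definite A"
  obtains R where "transpose R = R" "A = R ** R"
proof -
  obtain Q m where Q: "orthogonal_matrix Q" "A = Q ** diag m ** transpose Q" "\<And>i. 0 \<le> m i"
    using nonneg_definite_diagonalizable[OF A] by blast
  define R where "R = Q ** diag (\<lambda>i. sqrt (m i)) ** transpose Q"
  have "R ** R = Q ** diag (\<lambda>i. sqrt (m i)) ** (transpose Q ** Q) ** diag (\<lambda>i. sqrt (m i)) ** transpose Q"
    by (simp add: R_def matrix_mul_assoc)
  also have "\<dots> = Q ** (diag (\<lambda>i. sqrt (m i)) ** diag (\<lambda>i. sqrt (m i))) ** transpose Q"
    using Q(1) by (simp add: orthogonal_matrix_def matrix_mul_assoc)
  also have "\<dots> = A" using Q(2,3) by (simp add: diag_mult)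
  finally have "A = R ** R" by simp
  moreover have "transpose R = R"
    by (simp add: R_def matrix_transpose_mul transpose_diag matrix_mul_assoc)
  ultimately show thesis using that by blast
qed

text \<open>With a symmetric root \<open>B = R R\<close>, the matrix \<open>R A R\<close> is nonnegative definite and has determinant
\<open>det A * det B\<close> and trace \<open>tr (A B)\<close>.\<close>

lemma det_mult_le_trace_power:
  fixes A B :: "real^'n::finite^'n"
  assumes A: "sym_nonneg_definite A" and B: "sym_nonneg_definite B"
  shows "det A * det B \<le> trace (A ** B) ^ CARD('n)" "0 \<le> trace (A ** B)"
proof -
  obtain R where R: "transpose R = R" "B = R ** R" using nonneg_definite_sqrt[OF B] by blast
  define C where "C = R ** A ** R"
  have C: "sym_nonneg_definite C" using nonneg_definite_conjugate[OF A, of R] R by (simp add: C_def)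
  have tr: "trace C = trace (A ** B)"
    by (metis C_def R(2) matrix_mul_assoc trace_mul_sym)
  have "det C = det A * det B" by (simp add: C_def R(2) det_mul)
  then show "det A * det B \<le> trace (A ** B) ^ CARD('n)"
    using nonneg_definite_det_bounds(2)[OF C] tr by simp
  have "0 \<le> trace C" unfolding trace_def by (intro sum_nonneg nonneg_definite_diagonal_entry C)
  then show "0 \<le> trace (A ** B)" using tr by simp
qed

text \<open>In an eigenbasis of \<open>B\<close>, the trace of \<open>A B\<close> is the sum of the diagonal entries of \<open>A\<close> weighted by the eigenvalues
of \<open>B\<close>.  If these were all positive, all diagonal entries of \<open>A\<close> would vanish.  This settles the points where
\<open>L0 u = 0\<close>, including those with \<open>det a = 0\<close>.\<close>

lemma det_eq_0_if_trace_mult_eq_0: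
  fixes A B :: "real^'n::finite^'n"
  assumes A: "sym_nonneg_definite A" and B: "sym_nonneg_definite B"
    and 0: "trace (A ** B) = 0" and tr: "trace A > 0"
  shows "det B = 0"
proof (rule ccontr)
  assume det: "det B \<noteq> 0"
  obtain Q m where Q: "orthogonal_matrix Q" "B = Q ** diag m ** transpose Q" "\<And>i. 0 \<le> m i"
    using nonneg_definite_diagonalizable[OF B] by blast
  have "det B = prod m UNIV" using Q by (simp add: det_orthogonal_conjugate det_diag)
  then have m: "m i > 0" for i using Q(3)[of i] det by (auto simp: less_le)
  define C where "C = transpose Q ** A ** Q"
  have C: "sym_nonneg_definite C" unfolding C_def by (rule nonneg_definite_conjugate[OF A])
  have "trace (A ** B) = trace (C ** diag m)"
    unfolding C_def Q(2) by (metis matrix_mul_assoc trace_mul_sym)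
  also have "\<dots> = (\<Sum>i\<in>UNIV. C $ i $ i * m i)"
    by (simp add: trace_def diag_def matrix_matrix_mult_def if_distrib[of "\<lambda>x. _ * x"] sum.delta cong: if_cong)
  finally have "(\<Sum>i\<in>UNIV. C $ i $ i * m i) = 0" using 0 by simp
  then have "\<forall>i\<in>UNIV. C $ i $ i * m i = 0"
    by (subst (asm) sum_nonneg_eq_0_iff) (auto simp: nonneg_definite_diagonal_entry[OF C] Q(3))
  then have "C $ i $ i = 0" for i using m[of i] by (auto simp: less_le)
  then have "trace C = 0" by (simp add: trace_def)
  moreover have "trace C = trace A"
    unfolding C_def by (metis Q(1) matrix_mul_assoc matrix_mul_rid orthogonal_matrix_def trace_mul_sym)
  ultimately show False using tr by simp
qed

section \<open>The volume of an image under a differentiable map\<close>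

text \<open>The area inequality \<open>measure_differentiable_image\<close> concerns spaces whose index type is well-ordered.  An
initial segment of the naturals of the size of \<open>'n\<close> serves as a well-ordered copy of \<open>'n\<close>, and renaming
coordinates along a bijection changes neither volumes nor determinants.\<close>

typedef ('n::finite) idx = "{..<CARD('n)}"
  by (rule exI[of _ 0]) simp

instantiation idx :: (finite) wellorder
begin
definition "i \<le> j \<longleftrightarrow> Rep_idx i \<le> Rep_idx j"
definition "i < j \<longleftrightarrow> Rep_idx i < Rep_idx j"
instance
proof
  fix P :: "'a idx \<Rightarrow> bool" and a
  assume step: "\<And>x. (\<And>y. y < x \<Longrightarrow> P y) \<Longrightarrow> P x"
  show "P a"
  proof (induction a rule: measure_induct_rule[of Rep_idx])
    case (less x)
    show ?case by (rule step, rule less) (simp only: less_idx_def)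
  qed
qed (auto simp: less_eq_idx_def less_idx_def Rep_idx_inject)
end

instance idx :: (finite) finite
proof
  have "(UNIV :: 'a idx set) = Abs_idx ` {..<CARD('a)}"
    using type_definition.Abs_image[OF type_definition_idx[where 'n='a]] by simp
  then show "finite (UNIV :: 'a idx set)" by (metis finite_imageI finite_lessThan)
qed

lemma ex_bij_idx: "\<exists>c :: 'n::finite \<Rightarrow> 'n idx. bij c"
proof -
  have "CARD('n idx) = CARD('n)"
    using type_definition.card[OF type_definition_idx] by simp
  then show ?thesis using finite_same_card_bij[of "UNIV::'n set" "UNIV::'n idx set"] by simp
qed

definition reindex :: "('n \<Rightarrow> 'm) \<Rightarrow> real^'m::finite \<Rightarrow> real^'n::finite" where
  "reindex c y = (\<chi> i. y $ c i)"

lemma linear_reindex: "linear (reindex c)"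
  by (rule linearI) (auto simp: reindex_def vec_eq_iff)

lemma reindex_inverse: "bij c \<Longrightarrow> reindex c (reindex (inv c) x) = x"
  by (simp add: reindex_def vec_eq_iff bij_is_inj)

lemma reindex_inverse': "bij c \<Longrightarrow> reindex (inv c) (reindex c x) = x"
  by (simp add: reindex_def vec_eq_iff bij_is_surj surj_f_inv_f)

lemma measurable_reindex [measurable]: "reindex c \<in> borel_measurable borel"
  by (intro borel_measurable_continuous_onI linear_continuous_on linear_conv_bounded_linear[THEN iffD1] linear_reindex)

lemma distr_reindex:
  fixes c :: "'n::finite \<Rightarrow> 'm::finite"
  assumes c: "bij c"
  shows "distr lborel lborel (reindex c) = lborel"
proof (rule lborel_eqI[symmetric])
  fix l u :: "real^'n"
  assume lu: "\<And>b. b \<in> Basis \<Longrightarrow> l \<bullet> b \<le> u \<bullet> b"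
  then have le: "l $ i \<le> u $ i" for i by (simp add: cart_eq_inner_axis)
  have "reindex c -` box l u = box (reindex (inv c) l) (reindex (inv c) u)"
  proof -
    have "(\<forall>i. l $ i < y $ c i \<and> y $ c i < u $ i) \<longleftrightarrow> (\<forall>k. l $ inv c k < y $ k \<and> y $ k < u $ inv c k)" for y
      by (metis bij_inv_eq_iff c)
    then show ?thesis by (auto simp: mem_box_cart reindex_def)
  qed
  then have "emeasure (distr lborel lborel (reindex c)) (box l u)
     = emeasure lborel (box (reindex (inv c) l) (reindex (inv c) u))"
    by (simp add: emeasure_distr)
  also have "\<dots> = (\<Prod>b\<in>Basis. (reindex (inv c) u - reindex (inv c) l) \<bullet> b)"
    using le by (intro emeasure_lborel_box) (auto simp: Basis_vec_def inner_axis reindex_def)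
  also have "(\<Prod>b\<in>Basis. (reindex (inv c) u - reindex (inv c) l) \<bullet> b) = (\<Prod>k\<in>UNIV. u $ inv c k - l $ inv c k)"
    by (simp add: Basis_vec_def UNION_singleton_eq_range prod.reindex inj_on_def axis_eq_axis inner_axis reindex_def)
  also have "\<dots> = (\<Prod>i\<in>UNIV. u $ i - l $ i)"
    by (rule prod.reindex_bij_betw) (use c in \<open>simp add: bij_imp_bij_inv\<close>)
  also have "\<dots> = (\<Prod>b\<in>Basis. (u - l) \<bullet> b)"
    by (simp add: Basis_vec_def UNION_singleton_eq_range prod.reindex inj_on_def axis_eq_axis inner_axis)
  finally show "emeasure (distr lborel lborel (reindex c)) (box l u) = (\<Prod>b\<in>Basis. (u - l) \<bullet> b)" .
qed simp

lemma det_reindex: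
  fixes A :: "real^'n::finite^'n" and b :: "'m::finite \<Rightarrow> 'n"
  assumes b: "bij b"
  shows "det (\<chi> k l. A $ b k $ b l) = det A"
proof -
  define g :: "('m \<Rightarrow> 'm) \<Rightarrow> 'n \<Rightarrow> 'n" where "g = map_permutation UNIV b"
  have g: "g p = b \<circ> p \<circ> inv b" for p
    using b by (simp add: g_def map_permutation_def restrict_id_def bij_is_surj fun_eq_iff)
  have bij_g: "bij_betw g {p. p permutes UNIV} {p. p permutes UNIV}"
  proof (rule bij_betw_byWitness[where f' = "\<lambda>q. inv b \<circ> q \<circ> b"])
    show "\<forall>p\<in>{p. p permutes UNIV}. inv b \<circ> g p \<circ> b = p"
      using b by (auto simp: g fun_eq_iff bij_is_inj)
    show "\<forall>q\<in>{p. p permutes UNIV}. g (inv b \<circ> q \<circ> b) = q"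
      using b by (auto simp: g fun_eq_iff bij_is_surj surj_f_inv_f)
    show "g ` {p. p permutes UNIV} \<subseteq> {p. p permutes UNIV}"
      using b by (auto simp: g intro!: bij_imp_permutes bij_comp bij_imp_bij_inv dest: permutes_bij)
    show "(\<lambda>q. inv b \<circ> q \<circ> b) ` {p. p permutes UNIV} \<subseteq> {p. p permutes UNIV}"
      using b by (auto intro!: bij_imp_permutes bij_comp bij_imp_bij_inv dest: permutes_bij)
  qed
  have "det A = (\<Sum>p | p permutes UNIV. of_int (sign (g p)) * (\<Prod>i\<in>UNIV. A $ i $ g p i))"
    unfolding det_def by (rule sum.reindex_bij_betw[OF bij_g, symmetric])
  also have "\<dots> = (\<Sum>p | p permutes UNIV. of_int (sign p) * (\<Prod>k\<in>UNIV. A $ b k $ b (p k)))"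
  proof (intro sum.cong refl)
    fix p :: "'m \<Rightarrow> 'm" assume "p \<in> {p. p permutes UNIV}"
    then have "sign (g p) = sign p"
      unfolding g_def using b by (intro sign_map_permutation) (auto simp: bij_def)
    moreover have "(\<Prod>i\<in>UNIV. A $ i $ g p i) = (\<Prod>k\<in>UNIV. A $ b k $ g p (b k))"
      by (rule prod.reindex_bij_betw[symmetric]) (use b in simp)
    moreover have "g p (b k) = b (p k)" for k using b by (simp add: g bij_is_inj)
    ultimately show "of_int (sign (g p)) * (\<Prod>i\<in>UNIV. A $ i $ g p i)
       = (of_int (sign p) * (\<Prod>k\<in>UNIV. A $ b k $ b (p k)) :: real)" by simp
  qed
  finally show ?thesis by (simp add: det_def)
qed

lemma measure_image_le_integral_det_wellorder:
  fixes f :: "real^'n::{finite,wellorder} \<Rightarrow> real^'n::_" and A :: "real^'n::_ \<Rightarrow> real^'n::_^'n::_"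
  assumes S: "S \<in> sets borel" and P: "P \<in> sets borel" "P \<subseteq> f ` S"
    and f: "\<And>x. x \<in> S \<Longrightarrow> (f has_derivative (\<lambda>h. A x *v h)) (at x)"
    and int: "integrable lborel (\<lambda>x. indicator S x * \<bar>det (A x)\<bar>)"
  shows "measure lborel P \<le> (\<integral>x. indicator S x * \<bar>det (A x)\<bar> \<partial>lborel)"
proof -
  have eq: "(\<lambda>x. indicator S x * \<bar>det (A x)\<bar>) = (\<lambda>x. if x \<in> S then \<bar>det (matrix ((*v) (A x)))\<bar> else 0)"
    by (auto simp: fun_eq_iff)
  have 1: "(\<lambda>x. \<bar>det (matrix ((*v) (A x)))\<bar>) integrable_on S"
    using integrable_on_lborel[OF int] unfolding eq integrable_restrict_UNIV .
  have fS: "(f has_derivative (*v) (A x)) (at x within S)" if "x \<in> S" for x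
    using f[OF that] by (rule has_derivative_at_withinI)
  have SL: "S \<in> sets lebesgue" using S by simp
  have "measure lborel P = measure lebesgue P" using P by (simp add: measure_completion)
  also have "\<dots> \<le> measure lebesgue (f ` S)"
    using P by (intro measure_mono_fmeasurable measurable_differentiable_image[OF SL fS 1]) auto
  also have "\<dots> \<le> integral S (\<lambda>x. \<bar>det (matrix ((*v) (A x)))\<bar>)"
    by (rule measure_differentiable_image[OF SL fS 1])
  also have "\<dots> = integral UNIV (\<lambda>x. indicator S x * \<bar>det (A x)\<bar>)"
    unfolding eq by (rule integral_restrict_UNIV[symmetric])
  also have "\<dots> = (\<integral>x. indicator S x * \<bar>det (A x)\<bar> \<partial>lborel)"
    by (rule integral_lborel[OF int])
  finally show ?thesis .
qed

text \<open>The map \<open>f\<close> is conjugated with a renaming of the coordinates to carry the inequality over to an arbitrary finite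
index type.\<close>

lemma measure_image_le_integral_det:
  fixes f :: "real^'n::finite \<Rightarrow> real^'n" and A :: "real^'n \<Rightarrow> real^'n^'n"
  assumes S: "S \<in> sets borel" and P: "P \<in> sets borel" "P \<subseteq> f ` S"
    and f: "\<And>x. x \<in> S \<Longrightarrow> (f has_derivative (\<lambda>h. A x *v h)) (at x)"
    and int: "integrable lborel (\<lambda>x. indicator S x * \<bar>det (A x)\<bar>)"
  shows "measure lborel P \<le> (\<integral>x. indicator S x * \<bar>det (A x)\<bar> \<partial>lborel)"
proof -
  obtain c :: "'n \<Rightarrow> 'n idx" where c: "bij c" using ex_bij_idx by blast
  define J J' where "J = (reindex (inv c) :: real^'n \<Rightarrow> real^'n idx)" and "J' = (reindex c :: real^'n idx \<Rightarrow> real^'n)"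
  have JJ: "J' (J x) = x" "J (J' y) = y" for x y
    using c by (auto simp: J_def J'_def reindex_inverse reindex_inverse')
  have [measurable]: "J' \<in> borel_measurable borel" by (simp add: J'_def)
  have distr: "distr lborel lborel J' = lborel" unfolding J'_def by (rule distr_reindex[OF c])
  define A' where "A' y = (\<chi> k l. A (J' y) $ inv c k $ inv c l)" for y
  have detA': "det (A' y) = det (A (J' y))" for y
    unfolding A'_def by (rule det_reindex) (simp add: c bij_imp_bij_inv)
  have A'_mult: "J (A (J' y) *v J' h) = A' y *v h" for y h
  proof -
    have "(\<Sum>j\<in>UNIV. A (J' y) $ inv c k $ j * h $ c j) = (\<Sum>l\<in>UNIV. A (J' y) $ inv c k $ inv c l * h $ c (inv c l))" for k
      by (rule sum.reindex_bij_betw[symmetric]) (simp add: c bij_imp_bij_inv)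
    then show ?thesis
      using c by (simp add: J_def J'_def A'_def reindex_def vec_eq_iff matrix_vector_mult_def bij_is_surj surj_f_inv_f)
  qed
  have bl: "bounded_linear J" "bounded_linear J'"
    by (auto simp: J_def J'_def linear_reindex linear_conv_bounded_linear[symmetric])
  define S' where "S' = J' -` S"
  define P' where "P' = J' -` P"
  have "measure lborel P = measure (distr lborel lborel J') P" by (simp add: distr)
  also have "\<dots> = measure lborel P'" using P by (simp add: measure_distr P'_def)
  also have "\<dots> \<le> (\<integral>y. indicator S' y * \<bar>det (A' y)\<bar> \<partial>lborel)"
  proof (rule measure_image_le_integral_det_wellorder[where f = "J \<circ> f \<circ> J'"])
    show "S' \<in> sets borel" "P' \<in> sets borel"
      using measurable_sets_borel[of J' borel S] measurable_sets_borel[of J' borel P] S P by (auto simp: S'_def P'_def)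
    show "P' \<subseteq> (J \<circ> f \<circ> J') ` S'"
    proof
      fix p assume "p \<in> P'"
      then obtain x where x: "x \<in> S" "J' p = f x" using P(2) by (auto simp: P'_def)
      then have "J x \<in> S'" "p = (J \<circ> f \<circ> J') (J x)" by (auto simp: S'_def JJ) (metis JJ)
      then show "p \<in> (J \<circ> f \<circ> J') ` S'" by blast
    qed
    fix y assume "y \<in> S'"
    then have "(f has_derivative (\<lambda>h. A (J' y) *v h)) (at (J' y))" by (auto simp: S'_def intro: f)
    then have "(J \<circ> f \<circ> J' has_derivative (\<lambda>h. J (A (J' y) *v J' h))) (at y)"
      using has_derivative_compose[OF bounded_linear_imp_has_derivative[OF bl(2)]
          has_derivative_compose[OF _ bounded_linear_imp_has_derivative[OF bl(1)]]]
      by (simp add: comp_def)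
    then show "(J \<circ> f \<circ> J' has_derivative (\<lambda>h. A' y *v h)) (at y)" by (simp add: A'_mult)
  next
    show "integrable lborel (\<lambda>y. indicator S' y * \<bar>det (A' y)\<bar>)"
      using integrable_distr[of J' lborel lborel "\<lambda>x. indicator S x * \<bar>det (A x)\<bar>"] int distr
      by (simp add: detA' S'_def indicator_def)
  qed
  also have "\<dots> = (\<integral>y. indicator S (J' y) * \<bar>det (A (J' y))\<bar> \<partial>lborel)"
    by (simp add: detA' S'_def indicator_def)
  also have "\<dots> = (\<integral>x. indicator S x * \<bar>det (A x)\<bar> \<partial>distr lborel lborel J')"
    by (rule integral_distr[symmetric]) (use int in auto)
  finally show ?thesis by (simp add: distr)
qed

section \<open>A smooth bump function\<close>

text \<open>The family is closed under differentiation up to linear combinations; \<open>k = 0\<close> is the standard smooth function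
that vanishes on the negative half-line.\<close>

definition bump_exp :: "nat \<Rightarrow> real \<Rightarrow> real" where
  "bump_exp k t = (if t > 0 then exp (- (1 / t)) / t ^ k else 0)"

lemma bump_exp_nonneg: "0 \<le> bump_exp k t"
  by (simp add: bump_exp_def)

lemma bump_exp_tendsto_0: "(bump_exp k \<longlongrightarrow> 0) (at 0)"
proof (rule filterlim_split_at)
  have "((\<lambda>t. 0) \<longlongrightarrow> (0::real)) (at_left 0)" by simp
  then show "(bump_exp k \<longlongrightarrow> 0) (at_left 0)"
    by (rule Lim_transform_eventually) (auto simp: bump_exp_def eventually_at_filter)
  have "((\<lambda>t. (inverse t) ^ k / exp (inverse t)) \<longlongrightarrow> (0::real)) (at_right 0)"
    by (rule filterlim_compose[OF tendsto_power_div_exp_0 filterlim_inverse_at_top_right])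
  then show "(bump_exp k \<longlongrightarrow> 0) (at_right 0)"
    by (rule Lim_transform_eventually)
       (auto simp: bump_exp_def eventually_at_filter exp_minus field_simps)
qed

lemma bump_exp_has_derivative:
  "(bump_exp k has_real_derivative bump_exp (k + 2) t - real k * bump_exp (k + 1) t) (at t)"
proof -
  consider "t > 0" | "t < 0" | "t = 0" by linarith
  then show ?thesis
  proof cases
    case 1
    have D: "((\<lambda>t. exp (- (1 / t)) / t ^ k) has_real_derivative
        (exp (- (1 / t)) * (1 / t\<^sup>2) * t ^ k - exp (- (1 / t)) * (real k * t ^ (k - 1))) / (t ^ k * t ^ k)) (at t)"
      using 1 by (auto intro!: derivative_eq_intros simp: power2_eq_square)
    have "(exp (- (1 / t)) * (1 / t\<^sup>2) * t ^ k - exp (- (1 / t)) * (real k * t ^ (k - 1))) / (t ^ k * t ^ k)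
        = bump_exp (k + 2) t - real k * bump_exp (k + 1) t"
      using 1 by (cases k) (simp_all add: bump_exp_def field_simps power2_eq_square)
    with D have "((\<lambda>t. exp (- (1 / t)) / t ^ k) has_real_derivative
        bump_exp (k + 2) t - real k * bump_exp (k + 1) t) (at t)" by simp
    then show ?thesis
      by (rule has_field_derivative_transform_within_open[of _ _ _ "{0<..}"]) (use 1 in \<open>auto simp: bump_exp_def\<close>)
  next
    case 2
    have "((\<lambda>t. 0) has_real_derivative bump_exp (k + 2) t - real k * bump_exp (k + 1) t) (at t)"
      using 2 by (simp add: bump_exp_def)
    then show ?thesis
      by (rule has_field_derivative_transform_within_open[of _ _ _ "{..<0}"]) (use 2 in \<open>auto simp: bump_exp_def\<close>)
  next
    case 3
    \<comment> \<open>The difference quotient at the origin is \<open>bump_exp (k + 1)\<close>.\<close>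
    have "((\<lambda>h. (bump_exp k (0 + h) - bump_exp k 0) / h) \<longlongrightarrow> 0) (at 0)"
      by (rule Lim_transform_eventually[OF bump_exp_tendsto_0[of "Suc k"]])
         (auto simp: bump_exp_def eventually_at_filter)
    then show ?thesis using 3 by (simp add: DERIV_def bump_exp_def)
  qed
qed

text \<open>The smooth function \<open>bump 0 e x\<close> is supported in the ball of radius \<open>e\<close> about \<open>x\<close>; the other values of \<open>k\<close>
appear in its derivatives.\<close>

definition bump :: "nat \<Rightarrow> real \<Rightarrow> real^'n::finite \<Rightarrow> real^'n \<Rightarrow> real" where
  "bump k e x y = bump_exp k (e\<^sup>2 - (norm (y - x))\<^sup>2)"

lemma bump_commute: "bump k e x y = bump k e y x"
  by (simp add: bump_def norm_minus_commute)

lemma bump_nonneg: "0 \<le> bump k e x y"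
  by (simp add: bump_def bump_exp_nonneg)

lemma bump_eq_0:
  assumes "0 \<le> e" "e \<le> norm (y - x)"
  shows "bump k e x y = 0"
proof -
  have "e\<^sup>2 \<le> (norm (y - x))\<^sup>2" using assms by (intro power_mono)
  then show ?thesis by (simp add: bump_def bump_exp_def)
qed

lemma isCont_bump_exp: "isCont (bump_exp k) t"
  using DERIV_isCont bump_exp_has_derivative by blast

lemma continuous_on_bump_exp [continuous_intros]:
  "continuous_on S f \<Longrightarrow> continuous_on S (\<lambda>x. bump_exp k (f x))"
  using continuous_on_compose2[of UNIV "bump_exp k" S f]
  by (simp add: continuous_at_imp_continuous_on isCont_bump_exp)

lemma continuous_on_bump [continuous_intros]:
  "continuous_on S f \<Longrightarrow> continuous_on S g \<Longrightarrow> continuous_on S (\<lambda>x. bump k e (f x) (g x))"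
  unfolding bump_def by (intro continuous_intros)

lemma bump_has_derivative:
  "(bump k e x has_derivative
     (\<lambda>h. (bump (k + 2) e x y - real k * bump (k + 1) e x y) * (- 2 * ((y - x) \<bullet> h)))) (at y)"
proof -
  have "((\<lambda>y. e\<^sup>2 - (norm (y - x))\<^sup>2) has_derivative (\<lambda>h. - 2 * ((y - x) \<bullet> h))) (at y)"
    unfolding power2_norm_eq_inner by (auto intro!: derivative_eq_intros simp: inner_commute)
  from has_derivative_compose[OF this bump_exp_has_derivative[of k "e\<^sup>2 - (norm (y - x))\<^sup>2",
      unfolded has_field_derivative_def]]
  show ?thesis by (simp add: bump_def[abs_def])
qed

text \<open>An algebra of functions that is closed under all partial derivatives.  It makes smoothness of the bump a
matter of induction instead of an explicit formula for derivatives of every order.\<close>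

inductive_set bump_algebra :: "real \<Rightarrow> real^'n::finite \<Rightarrow> (real^'n \<Rightarrow> real) set"
  for e :: real and x :: "real^'n" where
  const: "(\<lambda>y. c) \<in> bump_algebra e x"
| coordinate: "(\<lambda>y. y $ i) \<in> bump_algebra e x"
| bump: "bump k e x \<in> bump_algebra e x"
| add: "f \<in> bump_algebra e x \<Longrightarrow> g \<in> bump_algebra e x \<Longrightarrow> (\<lambda>y. f y + g y) \<in> bump_algebra e x"
| mult: "f \<in> bump_algebra e x \<Longrightarrow> g \<in> bump_algebra e x \<Longrightarrow> (\<lambda>y. f y * g y) \<in> bump_algebra e x"

lemma partial_deriv_eqI:
  assumes "\<And>y. (f has_derivative f' y) (at y)"
  shows "partial_deriv i f = (\<lambda>y. f' y (axis i 1))"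
  unfolding partial_deriv_def by (metis assms frechet_derivative_at)

lemma partial_deriv_bump:
  "partial_deriv i (bump k e x) =
     (\<lambda>y. (bump (k + 2) e x y - real k * bump (k + 1) e x y) * (- 2 * (y $ i - x $ i)))"
  by (subst partial_deriv_eqI[OF bump_has_derivative]) (simp add: inner_axis)

lemma bump_algebra_closed:
  fixes x :: "real^'n::finite"
  assumes "f \<in> bump_algebra e x"
  shows "(\<forall>y. f differentiable (at y)) \<and> (\<forall>i. partial_deriv i f \<in> bump_algebra e x)"
  using assms
proof induction
  case (const c)
  have "partial_deriv i (\<lambda>y::real^'n. c) = (\<lambda>y. 0)" for i
    by (rule partial_deriv_eqI) (rule has_derivative_const)
  then show ?case by (simp add: bump_algebra.const)
next
  case (coordinate j)
  have d: "((\<lambda>y. y $ j) has_derivative (\<lambda>h. h $ j)) (at y)" for y :: "real^'n"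
    by (intro bounded_linear_imp_has_derivative bounded_linear_vec_nth)
  have "partial_deriv i (\<lambda>y. y $ j) = (\<lambda>y. axis i 1 $ j)" for i by (rule partial_deriv_eqI) (rule d)
  then show ?case using d by (auto intro: bump_algebra.intros simp: differentiable_def)
next
  case (bump k)
  have "(\<lambda>y. (bump (k + 2) e x y + (- real k) * bump (k + 1) e x y) * ((- 2) * (y $ i + (- x $ i)))) \<in> bump_algebra e x" for i
    by (intro bump_algebra.intros)
  then have "partial_deriv i (bump k e x) \<in> bump_algebra e x" for i
    by (simp add: partial_deriv_bump)
  then show ?case using bump_has_derivative[of k e x] unfolding differentiable_def by blast
next
  case (add f g)
  have d: "((\<lambda>y. f y + g y) has_derivative
      (\<lambda>h. frechet_derivative f (at y) h + frechet_derivative g (at y) h)) (at y)" for y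
    using add.IH by (intro has_derivative_add) (simp_all add: frechet_derivative_works[symmetric])
  have "partial_deriv i (\<lambda>y. f y + g y) = (\<lambda>y. partial_deriv i f y + partial_deriv i g y)" for i
    unfolding partial_deriv_def[of i f] partial_deriv_def[of i g] by (rule partial_deriv_eqI) (rule d)
  then show ?case using add d by (auto intro: bump_algebra.intros simp: differentiable_def)
next
  case (mult f g)
  have d: "((\<lambda>y. f y * g y) has_derivative
      (\<lambda>h. f y * frechet_derivative g (at y) h + frechet_derivative f (at y) h * g y)) (at y)" for y
    using mult.IH by (intro has_derivative_mult) (simp_all add: frechet_derivative_works[symmetric])
  have "partial_deriv i (\<lambda>y. f y * g y) = (\<lambda>y. f y * partial_deriv i g y + partial_deriv i f y * g y)" for i
    unfolding partial_deriv_def[of i f] partial_deriv_def[of i g] by (rule partial_deriv_eqI) (rule d)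
  moreover have "(\<lambda>y. f y * partial_deriv i g y + partial_deriv i f y * g y) \<in> bump_algebra e x" for i
    using mult by (intro bump_algebra.add bump_algebra.mult) simp_all
  moreover have "(\<lambda>y. f y * g y) differentiable (at y)" for y
    by (rule differentiableI) (rule d)
  ultimately show ?case by simp
qed

lemma test_function_bump:
  assumes "0 \<le> e" "cball x e \<subseteq> U"
  shows "test_function U (bump k e x)"
proof -
  have "partial_derivs is (bump k e x) \<in> bump_algebra e x" for "is"
  proof (induction "is")
    case Nil
    show ?case by (simp add: partial_derivs_def bump_algebra.bump)
  next
    case (Cons i "is")
    then have "partial_deriv i (partial_derivs is (bump k e x)) \<in> bump_algebra e x"
      using bump_algebra_closed[THEN conjunct2, rule_format] by metis
    then show ?case by (simp add: partial_derivs_def)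
  qed
  then have "partial_derivs is (bump k e x) differentiable (at y)" for "is" y
    using bump_algebra_closed[THEN conjunct1, rule_format] by metis
  moreover have "bump k e x y = 0" if "y \<notin> cball x e" for y
    using that assms(1) by (intro bump_eq_0) (auto simp: dist_norm norm_minus_commute)
  ultimately show ?thesis
    unfolding test_function_def using assms(2) by (intro conjI exI[of _ "cball x e"]) auto
qed

text \<open>The matrix of second derivatives of \<open>bump 0 e x\<close>, see \<open>partial_derivs_bump\<close>.\<close>

definition bump_hess :: "real \<Rightarrow> 'n \<Rightarrow> 'n \<Rightarrow> real^'n::finite \<Rightarrow> real^'n \<Rightarrow> real" where
  "bump_hess e i j x y = 4 * (y $ i - x $ i) * (y $ j - x $ j) * (bump 4 e x y - 2 * bump 3 e x y)
     - (if i = j then 2 * bump 2 e x y else 0)"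

lemma bump_grad_has_derivative:
  "((\<lambda>y. bump 2 e x y * (- 2 * (y $ j - x $ j))) has_derivative
     (\<lambda>h. \<Sum>i\<in>UNIV. h $ i * bump_hess e i j x y)) (at y)"
proof -
  have "((\<lambda>y. bump 2 e x y * (- 2 * (y $ j - x $ j))) has_derivative
     (\<lambda>h. bump 2 e x y * (- 2 * h $ j) +
       (bump (2 + 2) e x y - real 2 * bump (2 + 1) e x y) * (- 2 * ((y - x) \<bullet> h)) * (- 2 * (y $ j - x $ j)))) (at y)"
    by (rule has_derivative_mult[OF bump_has_derivative])
       (auto intro!: derivative_eq_intros bounded_linear_imp_has_derivative bounded_linear_vec_nth)
  moreover have "bump 2 e x y * (- 2 * h $ j) +
       (bump (2 + 2) e x y - real 2 * bump (2 + 1) e x y) * (- 2 * ((y - x) \<bullet> h)) * (- 2 * (y $ j - x $ j))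
      = (\<Sum>i\<in>UNIV. h $ i * bump_hess e i j x y)" for h
  proof -
    have "(\<Sum>i\<in>UNIV. h $ i * bump_hess e i j x y) =
       (\<Sum>i\<in>UNIV. ((y - x) $ i * h $ i) * (4 * (y $ j - x $ j) * (bump 4 e x y - 2 * bump 3 e x y)))
       - (\<Sum>i\<in>UNIV. if i = j then h $ i * (2 * bump 2 e x y) else 0)"
      unfolding sum_subtractf[symmetric] by (intro sum.cong) (auto simp: bump_hess_def algebra_simps)
    also have "\<dots> = ((y - x) \<bullet> h) * (4 * (y $ j - x $ j) * (bump 4 e x y - 2 * bump 3 e x y))
       - h $ j * (2 * bump 2 e x y)"
      by (simp add: inner_vec_def sum_distrib_right)
    finally show ?thesis by (simp add: algebra_simps eval_nat_numeral)
  qed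
  ultimately show ?thesis by simp
qed

lemma partial_derivs_bump:
  "partial_derivs [i, j] (bump 0 e x) = bump_hess e i j x"
proof -
  have 1: "partial_deriv j (bump 0 e x) = (\<lambda>y. bump 2 e x y * (- 2 * (y $ j - x $ j)))"
    by (simp add: partial_deriv_bump numeral_2_eq_2)
  have "partial_derivs [i, j] (bump 0 e x) = partial_deriv i (\<lambda>y. bump 2 e x y * (- 2 * (y $ j - x $ j)))"
    by (simp add: partial_derivs_def 1)
  also have "\<dots> = (\<lambda>y. \<Sum>l\<in>UNIV. axis i 1 $ l * bump_hess e l j x y)"
    by (rule partial_deriv_eqI[OF bump_grad_has_derivative])
  also have "\<dots> = bump_hess e i j x"
    by (simp add: axis_def if_distrib[of "\<lambda>x. x * _"] cong: if_cong)
  finally show ?thesis .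
qed

lemma bump_hess_sym: "bump_hess e i j x y = bump_hess e j i x y"
  by (auto simp: bump_hess_def algebra_simps)

text \<open>Because of this symmetry the second derivatives of \<open>bump 0 e x y\<close> in \<open>x\<close>, which arise when a convolution is
differentiated, agree with those in \<open>y\<close>, which occur in the definition of weak derivatives.\<close>

lemma bump_hess_commute: "bump_hess e i j x y = bump_hess e i j y x"
  by (simp add: bump_hess_def bump_commute[of _ _ x y] algebra_simps)

section \<open>Mollification in L1\<close>

lemma integrable_compact_support:
  fixes f :: "'a::euclidean_space \<Rightarrow> real"
  assumes f: "continuous_on UNIV f" and K: "compact K" "\<And>x. x \<notin> K \<Longrightarrow> f x = 0"
  shows "integrable lborel f"
proof -
  have "integrable lborel (\<lambda>x. indicator K x *\<^sub>R f x)"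
    by (rule borel_integrable_compact) (use f K in \<open>auto intro: continuous_on_subset\<close>)
  moreover have "(\<lambda>x. indicator K x *\<^sub>R f x) = f" using K(2) by (auto simp: fun_eq_iff indicator_def)
  ultimately show ?thesis by simp
qed

lemma abs_lebesgue_integral_le:
  fixes f g :: "'a \<Rightarrow> real"
  assumes f: "integrable M f" and g: "integrable M g" and le: "\<And>x. \<bar>f x\<bar> \<le> g x"
  shows "\<bar>integral\<^sup>L M f\<bar> \<le> integral\<^sup>L M g"
proof -
  have "\<bar>integral\<^sup>L M f\<bar> \<le> (\<integral>x. \<bar>f x\<bar> \<partial>M)" using integral_norm_bound[of M f] by simp
  also have "\<dots> \<le> integral\<^sup>L M g" using f g le by (intro integral_mono) auto
  finally show ?thesis .
qed

text \<open>The integral of \<open>bump 0 e x\<close>, which depends on \<open>e\<close> and the dimension only; the first argument fixes the latter.\<close>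

definition bump_mass :: "'n::finite itself \<Rightarrow> real \<Rightarrow> real" where
  "bump_mass _ e = (\<integral>y. bump 0 e (0 :: real^'n) y \<partial>lborel)"

lemma bump_eq_0_outside_cball: "0 \<le> e \<Longrightarrow> y \<notin> cball x e \<Longrightarrow> bump k e x y = 0"
  by (rule bump_eq_0) (auto simp: dist_norm norm_minus_commute)

lemma integrable_bump: "0 \<le> e \<Longrightarrow> integrable lborel (bump k e x)"
  by (rule integrable_compact_support[of _ "cball x e"])
     (auto intro!: continuous_intros bump_eq_0_outside_cball)

lemma integral_bump:
  "(\<integral>y. bump 0 e x y \<partial>lborel) = bump_mass TYPE('n::finite) e" for x :: "real^'n"
proof -
  have m: "bump 0 e x \<in> borel_measurable borel"
    by (intro borel_measurable_continuous_onI continuous_intros)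
  have "(\<integral>y. bump 0 e x y \<partial>lborel) = (\<integral>y. bump 0 e x y \<partial>distr lborel borel ((+) x))"
    by (simp add: lborel_distr_plus)
  also have "\<dots> = (\<integral>y. bump 0 e x (x + y) \<partial>lborel)"
    using m by (subst integral_distr) auto
  also have "\<dots> = bump_mass TYPE('n) e" by (simp add: bump_mass_def bump_def)
  finally show ?thesis .
qed

lemma bump_mass_pos:
  assumes e: "e > 0" shows "bump_mass TYPE('n::finite) e > 0"
proof -
  define c where "c = exp (- (1 / (e\<^sup>2 / 2)))"
  have le: "indicator (ball 0 (e/2)) y * c \<le> bump 0 e 0 y" for y :: "real^'n"
  proof (cases "norm y < e/2")
    case True
    then have "(norm y)\<^sup>2 < (e/2)\<^sup>2" by (intro power_strict_mono) auto
    then have "4 * (norm y)\<^sup>2 < e\<^sup>2" by (simp add: power_divide)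
    then have "e\<^sup>2 / 2 \<le> e\<^sup>2 - (norm y)\<^sup>2" using zero_le_power2[of "norm y"] by linarith
    moreover have q: "0 < e\<^sup>2 / 2" using e by simp
    ultimately have t: "e\<^sup>2 - (norm y)\<^sup>2 > 0" "1 / (e\<^sup>2 - (norm y)\<^sup>2) \<le> 1 / (e\<^sup>2 / 2)"
      by (linarith, intro frac_le) auto
    have "c \<le> exp (- (1 / (e\<^sup>2 - (norm y)\<^sup>2)))" unfolding c_def using t(2) by simp
    then show ?thesis using t(1) True by (simp add: bump_def bump_exp_def)
  qed (simp add: bump_nonneg)
  have "0 < measure lborel (ball (0::real^'n) (e/2)) * c"
    using e by (auto simp: c_def content_ball_pos)
  also have "\<dots> = (\<integral>y. indicator (ball 0 (e/2)) y * c \<partial>(lborel :: (real^'n) measure))"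
    by simp
  also have "\<dots> \<le> bump_mass TYPE('n) e"
    unfolding bump_mass_def using e le emeasure_bounded_finite[OF bounded_ball[of "0::real^'n" "e/2"]]
    by (intro integral_mono integrable_mult_left integrable_bump) (simp_all add: integrable_indicator_iff)
  finally show ?thesis .
qed

definition mollifier :: "real \<Rightarrow> real^'n::finite \<Rightarrow> real^'n \<Rightarrow> real" where
  "mollifier e x y = bump 0 e x y / bump_mass TYPE('n) e"

definition mollify :: "real \<Rightarrow> (real^'n::finite \<Rightarrow> real) \<Rightarrow> real^'n \<Rightarrow> real" where
  "mollify e f x = (\<integral>y. f y * mollifier e x y \<partial>lborel)"

lemma mollifier_nonneg: "e > 0 \<Longrightarrow> 0 \<le> mollifier e x y"
  unfolding mollifier_def using bump_mass_pos[of e] by (intro divide_nonneg_pos bump_nonneg)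

lemma mollifier_commute: "mollifier e x y = mollifier e y x"
  by (simp add: mollifier_def bump_commute)

lemma mollifier_eq_0: "e > 0 \<Longrightarrow> y \<notin> cball x e \<Longrightarrow> mollifier e x y = 0"
  by (simp add: mollifier_def bump_eq_0_outside_cball)

lemma continuous_on_mollifier [continuous_intros]:
  "continuous_on S f \<Longrightarrow> continuous_on S g \<Longrightarrow> continuous_on S (\<lambda>x. mollifier e (f x) (g x))"
  unfolding mollifier_def divide_inverse by (intro continuous_intros)

lemma measurable_mollifier [measurable]:
  "f \<in> borel_measurable M \<Longrightarrow> g \<in> borel_measurable M \<Longrightarrow> (\<lambda>x. mollifier e (f x) (g x)) \<in> borel_measurable M"
  by (rule borel_measurable_continuous_Pair[where H = "mollifier e"]) (auto intro!: continuous_intros)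

lemma integrable_mollifier: "e > 0 \<Longrightarrow> integrable lborel (mollifier e x)"
  unfolding mollifier_def by (intro integrable_divide_zero integrable_bump) auto

lemma integral_mollifier: "e > 0 \<Longrightarrow> (\<integral>y. mollifier e x y \<partial>lborel) = 1" for x :: "real^'n::finite"
  using bump_mass_pos[of e, where 'n='n] by (simp add: mollifier_def integral_bump)

lemma nn_integral_mollifier: "e > 0 \<Longrightarrow> (\<integral>\<^sup>+y. mollifier e x y \<partial>lborel) = 1"
  by (subst nn_integral_eq_integral) (auto simp: integrable_mollifier integral_mollifier mollifier_nonneg)

lemma mollifier_bounded:
  assumes "e > 0"
  obtains C where "\<And>y. \<bar>mollifier e x y\<bar> \<le> C"
proof -
  have "bounded (mollifier e x ` cball x e)"
    by (intro compact_imp_bounded compact_continuous_image continuous_intros compact_cball)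
  then obtain C where "\<forall>z\<in>mollifier e x ` cball x e. norm z \<le> C"
    unfolding bounded_iff by blast
  then have C: "y \<in> cball x e \<Longrightarrow> \<bar>mollifier e x y\<bar> \<le> C" for y by simp
  have "\<bar>mollifier e x y\<bar> \<le> max C 0" for y
    using C[of y] mollifier_eq_0[OF assms, of y x] by (cases "y \<in> cball x e") (auto simp: max_def)
  then show thesis using that by blast
qed

lemma integrable_mult_mollifier:
  assumes f: "integrable lborel f" and e: "e > 0"
  shows "integrable lborel (\<lambda>y. f y * mollifier e x y)"
proof -
  obtain C where C: "\<And>y. \<bar>mollifier e x y\<bar> \<le> C" using mollifier_bounded[OF e] by blast
  have [measurable]: "f \<in> borel_measurable borel" using f by auto
  show ?thesis
  proof (rule Bochner_Integration.integrable_bound)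
    show "integrable lborel (\<lambda>y. f y * C)" using f by simp
    show "AE y in lborel. norm (f y * mollifier e x y) \<le> norm (f y * C)"
      using C order_trans[OF C abs_ge_self] by (auto simp: abs_mult intro!: mult_left_mono)
  qed measurable
qed

lemma measurable_mollify [measurable]:
  assumes [measurable]: "f \<in> borel_measurable borel"
  shows "mollify e f \<in> borel_measurable borel"
  unfolding mollify_def[abs_def] by measurable

text \<open>By Tonelli, since the kernel is symmetric and has integral \<open>1\<close> in either variable.\<close>

lemma nn_integral_mollify_le:
  assumes [measurable]: "f \<in> borel_measurable borel" and e: "e > 0"
  shows "(\<integral>\<^sup>+x. ennreal \<bar>mollify e f x\<bar> \<partial>lborel) \<le> (\<integral>\<^sup>+x. ennreal \<bar>f x\<bar> \<partial>lborel)"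
proof -
  have "(\<integral>\<^sup>+x. ennreal \<bar>mollify e f x\<bar> \<partial>lborel) \<le> (\<integral>\<^sup>+x. \<integral>\<^sup>+y. ennreal \<bar>f y\<bar> * mollifier e x y \<partial>lborel \<partial>lborel)"
  proof (rule nn_integral_mono)
    fix x :: "real^'a"
    have "ennreal \<bar>mollify e f x\<bar> \<le> (\<integral>\<^sup>+y. ennreal (norm (f y * mollifier e x y)) \<partial>lborel)"
      unfolding mollify_def real_norm_def[symmetric]
    proof (cases "integrable lborel (\<lambda>y. f y * mollifier e x y)")
      case True then show "ennreal (norm (\<integral>y. f y * mollifier e x y \<partial>lborel)) \<le> (\<integral>\<^sup>+y. ennreal (norm (f y * mollifier e x y)) \<partial>lborel)"
        by (rule integral_norm_bound_ennreal)
    qed (simp add: not_integrable_integral_eq)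
    also have "\<dots> = (\<integral>\<^sup>+y. ennreal \<bar>f y\<bar> * mollifier e x y \<partial>lborel)"
      using mollifier_nonneg[OF e, of x] by (simp add: abs_mult ennreal_mult abs_of_nonneg)
    finally show "ennreal \<bar>mollify e f x\<bar> \<le> (\<integral>\<^sup>+y. ennreal \<bar>f y\<bar> * mollifier e x y \<partial>lborel)" .
  qed
  also have "\<dots> = (\<integral>\<^sup>+y. \<integral>\<^sup>+x. ennreal \<bar>f y\<bar> * mollifier e x y \<partial>lborel \<partial>lborel)"
    by (rule lborel_pair.Fubini') measurable
  also have "\<dots> = (\<integral>\<^sup>+y. ennreal \<bar>f y\<bar> * (\<integral>\<^sup>+x. mollifier e y x \<partial>lborel) \<partial>lborel)"
    by (subst mollifier_commute) (simp add: nn_integral_cmult)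
  also have "\<dots> = (\<integral>\<^sup>+x. ennreal \<bar>f x\<bar> \<partial>lborel)"
    by (simp add: nn_integral_mollifier[OF e])
  finally show ?thesis .
qed

lemma mollify_diff:
  assumes "integrable lborel f" "integrable lborel g" "e > 0"
  shows "mollify e (\<lambda>y. f y - g y) x = mollify e f x - mollify e g x"
  using assms by (simp add: mollify_def left_diff_distrib integrable_mult_mollifier)

lemma mollify_const: "e > 0 \<Longrightarrow> mollify e (\<lambda>_. c) x = c"
  by (simp add: mollify_def integral_mollifier)

lemma integrable_continuous_mult_mollifier:
  assumes "continuous_on UNIV g" "e > 0"
  shows "integrable lborel (\<lambda>y. g y * mollifier e x y)"
  by (rule integrable_compact_support[of _ "cball x e"])
     (use assms in \<open>auto intro!: continuous_intros simp: mollifier_eq_0\<close>)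

lemma mollify_uniform_limit:
  fixes g :: "real^'n::finite \<Rightarrow> real"
  assumes g: "continuous_on UNIV g" and K: "bounded K" and "\<eta> > 0"
  obtains e0 where "e0 > 0" "\<And>e x. 0 < e \<Longrightarrow> e < e0 \<Longrightarrow> x \<in> K \<Longrightarrow> \<bar>mollify e g x - g x\<bar> \<le> \<eta>"
proof -
  obtain R where R: "\<And>x. x \<in> K \<Longrightarrow> norm x \<le> R" using K by (auto simp: bounded_iff)
  have "uniformly_continuous_on (cball 0 (R + 1)) g"
    by (intro compact_uniformly_continuous continuous_on_subset[OF g]) auto
  then obtain d where d: "d > 0" "\<And>x y. x \<in> cball 0 (R+1) \<Longrightarrow> y \<in> cball 0 (R+1) \<Longrightarrow> dist y x < d \<Longrightarrow> dist (g y) (g x) < \<eta>"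
    unfolding uniformly_continuous_on_def using \<open>\<eta> > 0\<close> by metis
  show thesis
  proof (rule that[of "min d 1"])
    fix e x assume e: "0 < e" "e < min d 1" and x: "x \<in> K"
    have close: "\<bar>g y - g x\<bar> \<le> \<eta>" if "y \<in> cball x e" for y
    proof -
      have "norm y \<le> norm x + dist x y" by (metis dist_0_norm dist_triangle)
      then have "x \<in> cball 0 (R+1)" "y \<in> cball 0 (R+1)" "dist y x < d"
        using that e R[OF x] by (auto simp: dist_commute)
      from d(2)[OF this] show ?thesis by (simp add: dist_real_def)
    qed
    have "mollify e g x - g x = mollify e g x - mollify e (\<lambda>_. g x) x"
      using e by (simp add: mollify_const)
    also have "\<dots> = (\<integral>y. (g y - g x) * mollifier e x y \<partial>lborel)"
      using e g by (simp add: mollify_def left_diff_distrib integrable_continuous_mult_mollifier integrable_mollifier)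
    also have "\<bar>\<dots>\<bar> \<le> (\<integral>y. \<eta> * mollifier e x y \<partial>lborel)"
    proof (rule abs_lebesgue_integral_le)
      show "integrable lborel (\<lambda>y. (g y - g x) * mollifier e x y)"
        using g e by (intro integrable_continuous_mult_mollifier continuous_intros)
      show "integrable lborel (\<lambda>y. \<eta> * mollifier e x y)" using e by (simp add: integrable_mollifier)
      show "\<bar>(g y - g x) * mollifier e x y\<bar> \<le> \<eta> * mollifier e x y" for y
        using close[of y] mollifier_eq_0[of e y x] mollifier_nonneg[of e x y] e
        by (cases "y \<in> cball x e") (auto simp: abs_mult intro!: mult_right_mono)
    qed
    also have "\<dots> = \<eta>" using e by (simp add: integral_mollifier)
    finally show "\<bar>mollify e g x - g x\<bar> \<le> \<eta>" by simp
  qed (use d in auto)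
qed

text \<open>For an indicator function, the set is enclosed between a closed and an open set of almost the same measure,
and Urysohn's lemma interpolates between them.  The property passes to sums and dominated limits.\<close>

lemma continuous_dense_L1:
  fixes f :: "real^'n::finite \<Rightarrow> real"
  assumes "integrable lborel f"
  shows "\<forall>\<eta>>0. \<exists>g. continuous_on UNIV g \<and> integrable lborel g \<and> (\<integral>x. \<bar>f x - g x\<bar> \<partial>lborel) < \<eta>"
  using assms
proof (induction f rule: integrable_induct)
  case (base A c)
  show ?case
  proof (intro allI impI)
    fix \<eta> :: real assume \<eta>: "\<eta> > 0"
    define \<delta> where "\<delta> = \<eta> / (\<bar>c\<bar> + 1) / 2"
    have \<delta>: "\<delta> > 0" using \<eta> by (simp add: \<delta>_def add_nonneg_pos)
    have AL: "A \<in> sets lebesgue" using base by simp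
    obtain U where U: "open U" "A \<subseteq> U" "U - A \<in> lmeasurable" "emeasure lebesgue (U - A) < ennreal \<delta>"
      using sets_lebesgue_outer_open[OF AL \<delta>] by blast
    obtain C where C: "closed C" "C \<subseteq> A" "A - C \<in> lmeasurable" "emeasure lebesgue (A - C) < ennreal \<delta>"
      using sets_lebesgue_inner_closed[OF AL \<delta>] by blast
    have b[measurable]: "A \<in> sets borel" "U \<in> sets borel" "C \<in> sets borel" using base U C by auto
    obtain g :: "real^'n \<Rightarrow> real" where g: "continuous_on UNIV g" "\<And>x. g x \<in> closed_segment 1 0"
      "\<And>x. x \<in> C \<Longrightarrow> g x = 1" "\<And>x. x \<in> - U \<Longrightarrow> g x = 0"
      using Urysohn[of C "- U" 1 0] C U by auto
    have g01: "0 \<le> g x" "g x \<le> 1" for x using g(2)[of x] by (auto simp: closed_segment_eq_real_ivl)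
    have gm: "g \<in> borel_measurable borel" using g(1) by (rule borel_measurable_continuous_onI)
    have fA: "integrable lborel (indicator A :: _ \<Rightarrow> real)" using base by (simp add: integrable_indicator_iff)
    have e1: "emeasure lborel (U - A) < ennreal \<delta>" "emeasure lborel (A - C) < ennreal \<delta>"
      using U(4) C(4) by simp_all
    then have m1: "measure lborel (U - A) < \<delta>" "measure lborel (A - C) < \<delta>"
      using \<delta> less_trans[OF e1(1) ennreal_less_top] less_trans[OF e1(2) ennreal_less_top]
      by (simp_all add: emeasure_eq_ennreal_measure ennreal_less_iff less_top[symmetric])
    have iU: "integrable lborel (indicator (U - A) :: _ \<Rightarrow> real)" "integrable lborel (indicator (A - C) :: _ \<Rightarrow> real)"
      using less_trans[OF e1(1) ennreal_less_top] less_trans[OF e1(2) ennreal_less_top]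
      by (simp_all add: integrable_indicator_iff)
    have bd: "\<bar>indicator A x - g x\<bar> \<le> indicator (U - A) x + indicator (A - C) x" for x
      using g(3,4)[of x] g01[of x] U(2) C(2) by (auto simp: indicator_def)
    have gi: "integrable lborel g"
    proof (rule Bochner_Integration.integrable_bound)
      show "integrable lborel (\<lambda>x. indicator A x + indicator (U - A) x :: real)" using fA iU by simp
      show "AE x in lborel. norm (g x) \<le> norm (indicator A x + indicator (U - A) x :: real)"
        using g01 g(4) by (auto simp: indicator_def)
    qed (use gm in simp)
    have "(\<integral>x. \<bar>indicator A x *\<^sub>R c - c * g x\<bar> \<partial>lborel) \<le> (\<integral>x. \<bar>c\<bar> * (indicator (U - A) x + indicator (A - C) x) \<partial>lborel)"
    proof (rule integral_mono)
      fix x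
      have "indicator A x *\<^sub>R c - c * g x = c * (indicator A x - g x)" by (simp add: algebra_simps)
      then show "\<bar>indicator A x *\<^sub>R c - c * g x\<bar> \<le> \<bar>c\<bar> * (indicator (U - A) x + indicator (A - C) x)"
        using bd[of x] by (simp add: abs_mult mult_left_mono)
    qed (use fA iU gi in auto)
    also have "\<dots> = \<bar>c\<bar> * (measure lborel (U - A) + measure lborel (A - C))"
      using iU by simp
    also have "\<dots> \<le> \<bar>c\<bar> * (\<delta> + \<delta>)" using m1 by (intro mult_left_mono) auto
    also have "\<delta> + \<delta> = \<eta> / (\<bar>c\<bar> + 1)" unfolding \<delta>_def by (rule field_sum_of_halves)
    also have "\<bar>c\<bar> * (\<eta> / (\<bar>c\<bar> + 1)) = \<eta> * (\<bar>c\<bar> / (\<bar>c\<bar> + 1))" by simp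
    also have "\<dots> < \<eta> * 1" using \<eta> by (intro mult_strict_left_mono) (auto simp: divide_simps)
    also have "\<eta> * 1 = \<eta>" by simp
    finally show "\<exists>g. continuous_on UNIV g \<and> integrable lborel g \<and> (\<integral>x. \<bar>indicator A x *\<^sub>R c - g x\<bar> \<partial>lborel) < \<eta>"
      using g(1) gi by (intro exI[of _ "\<lambda>x. c * g x"]) (auto intro!: continuous_intros)
  qed
next
  case (add f1 f2)
  show ?case
  proof (intro allI impI)
    fix \<eta> :: real assume \<eta>: "\<eta> > 0"
    obtain g1 where g1: "continuous_on UNIV g1" "integrable lborel g1" "(\<integral>x. \<bar>f1 x - g1 x\<bar> \<partial>lborel) < \<eta> / 2"
      using add.IH(1) \<eta> by (meson half_gt_zero)
    obtain g2 where g2: "continuous_on UNIV g2" "integrable lborel g2" "(\<integral>x. \<bar>f2 x - g2 x\<bar> \<partial>lborel) < \<eta> / 2"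
      using add.IH(2) \<eta> by (meson half_gt_zero)
    have "(\<integral>x. \<bar>f1 x + f2 x - (g1 x + g2 x)\<bar> \<partial>lborel) \<le> (\<integral>x. \<bar>f1 x - g1 x\<bar> + \<bar>f2 x - g2 x\<bar> \<partial>lborel)"
      using add.hyps g1 g2 by (intro integral_mono) auto
    also have "\<dots> < \<eta>" using add.hyps g1 g2 by simp
    finally show "\<exists>g. continuous_on UNIV g \<and> integrable lborel g \<and> (\<integral>x. \<bar>f1 x + f2 x - g x\<bar> \<partial>lborel) < \<eta>"
      using g1 g2 by (intro exI[of _ "\<lambda>x. g1 x + g2 x"]) (auto intro!: continuous_intros)
  qed
next
  case (lim f s)
  show ?case
  proof (intro allI impI)
    fix \<eta> :: real assume \<eta>: "\<eta> > 0"
    have "(\<lambda>i. \<integral>x. \<bar>f x - s i x\<bar> \<partial>lborel) \<longlonglongrightarrow> (\<integral>x. 0 \<partial>(lborel :: (real^'n) measure))"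
    proof (rule integral_dominated_convergence[where w = "\<lambda>x. 3 * \<bar>f x\<bar>"])
      show "AE x in lborel. (\<lambda>i. \<bar>f x - s i x\<bar>) \<longlonglongrightarrow> 0"
      proof (rule AE_I2)
        fix x :: "real^'n"
        have "(\<lambda>i. \<bar>f x - s i x\<bar>) \<longlonglongrightarrow> \<bar>f x - f x\<bar>"
          by (intro tendsto_intros lim.hyps(2)) simp
        then show "(\<lambda>i. \<bar>f x - s i x\<bar>) \<longlonglongrightarrow> 0" by simp
      qed
      show "AE x in lborel. norm \<bar>f x - s i x\<bar> \<le> 3 * \<bar>f x\<bar>" for i
      proof (rule AE_I2)
        fix x :: "real^'n"
        have "\<bar>s i x\<bar> \<le> 2 * \<bar>f x\<bar>" using lim.hyps(3)[of x i] by simp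
        then show "norm \<bar>f x - s i x\<bar> \<le> 3 * \<bar>f x\<bar>" by simp
      qed
    qed (use lim.hyps in auto)
    then have "\<forall>\<^sub>F i in sequentially. (\<integral>x. \<bar>f x - s i x\<bar> \<partial>lborel) < \<eta> / 2"
      using \<eta> by (intro order_tendstoD) auto
    then obtain i where i: "(\<integral>x. \<bar>f x - s i x\<bar> \<partial>lborel) < \<eta> / 2"
      by (auto simp: eventually_sequentially)
    obtain g where g: "continuous_on UNIV g" "integrable lborel g" "(\<integral>x. \<bar>s i x - g x\<bar> \<partial>lborel) < \<eta> / 2"
      using lim.IH \<eta> by (meson half_gt_zero)
    have "(\<integral>x. \<bar>f x - g x\<bar> \<partial>lborel) \<le> (\<integral>x. \<bar>f x - s i x\<bar> + \<bar>s i x - g x\<bar> \<partial>lborel)"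
      using lim.hyps g by (intro integral_mono) auto
    also have "\<dots> < \<eta>" using lim.hyps g i by simp
    finally show "\<exists>g. continuous_on UNIV g \<and> integrable lborel g \<and> (\<integral>x. \<bar>f x - g x\<bar> \<partial>lborel) < \<eta>"
      using g by blast
  qed
qed

text \<open>By density it is enough to mollify a continuous function \<open>g\<close> close to \<open>f\<close>: mollification does not increase
the L1 distance of \<open>f\<close> and \<open>g\<close>, and \<open>g\<close> is approximated uniformly on the bounded set \<open>K\<close>.\<close>

lemma mollify_tendsto_L1:
  fixes f :: "real^'n::finite \<Rightarrow> real"
  assumes f: "integrable lborel f" and K: "bounded K" "K \<in> sets borel"
    and e: "\<And>n. 0 < e n" "e \<longlonglongrightarrow> 0"
  shows "(\<lambda>n. \<integral>x. indicator K x * \<bar>mollify (e n) f x - f x\<bar> \<partial>lborel) \<longlonglongrightarrow> 0"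
    and "\<And>n. integrable lborel (\<lambda>x. indicator K x * \<bar>mollify (e n) f x - f x\<bar>)"
proof -
  have [measurable]: "K \<in> sets borel" by fact
  have int_mollify: "integrable lborel (mollify d g)" "(\<integral>x. \<bar>mollify d g x\<bar> \<partial>lborel) \<le> (\<integral>x. \<bar>g x\<bar> \<partial>lborel)"
    if g: "integrable lborel g" and d: "d > 0" for d and g :: "real^'n \<Rightarrow> real"
  proof -
    have [measurable]: "g \<in> borel_measurable borel" using g by auto
    have *: "(\<integral>\<^sup>+x. ennreal \<bar>mollify d g x\<bar> \<partial>lborel) \<le> ennreal (\<integral>x. \<bar>g x\<bar> \<partial>lborel)"
      using nn_integral_mollify_le[of g d] g d by (subst (asm) (2) nn_integral_eq_integral) auto
    then show 1: "integrable lborel (mollify d g)"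
      unfolding integrable_iff_bounded by (auto intro: le_less_trans)
    show "(\<integral>x. \<bar>mollify d g x\<bar> \<partial>lborel) \<le> (\<integral>x. \<bar>g x\<bar> \<partial>lborel)"
      using * 1 by (subst (asm) nn_integral_eq_integral) auto
  qed
  show int: "integrable lborel (\<lambda>x. indicator K x * \<bar>mollify (e n) f x - f x\<bar>)" for n
  proof -
    have "integrable lborel (\<lambda>x. \<bar>mollify (e n) f x - f x\<bar> * indicator K x)"
      using int_mollify(1)[OF f e(1)] f K(2) by (intro integrable_real_mult_indicator) auto
    then show ?thesis by (simp add: mult.commute)
  qed
  show "(\<lambda>n. \<integral>x. indicator K x * \<bar>mollify (e n) f x - f x\<bar> \<partial>lborel) \<longlonglongrightarrow> 0"
  proof (rule LIMSEQ_I)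
    fix r :: real assume r: "r > 0"
    obtain g where g: "continuous_on UNIV g" "integrable lborel g" "(\<integral>x. \<bar>f x - g x\<bar> \<partial>lborel) < r / 3"
      using continuous_dense_L1[OF f] r by (meson divide_pos_pos zero_less_numeral)
    define \<eta> where "\<eta> = r / (4 * (measure lborel K + 1))"
    have \<eta>: "\<eta> > 0" using r by (simp add: \<eta>_def add_nonneg_pos)
    obtain e0 where e0: "e0 > 0" "\<And>e x. 0 < e \<Longrightarrow> e < e0 \<Longrightarrow> x \<in> K \<Longrightarrow> \<bar>mollify e g x - g x\<bar> \<le> \<eta>"
      using mollify_uniform_limit[OF g(1) K(1) \<eta>] by blast
    have "\<forall>\<^sub>F n in sequentially. e n < e0" using e(2) e0(1) by (rule order_tendstoD)
    then obtain N where N: "\<And>n. n \<ge> N \<Longrightarrow> e n < e0" by (auto simp: eventually_sequentially)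
    have "norm ((\<integral>x. indicator K x * \<bar>mollify (e n) f x - f x\<bar> \<partial>lborel) - 0) < r" if n: "n \<ge> N" for n
    proof -
      have fg: "integrable lborel (\<lambda>x. f x - g x)" using f g by simp
      have Kf: "emeasure lborel K < \<infinity>" using K(1) by (rule emeasure_bounded_finite)
      have iK: "integrable lborel (\<lambda>x. indicator K x * \<eta>)" using K Kf by simp
      have "(\<integral>x. indicator K x * \<bar>mollify (e n) f x - f x\<bar> \<partial>lborel)
          \<le> (\<integral>x. \<bar>mollify (e n) (\<lambda>y. f y - g y) x\<bar> + \<bar>f x - g x\<bar> + indicator K x * \<eta> \<partial>lborel)"
      proof (intro integral_mono int)
        show "integrable lborel (\<lambda>x. \<bar>mollify (e n) (\<lambda>y. f y - g y) x\<bar> + \<bar>f x - g x\<bar> + indicator K x * \<eta>)"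
          using int_mollify(1)[OF fg e(1)] fg iK by auto
        fix x
        show "indicator K x * \<bar>mollify (e n) f x - f x\<bar> \<le>
           \<bar>mollify (e n) (\<lambda>y. f y - g y) x\<bar> + \<bar>f x - g x\<bar> + indicator K x * \<eta>"
          using e0(2)[OF e(1) N[OF n], of x] mollify_diff[OF f g(2) e(1), of n x] by (auto simp: indicator_def)
      qed
      also have "\<dots> = (\<integral>x. \<bar>mollify (e n) (\<lambda>y. f y - g y) x\<bar> \<partial>lborel) + (\<integral>x. \<bar>f x - g x\<bar> \<partial>lborel) + measure lborel K * \<eta>"
        using int_mollify(1)[OF fg e(1)] fg iK by simp
      also have "\<dots> \<le> (\<integral>x. \<bar>f x - g x\<bar> \<partial>lborel) + (\<integral>x. \<bar>f x - g x\<bar> \<partial>lborel) + r / 4"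
      proof -
        have "measure lborel K * \<eta> \<le> (measure lborel K + 1) * \<eta>" using \<eta> by simp
        also have "\<dots> = r / 4"
        proof -
          have "measure lborel K + 1 \<noteq> 0" using measure_nonneg[of lborel K] by linarith
          then show ?thesis unfolding \<eta>_def times_divide_eq_right by (subst mult.commute) (simp only: nonzero_mult_divide_mult_cancel_right not_False_eq_True)
        qed
        finally show ?thesis using int_mollify(2)[OF fg e(1)] by (intro add_mono) auto
      qed
      also have "\<dots> < r" using g(3) r by simp
      finally have "(\<integral>x. indicator K x * \<bar>mollify (e n) f x - f x\<bar> \<partial>lborel) < r" .
      moreover have "0 \<le> (\<integral>x. indicator K x * \<bar>mollify (e n) f x - f x\<bar> \<partial>lborel)" by (intro integral_nonneg_AE) simp
      ultimately show ?thesis by simp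
    qed
    then show "\<exists>N. \<forall>n\<ge>N. norm ((\<integral>x. indicator K x * \<bar>mollify (e n) f x - f x\<bar> \<partial>lborel) - 0) < r" by blast
  qed
qed

text \<open>Jensen's inequality for the probability density \<open>mollifier e x\<close>: the power function lies above its tangent at the
mean of \<open>|f|\<close>.\<close>

lemma mollify_power_le:
  fixes f :: "real^'n::finite \<Rightarrow> real"
  assumes f: "integrable lborel f" and fd: "integrable lborel (\<lambda>y. \<bar>f y\<bar> ^ d)" and e: "e > 0" and d: "d > 0"
  shows "\<bar>mollify e f x\<bar> ^ d \<le> mollify e (\<lambda>y. \<bar>f y\<bar> ^ d) x"
proof -
  \<comment> \<open>Bernoulli's inequality for \<open>t / s\<close>.\<close>
  have tangent: "s ^ d + d * s ^ (d - 1) * (t - s) \<le> t ^ d" if "0 \<le> s" "0 \<le> t" for s t :: real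
  proof -
    show ?thesis
    proof (cases "s = 0")
      case True
      then show ?thesis using that d by (cases "d = 1") (auto simp: power_0_left)
    next
      case False
      then have s: "s > 0" using that by simp
      have "1 + d * (t / s - 1) \<le> (1 + (t / s - 1)) ^ d"
        using that s by (intro Bernoulli_inequality) auto
      then have "s ^ d * (1 + d * (t / s - 1)) \<le> s ^ d * (t / s) ^ d"
        using s by (intro mult_left_mono) auto
      moreover have "s ^ d * (t / s) ^ d = t ^ d" using s by (simp add: power_divide)
      moreover have "s ^ d * (1 + d * (t / s - 1)) = s ^ d + d * s ^ (d - 1) * (t - s)"
        using s d by (cases d) (simp_all add: field_simps)
      ultimately show ?thesis by simp
    qed
  qed
  define s where "s = mollify e (\<lambda>y. \<bar>f y\<bar>) x"
  have i1: "integrable lborel (\<lambda>y. \<bar>f y\<bar> * mollifier e x y)" using f e by (intro integrable_mult_mollifier) auto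
  have i2: "integrable lborel (\<lambda>y. \<bar>f y\<bar> ^ d * mollifier e x y)" using fd e by (intro integrable_mult_mollifier) auto
  have split: "(\<lambda>y. (s ^ d + d * s ^ (d - 1) * (\<bar>f y\<bar> - s)) * mollifier e x y) =
      (\<lambda>y. (s ^ d - d * s ^ (d - 1) * s) * mollifier e x y + (d * s ^ (d - 1)) * (\<bar>f y\<bar> * mollifier e x y))"
    by (auto simp: algebra_simps)
  have s0: "0 \<le> s" unfolding s_def mollify_def using mollifier_nonneg[OF e, of x] by (intro integral_nonneg_AE) simp
  have "\<bar>mollify e f x\<bar> \<le> s"
  proof -
    have "\<bar>\<integral>y. f y * mollifier e x y \<partial>lborel\<bar> \<le> (\<integral>y. \<bar>f y\<bar> * mollifier e x y \<partial>lborel)"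
      using mollifier_nonneg[OF e, of x] f e i1
      by (intro abs_lebesgue_integral_le integrable_mult_mollifier) (simp_all add: abs_mult abs_of_nonneg)
    then show ?thesis by (simp add: mollify_def s_def)
  qed
  then have "\<bar>mollify e f x\<bar> ^ d \<le> s ^ d" by (intro power_mono) auto
  also have "s ^ d = (\<integral>y. (s ^ d + d * s ^ (d - 1) * (\<bar>f y\<bar> - s)) * mollifier e x y \<partial>lborel)"
    unfolding split using i1 e
    by (simp add: integrable_mollifier integral_mollifier s_def[unfolded mollify_def, symmetric])
  also have "\<dots> \<le> mollify e (\<lambda>y. \<bar>f y\<bar> ^ d) x"
    unfolding mollify_def
  proof (rule integral_mono)
    show "integrable lborel (\<lambda>y. (s ^ d + d * s ^ (d - 1) * (\<bar>f y\<bar> - s)) * mollifier e x y)"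
      unfolding split using i1 e by (simp add: integrable_mollifier)
    fix y
    show "(s ^ d + d * s ^ (d - 1) * (\<bar>f y\<bar> - s)) * mollifier e x y \<le> \<bar>f y\<bar> ^ d * mollifier e x y"
      using mollifier_nonneg[OF e] tangent[OF s0, of "\<bar>f y\<bar>"] by (intro mult_right_mono) auto
  qed (rule i2)
  finally show ?thesis .
qed

section \<open>Derivatives of mollified functions\<close>

text \<open>Near \<open>x0\<close> all kernels are supported in one box, on which differentiation under the integral sign is
justified by continuity of the gradient of the kernel.\<close>

lemma has_derivative_integral_kernel:
  fixes u :: "real^'n::finite \<Rightarrow> real" and k :: "real^'n \<Rightarrow> real^'n \<Rightarrow> real"
    and K :: "'n \<Rightarrow> real^'n \<Rightarrow> real^'n \<Rightarrow> real"
  assumes u: "continuous_on UNIV u"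
    and k: "\<And>x y. ((\<lambda>x. k x y) has_derivative (\<lambda>h. \<Sum>i\<in>UNIV. h $ i * K i x y)) (at x)"
    and k_cont: "continuous_on UNIV (\<lambda>p. k (fst p) (snd p))"
    and K_cont: "\<And>i. continuous_on UNIV (\<lambda>p. K i (fst p) (snd p))"
    and supp: "\<And>x y. y \<notin> cball x e \<Longrightarrow> k x y = 0" "\<And>i x y. y \<notin> cball x e \<Longrightarrow> K i x y = 0"
  shows "((\<lambda>x. \<integral>y. u y * k x y \<partial>lborel) has_derivative
      (\<lambda>h. \<Sum>i\<in>UNIV. h $ i * (\<integral>y. u y * K i x0 y \<partial>lborel))) (at x0)"
proof -
  obtain a where a: "cball x0 (\<bar>e\<bar> + 1) \<subseteq> cbox (- a) a"
    using bounded_subset_cbox_symmetric[OF bounded_cball] by blast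
  let ?Q = "cbox (- a) a"
  have inQ: "y \<notin> cball x e" if "x \<in> ball x0 1" "y \<notin> ?Q" for x y
  proof
    assume "y \<in> cball x e"
    then have "dist x0 y \<le> \<bar>e\<bar> + 1" using that(1) dist_triangle[of x0 y x] by simp
    then show False using a that(2) by auto
  qed
  have to_box: "(\<integral>y. u y * g y \<partial>lborel) = integral ?Q (\<lambda>y. u y * g y)" "(\<lambda>y. u y * g y) integrable_on ?Q"
    if g: "continuous_on UNIV g" "\<And>y. y \<notin> ?Q \<Longrightarrow> g y = 0" for g
  proof -
    have "integrable lborel (\<lambda>y. u y * g y)"
      by (rule integrable_compact_support[of _ ?Q]) (use u g in \<open>auto intro: continuous_on_mult\<close>)
    then have "(\<integral>y. u y * g y \<partial>lborel) = integral UNIV (\<lambda>y. u y * g y)"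
      by (rule integral_lborel[symmetric])
    also have "\<dots> = integral UNIV (\<lambda>y. if y \<in> ?Q then u y * g y else 0)"
      using g(2) by (intro arg_cong[where f = "integral UNIV"]) auto
    also have "\<dots> = integral ?Q (\<lambda>y. u y * g y)" by (rule integral_restrict_UNIV)
    finally show "(\<integral>y. u y * g y \<partial>lborel) = integral ?Q (\<lambda>y. u y * g y)" .
    show "(\<lambda>y. u y * g y) integrable_on ?Q"
      using u g(1) by (intro integrable_continuous continuous_on_mult) (auto intro: continuous_on_subset)
  qed
  have cont_snd: "continuous_on UNIV (k x)" "continuous_on UNIV (K i x)" for x :: "real^'n" and i
  proof -
    have p: "continuous_on UNIV (\<lambda>y :: real^'n. (x, y))" by (intro continuous_intros)
    show "continuous_on UNIV (k x)" "continuous_on UNIV (K i x)"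
      using continuous_on_compose2[OF k_cont p] continuous_on_compose2[OF K_cont p] by simp_all
  qed
  define F where "F = (\<lambda>x y. \<Sum>i\<in>UNIV. (u y * K i x y) *\<^sub>R blinfun_inner_right (axis i 1 :: real^'n))"
  have F_apply: "blinfun_apply (F x y) h = (\<Sum>i\<in>UNIV. h $ i * (u y * K i x y))" for x y h
    by (simp add: F_def blinfun.sum_left blinfun.scaleR_left inner_axis' mult.commute)
  have F_cont: "continuous_on (ball x0 1 \<times> ?Q) (\<lambda>(x, y). F x y)"
    unfolding F_def case_prod_beta
    by (intro continuous_intros continuous_on_subset[OF K_cont] continuous_on_compose2[OF u]) auto
  have "((\<lambda>x. integral ?Q (\<lambda>y. u y * k x y)) has_derivative blinfun_apply (integral ?Q (F x0))) (at x0 within ball x0 1)"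
  proof (rule leibniz_rule[OF _ _ F_cont])
    fix x y assume "x \<in> ball x0 1"
    show "((\<lambda>x. u y * k x y) has_derivative blinfun_apply (F x y)) (at x within ball x0 1)"
      using has_derivative_mult_right[OF k[of y x], of "u y", THEN has_derivative_at_withinI]
      by (simp add: F_apply[abs_def] sum_distrib_left algebra_simps)
  next
    fix x assume "x \<in> ball x0 1"
    then show "(\<lambda>y. u y * k x y) integrable_on ?Q"
      using inQ supp(1) by (intro to_box(2) cont_snd) blast
  qed auto
  then have 1: "((\<lambda>x. integral ?Q (\<lambda>y. u y * k x y)) has_derivative blinfun_apply (integral ?Q (F x0))) (at x0)"
    by (simp add: at_within_open[of x0 "ball x0 1"])
  have "blinfun_apply (integral ?Q (F x0)) = (\<lambda>h. \<Sum>i\<in>UNIV. h $ i * (\<integral>y. u y * K i x0 y \<partial>lborel))"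
  proof
    fix h
    have p: "continuous_on ?Q (\<lambda>y. (x0, y))" by (intro continuous_intros)
    have im: "(\<lambda>y. (x0, y)) ` ?Q \<subseteq> ball x0 1 \<times> ?Q" by auto
    have "continuous_on ?Q (F x0)"
      using continuous_on_compose2[OF F_cont p im] by simp
    then have "blinfun_apply (integral ?Q (F x0)) h = integral ?Q (\<lambda>y. \<Sum>i\<in>UNIV. h $ i * (u y * K i x0 y))"
      by (subst blinfun_apply_integral) (auto intro: integrable_continuous simp: F_apply)
    also have "\<dots> = (\<Sum>i\<in>UNIV. integral ?Q (\<lambda>y. h $ i * (u y * K i x0 y)))"
      using inQ[of x0] supp(2) by (intro integral_sum integrable_on_mult_right to_box(2) cont_snd) auto
    also have "\<dots> = (\<Sum>i\<in>UNIV. h $ i * (\<integral>y. u y * K i x0 y \<partial>lborel))"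
      using inQ[of x0] supp(2) by (intro sum.cong refl) (subst to_box(1), auto intro: cont_snd)
    finally show "blinfun_apply (integral ?Q (F x0)) h = (\<Sum>i\<in>UNIV. h $ i * (\<integral>y. u y * K i x0 y \<partial>lborel))" .
  qed
  with 1 have 2: "((\<lambda>x. integral ?Q (\<lambda>y. u y * k x y)) has_derivative
      (\<lambda>h. \<Sum>i\<in>UNIV. h $ i * (\<integral>y. u y * K i x0 y \<partial>lborel))) (at x0)" by simp
  show ?thesis
  proof (rule has_derivative_transform_within_open[OF 2, of "ball x0 1"])
    fix x assume "x \<in> ball x0 1"
    then show "integral ?Q (\<lambda>y. u y * k x y) = (\<integral>y. u y * k x y \<partial>lborel)"
      using inQ supp(1) by (intro to_box(1)[symmetric] cont_snd) blast
  qed auto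
qed

definition mollify_grad :: "real \<Rightarrow> (real^'n::finite \<Rightarrow> real) \<Rightarrow> real^'n \<Rightarrow> real^'n" where
  "mollify_grad e u x = (\<chi> i. (\<integral>y. u y * (bump 2 e y x * (- 2 * (x $ i - y $ i))) \<partial>lborel) / bump_mass TYPE('n) e)"

definition mollify_hess :: "real \<Rightarrow> (real^'n::finite \<Rightarrow> real) \<Rightarrow> real^'n \<Rightarrow> real^'n^'n" where
  "mollify_hess e u x = (\<chi> i j. (\<integral>y. u y * bump_hess e i j x y \<partial>lborel) / bump_mass TYPE('n) e)"

lemma bump_outside: "0 \<le> e \<Longrightarrow> y \<notin> cball x e \<Longrightarrow> bump k e y x = 0" 
  using bump_eq_0_outside_cball[of e y x k] by (simp add: bump_commute)

lemma mollify_has_derivative: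
  assumes u: "continuous_on UNIV u" and e: "e > 0"
  shows "(mollify e u has_derivative (\<lambda>h. mollify_grad e u x \<bullet> h)) (at x)"
proof -
  have "((\<lambda>x. \<integral>y. u y * bump 0 e y x \<partial>lborel) has_derivative
      (\<lambda>h. \<Sum>i\<in>UNIV. h $ i * (\<integral>y. u y * (bump 2 e y x * (- 2 * (x $ i - y $ i))) \<partial>lborel))) (at x)"
  proof (rule has_derivative_integral_kernel[OF u, where e = e])
    fix x y :: "real^'a"
    have "(bump (0 + 2) e y x - real 0 * bump (0 + 1) e y x) * (- 2 * ((x - y) \<bullet> h))
       = (\<Sum>i\<in>UNIV. h $ i * (bump 2 e y x * (- 2 * (x $ i - y $ i))))" for h
      by (simp add: inner_vec_def sum_distrib_left algebra_simps numeral_2_eq_2)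
    then show "((\<lambda>x. bump 0 e y x) has_derivative
        (\<lambda>h. \<Sum>i\<in>UNIV. h $ i * (bump 2 e y x * (- 2 * (x $ i - y $ i))))) (at x)"
      using bump_has_derivative[of 0 e y x] by simp
  qed (use e in \<open>auto intro!: continuous_intros simp: bump_outside\<close>)
  then have "((\<lambda>x. (\<integral>y. u y * bump 0 e y x \<partial>lborel) / bump_mass TYPE('a) e) has_derivative
      (\<lambda>h. (\<Sum>i\<in>UNIV. h $ i * (\<integral>y. u y * (bump 2 e y x * (- 2 * (x $ i - y $ i))) \<partial>lborel)) / bump_mass TYPE('a) e)) (at x)"
    by (rule bounded_linear.has_derivative[OF bounded_linear_divide])
  moreover have "mollify e u = (\<lambda>x. (\<integral>y. u y * bump 0 e y x \<partial>lborel) / bump_mass TYPE('a) e)"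
    by (simp add: fun_eq_iff mollify_def mollifier_def bump_commute)
  moreover have "(\<Sum>i\<in>UNIV. h $ i * (\<integral>y. u y * (bump 2 e y x * (- 2 * (x $ i - y $ i))) \<partial>lborel)) / bump_mass TYPE('a) e
      = mollify_grad e u x \<bullet> h" for h
    by (simp add: mollify_grad_def inner_vec_def sum_divide_distrib mult.commute)
  ultimately show ?thesis by simp
qed

lemma mollify_grad_has_derivative:
  assumes u: "continuous_on UNIV u" and e: "e > 0"
  shows "(mollify_grad e u has_derivative (\<lambda>h. mollify_hess e u x *v h)) (at x)"
proof -
  have comp: "((\<lambda>x. mollify_grad e u x $ j) has_derivative (\<lambda>h. (mollify_hess e u x *v h) $ j)) (at x)" for j
  proof -
    have "((\<lambda>x. \<integral>y. u y * (bump 2 e y x * (- 2 * (x $ j - y $ j))) \<partial>lborel) has_derivative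
        (\<lambda>h. \<Sum>i\<in>UNIV. h $ i * (\<integral>y. u y * bump_hess e i j y x \<partial>lborel))) (at x)"
    proof (rule has_derivative_integral_kernel[OF u bump_grad_has_derivative, where e = e])
      show "continuous_on UNIV (\<lambda>p. bump_hess e i j (snd p) (fst p))" for i
        unfolding bump_hess_def by (cases "i = j") (auto intro!: continuous_intros)
    qed (use e in \<open>auto intro!: continuous_intros simp: bump_outside bump_hess_def\<close>)
    then have "((\<lambda>x. (\<integral>y. u y * (bump 2 e y x * (- 2 * (x $ j - y $ j))) \<partial>lborel) / bump_mass TYPE('a) e) has_derivative
        (\<lambda>h. (\<Sum>i\<in>UNIV. h $ i * (\<integral>y. u y * bump_hess e i j y x \<partial>lborel)) / bump_mass TYPE('a) e)) (at x)"
      by (rule bounded_linear.has_derivative[OF bounded_linear_divide])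
    moreover have "(\<Sum>i\<in>UNIV. h $ i * (\<integral>y. u y * bump_hess e i j y x \<partial>lborel)) / bump_mass TYPE('a) e
       = (mollify_hess e u x *v h) $ j" for h
      by (simp add: mollify_hess_def matrix_vector_mult_def sum_divide_distrib mult.commute
          bump_hess_sym[of e _ j] bump_hess_commute[of e _ _ _ x])
    ultimately show ?thesis by (simp add: mollify_grad_def)
  qed
  show ?thesis
  proof (subst has_derivative_componentwise_within, rule ballI)
    fix b :: "real^'a" assume "b \<in> Basis"
    then obtain j where "b = axis j 1" by (auto simp: Basis_vec_def)
    then show "((\<lambda>x. mollify_grad e u x \<bullet> b) has_derivative (\<lambda>h. (mollify_hess e u x *v h) \<bullet> b)) (at x)"
      using comp[of j] by (simp add: inner_axis)
  qed
qed

lemma transpose_mollify_hess: "transpose (mollify_hess e u x) = mollify_hess e u x"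
  by (simp add: transpose_def mollify_hess_def vec_eq_iff bump_hess_sym)

text \<open>If the second derivative along a line through the maximum were positive, the first derivative along it would
be positive just after the maximum and the function would increase there.\<close>

lemma second_order_necessary_condition:
  fixes f :: "real^'n::finite \<Rightarrow> real"
  assumes S: "open S" "x \<in> S"
    and f: "\<And>y. y \<in> S \<Longrightarrow> (f has_derivative (\<lambda>h. G y \<bullet> h)) (at y)"
    and G: "(G has_derivative (\<lambda>h. M *v h)) (at x)"
    and max: "\<And>y. y \<in> S \<Longrightarrow> f y - p \<bullet> y \<le> f x - p \<bullet> x"
  shows "G x = p" "v \<bullet> (M *v v) \<le> 0"
proof -
  have d: "((\<lambda>y. f y - p \<bullet> y) has_derivative (\<lambda>h. (G y - p) \<bullet> h)) (at y)" if "y \<in> S" for y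
    using f[OF that] by (auto intro!: derivative_eq_intros simp: inner_diff_left)
  have "(\<lambda>h. (G x - p) \<bullet> h) = (\<lambda>h. 0)"
    using differential_zero_maxmin[OF S(2,1) d[OF S(2)]] max by blast
  then have "(G x - p) \<bullet> (G x - p) = 0" by metis
  then show Gx: "G x = p" by simp
  show "v \<bullet> (M *v v) \<le> 0"
  proof (rule ccontr)
    assume neg: "\<not> v \<bullet> (M *v v) \<le> 0"
    define g where "g t = f (x + t *\<^sub>R v) - p \<bullet> (x + t *\<^sub>R v)" for t
    define g' where "g' t = (G (x + t *\<^sub>R v) - p) \<bullet> v" for t
    have line: "((\<lambda>t. x + t *\<^sub>R v) has_derivative (\<lambda>t. t *\<^sub>R v)) (at t)" for t
      by (auto intro!: derivative_eq_intros)
    have dg: "(g has_real_derivative g' t) (at t)" if "x + t *\<^sub>R v \<in> S" for t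
      using has_derivative_compose[OF line d[OF that]]
      by (simp add: g_def[abs_def] g'_def has_field_derivative_def mult_commute_abs)
    have "(G has_derivative (\<lambda>h. M *v h)) (at (x + 0 *\<^sub>R v))" using G by simp
    from has_derivative_compose[OF line this]
    have "((\<lambda>t. G (x + t *\<^sub>R v)) has_derivative (\<lambda>t. M *v (t *\<^sub>R v))) (at 0)" .
    then have "(g' has_derivative (\<lambda>t. (M *v (t *\<^sub>R v)) \<bullet> v)) (at 0)"
      unfolding g'_def[abs_def] by (auto intro!: derivative_eq_intros)
    then have "(g' has_real_derivative v \<bullet> (M *v v)) (at 0)"
      by (simp add: has_field_derivative_def matrix_vector_mult_scaleR inner_commute mult_commute_abs)
    from DERIV_pos_inc_right[OF this] neg
    obtain d where d: "d > 0" "\<And>t. t > 0 \<Longrightarrow> t < d \<Longrightarrow> g' 0 < g' t" by auto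
    have g'0: "g' 0 = 0" by (simp add: g'_def Gx)
    obtain r where r: "r > 0" "ball x r \<subseteq> S" using S openE by blast
    define t where "t = min (d / 2) (r / (2 * (norm v + 1)))"
    have t: "t > 0" "t < d" using d r by (auto simp: t_def intro!: divide_pos_pos add_nonneg_pos)
    have inS: "x + s *\<^sub>R v \<in> S" if "0 \<le> s" "s \<le> t" for s
    proof -
      have "s * norm v \<le> (r / (2 * (norm v + 1))) * (norm v + 1)"
        using that r by (intro mult_mono) (auto simp: t_def)
      also have "\<dots> = r / 2"
      proof -
        have "norm v + 1 \<noteq> 0" using norm_ge_zero[of v] by linarith
        then show ?thesis by (simp only: times_divide_eq_left nonzero_mult_divide_mult_cancel_right not_False_eq_True)
      qed
      also have "\<dots> < r" using r by simp
      finally show ?thesis using that r(2) by (auto simp: dist_norm)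
    qed
    have "\<exists>z. 0 < z \<and> z < t \<and> g t - g 0 = (t - 0) * g' z"
      using t by (intro MVT2 dg inS) auto
    then obtain z where z: "0 < z" "z < t" "g t - g 0 = t * g' z" by auto
    have "g' z > 0" using d(2)[of z] z t g'0 by auto
    then have "t * g' z > 0" using t by simp
    then have "g t > g 0" using z(3) by linarith
    moreover have "g t \<le> g 0" using max[OF inS[of t]] t by (simp add: g_def)
    ultimately show False by simp
  qed
qed

section \<open>Images of contact sets under approximate gradients\<close>

text \<open>The integrand of the area inequality restricted to contact points: at a contact point of \<open>u\<close> from above the matrix
\<open>A = - D\<^sup>2 u\<close> is nonnegative definite, and elsewhere nothing is counted.\<close>

definition det_nonneg :: "real^'n::finite^'n \<Rightarrow> real" where
  "det_nonneg A = (if sym_nonneg_definite A then det A else 0)"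

lemma det_nonneg_ge_0: "0 \<le> det_nonneg A"
  by (simp add: det_nonneg_def nonneg_definite_det_bounds)

lemma det_nonneg_le_trace_power: "det_nonneg A \<le> \<bar>trace A\<bar> ^ CARD('n)" for A :: "real^'n::finite^'n"
proof (cases "sym_nonneg_definite A")
  case True
  then have "0 \<le> trace A" unfolding trace_def by (intro sum_nonneg nonneg_definite_diagonal_entry)
  then show ?thesis using nonneg_definite_det_bounds(2)[OF True] True by (simp add: det_nonneg_def)
qed (simp add: det_nonneg_def)

lemma closed_nonneg_definite: "closed {A :: real^'n::finite^'n. sym_nonneg_definite A}"
proof -
  have eq: "sym_nonneg_definite A \<longleftrightarrow> (\<forall>i j. A $ j $ i = A $ i $ j) \<and>
      (\<forall>v. 0 \<le> (\<Sum>i\<in>UNIV. v $ i * (\<Sum>j\<in>UNIV. A $ i $ j * v $ j)))" for A :: "real^'n^'n"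
    by (simp add: sym_nonneg_definite_def vec_eq_iff transpose_def inner_vec_def matrix_vector_mult_def)
  have "closed {A :: real^'n^'n. \<forall>i j. A $ j $ i = A $ i $ j}"
    by (intro closed_Collect_all closed_Collect_eq continuous_intros)
  moreover have "closed {A :: real^'n^'n. \<forall>v. 0 \<le> (\<Sum>i\<in>UNIV. v $ i * (\<Sum>j\<in>UNIV. A $ i $ j * v $ j))}"
    by (intro closed_Collect_all closed_Collect_le continuous_intros)
  ultimately show ?thesis unfolding eq by (rule closed_Collect_conj)
qed

lemma continuous_on_det: "continuous_on S (det :: real^'n::finite^'n \<Rightarrow> real)"
  unfolding det_def[abs_def] by (intro continuous_intros)

lemma measurable_det_nonneg [measurable]:
  "(det_nonneg :: real^'n::finite^'n \<Rightarrow> real) \<in> borel_measurable borel"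
proof -
  have [measurable]: "{A :: real^'n^'n. sym_nonneg_definite A} \<in> sets borel"
    by (intro borel_closed closed_nonneg_definite)
  have [measurable]: "(det :: real^'n^'n \<Rightarrow> real) \<in> borel_measurable borel"
    by (intro borel_measurable_continuous_onI continuous_on_det)
  have eq: "det_nonneg = (\<lambda>A :: real^'n^'n. indicator {A. sym_nonneg_definite A} A * det A)"
    by (auto simp: det_nonneg_def fun_eq_iff)
  show ?thesis unfolding eq by measurable
qed

text \<open>At a nonnegative definite matrix the determinant is continuous and nonnegative, and the remaining matrices form an
open set on which \<open>det_nonneg\<close> vanishes.\<close>

lemma det_nonneg_upper_semicontinuous:
  fixes A :: "nat \<Rightarrow> real^'n::finite^'n"
  assumes "A \<longlonglongrightarrow> B"
  shows "(\<lambda>n. max 0 (det_nonneg (A n) - det_nonneg B)) \<longlonglongrightarrow> 0"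
proof (cases "sym_nonneg_definite B")
  case True
  have "(\<lambda>n. det (A n)) \<longlonglongrightarrow> det B"
    using continuous_on_tendsto_compose[OF continuous_on_det[of UNIV] assms] by simp
  then have lim: "(\<lambda>n. \<bar>det (A n) - det B\<bar>) \<longlonglongrightarrow> 0"
    by (simp add: LIM_zero tendsto_rabs_zero)
  have le: "max 0 (det_nonneg (A n) - det_nonneg B) \<le> \<bar>det (A n) - det B\<bar>" for n
    using True nonneg_definite_det_bounds(1)[OF True] by (auto simp: det_nonneg_def)
  show ?thesis
    by (rule tendsto_sandwich[OF always_eventually[OF allI] always_eventually[OF allI] tendsto_const lim])
       (rule max.cobounded1, rule le)
next
  case False
  have "open (- {A :: real^'n^'n. sym_nonneg_definite A})" by (intro open_Compl closed_nonneg_definite)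
  then have "\<forall>\<^sub>F n in sequentially. A n \<in> - {A. sym_nonneg_definite A}"
    using assms False by (intro topological_tendstoD) auto
  then have "\<forall>\<^sub>F n in sequentially. max 0 (det_nonneg (A n) - det_nonneg B) = 0"
    by eventually_elim (use False in \<open>auto simp: det_nonneg_def\<close>)
  then show ?thesis by (simp add: tendsto_eventually)
qed

lemma measurable_matrix:
  fixes v :: "'n::finite \<Rightarrow> 'n \<Rightarrow> 'a \<Rightarrow> real"
  assumes "\<And>i j. v i j \<in> borel_measurable M"
  shows "(\<lambda>x. \<chi> i j. v i j x) \<in> borel_measurable M"
proof (subst borel_measurable_euclidean_space, rule ballI)
  fix b :: "real^'n^'n" assume "b \<in> Basis"
  then obtain i j where "b = axis i (axis j 1)" by (auto simp: Basis_vec_def)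
  then show "(\<lambda>x. (\<chi> i j. v i j x) \<bullet> b) \<in> borel_measurable M"
    using assms by (simp add: inner_axis)
qed

lemma tendsto_matrix:
  fixes A :: "nat \<Rightarrow> real^'n::finite^'n"
  assumes "\<And>i j. (\<lambda>n. A n $ i $ j) \<longlonglongrightarrow> B $ i $ j"
  shows "A \<longlonglongrightarrow> B"
  by (intro vec_tendstoI assms)

text \<open>The area inequality bounds \<open>|P|\<close> by the integral over \<open>V\<close> of \<open>det_nonneg\<close> at the mollified matrix, for every \<open>n\<close>.
To pass to the limit, the matrices are made to converge almost everywhere along a subsequence.  The values of
\<open>det_nonneg\<close> are at most \<open>mollify (e n) g\<close> with \<open>g = |tr v|\<^sup>d\<close>, where \<open>d\<close> is the dimension.  This bound
depends on \<open>n\<close>, but its distance \<open>q n\<close> from the fixed integrable function \<open>g\<close> tends to \<open>0\<close> in L1.  Hence the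
excess of \<open>det_nonneg\<close> over its limit value, diminished by \<open>q n\<close>, is dominated by \<open>g\<close> and tends to \<open>0\<close> by upper
semicontinuity.\<close>

lemma measure_gradient_image_limit:
  fixes u :: "real^'n::finite \<Rightarrow> real" and v :: "'n \<Rightarrow> 'n \<Rightarrow> real^'n \<Rightarrow> real"
  assumes u: "continuous_on UNIV u"
    and v: "\<And>i j. integrable lborel (v i j)"
    and vd: "integrable lborel (\<lambda>x. \<bar>\<Sum>i\<in>UNIV. v i i x\<bar> ^ CARD('n))"
    and V: "bounded V" "V \<in> sets borel"
    and e: "\<And>n. 0 < e n" "e \<longlonglongrightarrow> 0"
    and hess: "\<And>n x i j. x \<in> V \<Longrightarrow> mollify_hess (e n) u x $ i $ j = mollify (e n) (v i j) x"
    and P: "P \<in> sets borel"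
      "\<And>n. P \<subseteq> mollify_grad (e n) u ` {x \<in> V. sym_nonneg_definite (- mollify_hess (e n) u x)}"
  shows "measure lborel P \<le> (\<integral>x. indicator V x * det_nonneg (\<chi> i j. - v i j x) \<partial>lborel)"
    and "integrable lborel (\<lambda>x. indicator V x * det_nonneg (\<chi> i j. - v i j x))"
proof -
  define A where "A n x = (\<chi> i j. - mollify (e n) (v i j) x)" for n x
  define B where "B x = (\<chi> i j. - v i j x)" for x
  define T where "T x = (\<Sum>i\<in>UNIV. v i i x)" for x
  define g where "g x = \<bar>T x\<bar> ^ CARD('n)" for x
  \<comment> \<open>The error of the dominating function.\<close>
  define q where "q n x = indicator V x * \<bar>mollify (e n) g x - g x\<bar>" for n x
  have [measurable]: "V \<in> sets borel" "v i j \<in> borel_measurable borel" for i j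
    using V borel_measurable_integrable[OF v] by auto
  have Am[measurable]: "A n \<in> borel_measurable borel" for n
    unfolding A_def[abs_def] by (intro measurable_matrix) measurable
  have Bm[measurable]: "B \<in> borel_measurable borel"
    unfolding B_def[abs_def] by (intro measurable_matrix) measurable
  have Tm[measurable]: "T \<in> borel_measurable borel" unfolding T_def[abs_def] by measurable
  have gm[measurable]: "g \<in> borel_measurable borel" unfolding g_def[abs_def] by measurable
  have T: "integrable lborel T" unfolding T_def[abs_def] using v by simp
  have g: "integrable lborel g" using vd by (simp add: g_def[abs_def] T_def)
  have g0: "0 \<le> g x" for x by (simp add: g_def)
  have A_hess: "- mollify_hess (e n) u x = A n x" if "x \<in> V" for n x
    using hess[OF that] by (simp add: A_def vec_eq_iff)

  have bound_B: "det_nonneg (B x) \<le> g x" for x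
  proof -
    have "trace (B x) = - T x" by (simp add: trace_def B_def T_def sum_negf)
    then show ?thesis using det_nonneg_le_trace_power[of "B x"] by (simp add: g_def)
  qed
  have bound_A: "det_nonneg (A n x) \<le> mollify (e n) g x" for n x
  proof -
    have "trace (A n x) = - mollify (e n) T x"
      using v e by (simp add: trace_def A_def T_def[abs_def] sum_negf mollify_def sum_distrib_right integrable_mult_mollifier)
    then have "det_nonneg (A n x) \<le> \<bar>mollify (e n) T x\<bar> ^ CARD('n)"
      using det_nonneg_le_trace_power[of "A n x"] by simp
    also have "\<dots> \<le> mollify (e n) g x"
      unfolding g_def[abs_def] using T g e by (intro mollify_power_le) (auto simp: g_def[abs_def])
    finally show ?thesis .
  qed
  have intVg: "integrable lborel (\<lambda>x. indicator V x * g x)"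
    using integrable_mult_indicator[of V lborel g] g by simp
  show intB: "integrable lborel (\<lambda>x. indicator V x * det_nonneg (\<chi> i j. - v i j x))"
    unfolding B_def[symmetric]
    by (rule Bochner_Integration.integrable_bound[OF intVg])
       (use bound_B g0 in \<open>auto simp: indicator_def det_nonneg_ge_0\<close>)
  have q: "integrable lborel (q n)" "(\<lambda>n. \<integral>x. q n x \<partial>lborel) \<longlonglongrightarrow> 0" for n
    unfolding q_def[abs_def] using mollify_tendsto_L1[OF g V e] by auto
  have intA: "integrable lborel (\<lambda>x. indicator V x * det_nonneg (A n x))" for n
  proof (rule Bochner_Integration.integrable_bound)
    show "integrable lborel (\<lambda>x. indicator V x * g x + q n x)" using intVg q by simp
    show "AE x in lborel. norm (indicator V x * det_nonneg (A n x)) \<le> norm (indicator V x * g x + q n x)"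
    proof (rule AE_I2)
      fix x
      have "det_nonneg (A n x) \<le> g x + \<bar>mollify (e n) g x - g x\<bar>"
        using bound_A[of n x] by linarith
      then show "norm (indicator V x * det_nonneg (A n x)) \<le> norm (indicator V x * g x + q n x)"
        using g0[of x] det_nonneg_ge_0[of "A n x"] by (auto simp: indicator_def q_def)
    qed
  qed measurable
  have area: "measure lborel P \<le> (\<integral>x. indicator V x * det_nonneg (A n x) \<partial>lborel)" for n
  proof -
    define S where "S = {x \<in> V. sym_nonneg_definite (- mollify_hess (e n) u x)}"
    have S_eq: "S = V \<inter> A n -` {A. sym_nonneg_definite A}"
      by (auto simp: S_def A_hess)
    have Sm: "S \<in> sets borel"
      unfolding S_eq using measurable_sets_borel[OF Am, of "{A. sym_nonneg_definite A}"]
      by (intro sets.Int V) (simp add: borel_closed closed_nonneg_definite)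
    have eq: "(\<lambda>x. indicator S x * \<bar>det (mollify_hess (e n) u x)\<bar>) = (\<lambda>x. indicator V x * det_nonneg (A n x))"
    proof
      fix x
      have "\<bar>det (mollify_hess (e n) u x)\<bar> = det_nonneg (A n x)" if "x \<in> S"
      proof -
        have "sym_nonneg_definite (A n x)" "x \<in> V" using that by (auto simp: S_eq)
        moreover have "\<bar>det (- M)\<bar> = \<bar>det M\<bar>" for M :: "real^'n^'n"
        proof -
          have "- M = diag (\<lambda>_. -1) ** M"
            by (simp add: diag_def matrix_matrix_mult_def vec_eq_iff if_distrib[of "\<lambda>x. x * _"] cong: if_cong)
          then show ?thesis by (simp add: det_mul det_diag abs_mult power_abs[symmetric])
        qed
        ultimately show ?thesis
          using A_hess[of x n, symmetric] nonneg_definite_det_bounds(1)[of "A n x"]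
          by (simp add: det_nonneg_def) (metis abs_of_nonneg)
      qed
      then show "indicator S x * \<bar>det (mollify_hess (e n) u x)\<bar> = indicator V x * det_nonneg (A n x)"
        by (auto simp: indicator_def S_eq det_nonneg_def)
    qed
    have "measure lborel P \<le> (\<integral>x. indicator S x * \<bar>det (mollify_hess (e n) u x)\<bar> \<partial>lborel)"
      using P Sm intA[of n] mollify_grad_has_derivative[OF u e(1)]
      by (intro measure_image_le_integral_det) (auto simp: S_def eq[unfolded S_def])
    then show ?thesis unfolding eq .
  qed

  \<comment> \<open>One sum over all entries yields a subsequence that works for every entry.\<close>
  define w where "w n x = (\<Sum>i\<in>UNIV. \<Sum>j\<in>UNIV. indicator V x * \<bar>mollify (e n) (v i j) x - v i j x\<bar>)" for n x
  note w_ij = mollify_tendsto_L1(2)[OF v V e]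
  have w_int: "integrable lborel (w n)" for n
    unfolding w_def[abs_def] by (intro Bochner_Integration.integrable_sum w_ij)
  have "(\<lambda>n. \<integral>x. norm (w n x) \<partial>lborel) \<longlonglongrightarrow> 0"
  proof -
    have "(\<lambda>n. \<Sum>i\<in>UNIV. \<Sum>j\<in>UNIV. \<integral>x. indicator V x * \<bar>mollify (e n) (v i j) x - v i j x\<bar> \<partial>lborel) \<longlonglongrightarrow> 0"
      by (intro tendsto_null_sum mollify_tendsto_L1(1)[OF v V e])
    moreover have "(\<integral>x. norm (w n x) \<partial>lborel)
      = (\<Sum>i\<in>UNIV. \<Sum>j\<in>UNIV. \<integral>x. indicator V x * \<bar>mollify (e n) (v i j) x - v i j x\<bar> \<partial>lborel)" for n
    proof -
      have "(\<integral>x. norm (w n x) \<partial>lborel) = (\<integral>x. w n x \<partial>lborel)"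
        by (intro Bochner_Integration.integral_cong refl) (simp add: w_def sum_nonneg)
      also have "\<dots> = (\<Sum>i\<in>UNIV. \<integral>x. (\<Sum>j\<in>UNIV. indicator V x * \<bar>mollify (e n) (v i j) x - v i j x\<bar>) \<partial>lborel)"
        unfolding w_def by (intro Bochner_Integration.integral_sum Bochner_Integration.integrable_sum w_ij)
      also have "\<dots> = (\<Sum>i\<in>UNIV. \<Sum>j\<in>UNIV. \<integral>x. indicator V x * \<bar>mollify (e n) (v i j) x - v i j x\<bar> \<partial>lborel)"
        by (intro sum.cong refl Bochner_Integration.integral_sum w_ij)
      finally show ?thesis .
    qed
    ultimately show ?thesis by simp
  qed
  from tendsto_L1_AE_subseq[OF w_int this]
  obtain s where s: "strict_mono s" and w_AE: "AE x in lborel. (\<lambda>n. w (s n) x) \<longlonglongrightarrow> 0" by blast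
  have A_lim: "(\<lambda>n. A (s n) x) \<longlonglongrightarrow> B x" if "x \<in> V" "(\<lambda>n. w (s n) x) \<longlonglongrightarrow> 0" for x
  proof (rule tendsto_matrix)
    fix i j
    have "\<bar>mollify (e n) (v i j) x - v i j x\<bar> \<le> w n x" for n
    proof -
      have "\<bar>mollify (e n) (v i j) x - v i j x\<bar> \<le> (\<Sum>j\<in>UNIV. \<bar>mollify (e n) (v i j) x - v i j x\<bar>)"
        by (intro member_le_sum[of j]) auto
      also have "\<dots> \<le> (\<Sum>i\<in>UNIV. \<Sum>j\<in>UNIV. \<bar>mollify (e n) (v i j) x - v i j x\<bar>)"
        by (intro member_le_sum[of i UNIV "\<lambda>i. \<Sum>j\<in>UNIV. \<bar>mollify (e n) (v i j) x - v i j x\<bar>"] sum_nonneg) auto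
      finally show ?thesis using that by (simp add: w_def)
    qed
    then have "(\<lambda>n. \<bar>mollify (e (s n)) (v i j) x - v i j x\<bar>) \<longlonglongrightarrow> 0"
      by (intro tendsto_sandwich[OF always_eventually always_eventually tendsto_const that(2)] allI) simp_all
    then have "(\<lambda>n. mollify (e (s n)) (v i j) x) \<longlonglongrightarrow> v i j x"
      by (simp add: tendsto_rabs_zero_iff LIM_zero_iff)
    then show "(\<lambda>n. A (s n) x $ i $ j) \<longlonglongrightarrow> B x $ i $ j"
      by (auto simp: A_def B_def intro: tendsto_minus)
  qed
  \<comment> \<open>The excess over the limit value, reduced by \<open>q\<close> so that \<open>g\<close> dominates it.\<close>
  define h where "h n x = indicator V x * max 0 (det_nonneg (A (s n) x) - det_nonneg (B x) - q (s n) x)" for n x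
  have [measurable]: "q n \<in> borel_measurable borel" for n unfolding q_def[abs_def] by measurable
  have hm[measurable]: "h n \<in> borel_measurable borel" for n unfolding h_def[abs_def] by measurable
  have h_bound: "norm (h n x) \<le> indicator V x * g x" for n x
    using bound_A[of "s n" x] det_nonneg_ge_0[of "B x"] g0[of x] by (auto simp: h_def q_def indicator_def)
  have "(\<lambda>n. \<integral>x. h n x \<partial>lborel) \<longlonglongrightarrow> (\<integral>x. 0 \<partial>(lborel :: (real^'n) measure))"
  proof (rule integral_dominated_convergence[OF _ _ intVg])
    show "AE x in lborel. (\<lambda>n. h n x) \<longlonglongrightarrow> 0"
      using w_AE
    proof (rule AE_mp, intro AE_I2 impI)
      fix x assume x: "(\<lambda>n. w (s n) x) \<longlonglongrightarrow> 0"
      show "(\<lambda>n. h n x) \<longlonglongrightarrow> 0"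
      proof (cases "x \<in> V")
        case True
        show ?thesis
        proof (rule tendsto_sandwich[OF always_eventually[OF allI] always_eventually[OF allI] tendsto_const
              det_nonneg_upper_semicontinuous[OF A_lim[OF True x]]])
          show "0 \<le> h n x" for n by (simp add: h_def)
          have "max 0 (a - b - \<bar>c\<bar>) \<le> max 0 (a - b)" for a b c :: real by (rule max.mono) simp_all
          then show "h n x \<le> max 0 (det_nonneg (A (s n) x) - det_nonneg (B x))" for n
            using True by (simp add: h_def q_def)
        qed
      qed (simp add: h_def)
    qed
  qed (use h_bound in auto)
  then have h_lim: "(\<lambda>n. \<integral>x. h n x \<partial>lborel) \<longlonglongrightarrow> 0" by simp
  have h_int: "integrable lborel (h n)" for n
    by (rule Bochner_Integration.integrable_bound[OF intVg]) (use h_bound g0 in \<open>auto intro: order_trans\<close>)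
  have le: "measure lborel P \<le> (\<integral>x. indicator V x * det_nonneg (B x) \<partial>lborel) + (\<integral>x. h n x \<partial>lborel) + (\<integral>x. q (s n) x \<partial>lborel)" for n
  proof -
    have intB': "integrable lborel (\<lambda>x. indicator V x * det_nonneg (B x))" using intB by (simp add: B_def)
    have "measure lborel P \<le> (\<integral>x. indicator V x * det_nonneg (A (s n) x) \<partial>lborel)" by (rule area)
    also have "\<dots> \<le> (\<integral>x. indicator V x * det_nonneg (B x) + h n x + q (s n) x \<partial>lborel)"
    proof (intro integral_mono intA Bochner_Integration.integrable_add intB' h_int q(1))
      fix x
      show "indicator V x * det_nonneg (A (s n) x) \<le> indicator V x * det_nonneg (B x) + h n x + q (s n) x"
        by (auto simp: h_def indicator_def q_def)
    qed
    also have "\<dots> = (\<integral>x. indicator V x * det_nonneg (B x) \<partial>lborel) + (\<integral>x. h n x \<partial>lborel) + (\<integral>x. q (s n) x \<partial>lborel)"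
      using intB' h_int q by simp
    finally show ?thesis .
  qed
  have "(\<lambda>n. (\<integral>x. indicator V x * det_nonneg (B x) \<partial>lborel) + (\<integral>x. h n x \<partial>lborel) + (\<integral>x. q (s n) x \<partial>lborel))
     \<longlonglongrightarrow> (\<integral>x. indicator V x * det_nonneg (B x) \<partial>lborel) + 0 + 0"
    using LIMSEQ_subseq_LIMSEQ[OF q(2) s] by (intro tendsto_add tendsto_const h_lim) (simp add: o_def)
  from LIMSEQ_le_const[OF this] le
  show "measure lborel P \<le> (\<integral>x. indicator V x * det_nonneg (\<chi> i j. - v i j x) \<partial>lborel)"
    by (auto simp: B_def)
qed

section \<open>Weak second derivatives and mollification\<close>

lemma lebesgue_on_integral_eq_lborel:
  fixes f :: "real^'n::finite \<Rightarrow> real"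
  assumes U: "U \<in> sets lebesgue" and f: "f \<in> borel_measurable (lebesgue_on U)"
    and g: "g \<in> borel_measurable borel" and eq: "AE y in lborel. indicator U y * f y = g y"
  shows "integral\<^sup>L (lebesgue_on U) f = integral\<^sup>L lborel g"
proof -
  have "(\<lambda>y. indicator U y *\<^sub>R f y) \<in> borel_measurable lebesgue"
    using f by (subst borel_measurable_restrict_space_iff[symmetric]) (use U in auto)
  then have m: "(\<lambda>y. indicator U y * f y) \<in> borel_measurable lebesgue" by simp
  have "integral\<^sup>L (lebesgue_on U) f = integral\<^sup>L lebesgue (\<lambda>y. indicator U y * f y)"
    using U by (subst integral_restrict_space) auto
  also have "\<dots> = integral\<^sup>L lebesgue g"
  proof (rule integral_cong_AE[OF m _ AE_completion[OF eq]])
    show "g \<in> borel_measurable lebesgue" by (rule measurable_completion) (use g in simp)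
  qed
  also have "\<dots> = integral\<^sup>L lborel g"
    using g by (intro integral_completion) auto
  finally show ?thesis .
qed

text \<open>The definition of the weak derivative is tested with the bump about \<open>x\<close>, whose second derivatives in \<open>y\<close> are
those of the convolution kernel in \<open>x\<close>.\<close>

lemma mollify_hess_eq_mollify_weak_deriv:
  fixes u0 u h v :: "real^'n::finite \<Rightarrow> real"
  assumes w: "has_weak_deriv U [i, j] u0 h" and U: "U \<in> sets lebesgue"
    and u: "continuous_on UNIV u" "\<And>y. y \<in> cball x e \<Longrightarrow> u y = u0 y"
    and v: "v \<in> borel_measurable borel" "AE y in lborel. y \<in> cball x e \<longrightarrow> v y = h y"
    and e: "e > 0" "cball x e \<subseteq> U"
  shows "mollify_hess e u x $ i $ j = mollify e v x"
proof -
  have hm: "h \<in> borel_measurable (lebesgue_on U)" "u0 \<in> borel_measurable (lebesgue_on U)"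
    using w by (auto simp: has_weak_deriv_def Lp_loc_def)
  have um: "u \<in> borel_measurable borel" using u(1) by (rule borel_measurable_continuous_onI)
  have bm: "bump k e x \<in> borel_measurable borel" for k
    by (intro borel_measurable_continuous_onI continuous_intros)
  have hess_m: "bump_hess e i j x \<in> borel_measurable borel"
    unfolding bump_hess_def by (cases "i = j") (auto intro!: borel_measurable_continuous_onI continuous_intros)
  have restr: "f \<in> borel_measurable (lebesgue_on U)" if "f \<in> borel_measurable borel" for f :: "real^'n \<Rightarrow> real"
    using that by (intro measurable_restrict_space1 measurable_completion) simp
  have out: "bump k e x y = 0" "bump_hess e i j x y = 0" if "y \<notin> cball x e" for k y
    using that e(1) by (auto simp: bump_eq_0_outside_cball bump_hess_def)
  have "(LINT y|lebesgue_on U. u0 y * bump_hess e i j x y) = (\<integral>y. u y * bump_hess e i j x y \<partial>lborel)"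
  proof (rule lebesgue_on_integral_eq_lborel[OF U])
    show "AE y in lborel. indicator U y * (u0 y * bump_hess e i j x y) = u y * bump_hess e i j x y"
    proof (rule AE_I2)
      fix y
      show "indicator U y * (u0 y * bump_hess e i j x y) = u y * bump_hess e i j x y"
        using u(2)[of y] out(2)[of y] e(2) by (cases "y \<in> cball x e") (auto simp: indicator_def)
    qed
  qed (use hm um hess_m restr[OF hess_m] in \<open>auto intro: borel_measurable_times\<close>)
  moreover have "(LINT y|lebesgue_on U. h y * bump 0 e x y) = (\<integral>y. v y * bump 0 e x y \<partial>lborel)"
  proof (rule lebesgue_on_integral_eq_lborel[OF U])
    show "AE y in lborel. indicator U y * (h y * bump 0 e x y) = v y * bump 0 e x y"
      using v(2)
    proof (rule AE_mp, intro AE_I2 impI)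
      fix y assume "y \<in> cball x e \<longrightarrow> v y = h y"
      then show "indicator U y * (h y * bump 0 e x y) = v y * bump 0 e x y"
        using out(1)[of y] e(2) by (cases "y \<in> cball x e") (auto simp: indicator_def)
    qed
  qed (use hm v bm restr[OF bm] in \<open>auto intro: borel_measurable_times\<close>)
  moreover have tf: "test_function U (bump 0 e x)" using e by (intro test_function_bump) auto
  have "(LINT y|lebesgue_on U. u0 y * bump_hess e i j x y) = (LINT y|lebesgue_on U. h y * bump 0 e x y)"
    using w[unfolded has_weak_deriv_def, THEN conjunct2, THEN conjunct2, rule_format, OF tf]
    by (simp add: partial_derivs_bump)
  ultimately have "(\<integral>y. u y * bump_hess e i j x y \<partial>lborel) = (\<integral>y. v y * bump 0 e x y \<partial>lborel)" by simp
  then show ?thesis by (simp add: mollify_hess_def mollify_def mollifier_def)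
qed

lemma Lp_loc_borel_representative:
  fixes h :: "real^'n::finite \<Rightarrow> real"
  assumes h: "h \<in> Lp_loc p U" and p: "p > 0" and U: "U \<in> sets lebesgue" and K: "compact K" "K \<subseteq> U"
  obtains v where "v \<in> borel_measurable borel" "AE x in lborel. v x = indicator K x * h x"
    "integrable lborel (\<lambda>x. \<bar>v x\<bar> powr p)"
proof -
  have "(\<lambda>x. indicator U x *\<^sub>R h x) \<in> borel_measurable lebesgue"
    using h U by (subst borel_measurable_restrict_space_iff[symmetric]) (auto simp: Lp_loc_def)
  moreover have KL: "K \<in> sets lebesgue" using K(1) by (simp add: borel_compact)
  ultimately have "(\<lambda>x. indicator K x * (indicator U x *\<^sub>R h x)) \<in> borel_measurable lebesgue"
    by (intro borel_measurable_times borel_measurable_indicator) auto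
  moreover have "(\<lambda>x. indicator K x * (indicator U x *\<^sub>R h x)) = (\<lambda>x. indicator K x * h x)"
    using K(2) by (auto simp: indicator_def fun_eq_iff)
  ultimately have m: "(\<lambda>x. indicator K x * h x) \<in> borel_measurable (completion lborel)" by (simp only:)
  obtain v where v: "v \<in> borel_measurable borel" "AE x in lborel. indicator K x * h x = v x"
    using completion_ex_borel_measurable_real[OF m] by auto
  have "integrable (lebesgue_on K) (\<lambda>x. \<bar>h x\<bar> powr p)" using h K by (auto simp: Lp_loc_def)
  then have "integrable lebesgue (\<lambda>x. indicator K x * \<bar>h x\<bar> powr p)"
    using KL by (subst (asm) integrable_restrict_space) auto
  moreover have "indicator K x * \<bar>h x\<bar> powr p = \<bar>indicator K x * h x\<bar> powr p" for x
    using p by (auto simp: indicator_def)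
  ultimately have I: "integrable lebesgue (\<lambda>x. \<bar>indicator K x * h x\<bar> powr p)" by simp
  have vm: "(\<lambda>x. \<bar>v x\<bar> powr p) \<in> borel_measurable lborel" using v(1) by simp
  have "integrable lebesgue (\<lambda>x. \<bar>v x\<bar> powr p)"
  proof (rule integrable_cong_AE_imp[OF I])
    show "(\<lambda>x. \<bar>v x\<bar> powr p) \<in> borel_measurable lebesgue" using vm by (rule measurable_completion)
    show "AE x in lebesgue. \<bar>indicator K x * h x\<bar> powr p = \<bar>v x\<bar> powr p"
      using AE_completion[OF v(2)] by (rule AE_mp) (auto intro!: AE_I2)
  qed
  then have "integrable lborel (\<lambda>x. \<bar>v x\<bar> powr p)"
    using vm by (simp add: integrable_completion)
  moreover have "AE x in lborel. v x = indicator K x * h x" using v(2) by (rule AE_mp) (auto intro!: AE_I2)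
  ultimately show thesis using that v(1) by blast
qed

text \<open>This gives uniqueness of weak derivatives: two of them have the same mollifications.\<close>

lemma mollify_eq_imp_AE_eq:
  fixes v w :: "real^'n::finite \<Rightarrow> real"
  assumes v: "integrable lborel v" and w: "integrable lborel w"
    and S: "bounded S" "S \<in> sets borel" and e: "\<And>n. 0 < e n" "e \<longlonglongrightarrow> 0"
    and eq: "\<And>n x. x \<in> S \<Longrightarrow> mollify (e n) v x = mollify (e n) w x"
  shows "AE x in lborel. x \<in> S \<longrightarrow> v x = w x"
proof -
  let ?I = "\<integral>x. indicator S x * \<bar>v x - w x\<bar> \<partial>lborel"
  note lv = mollify_tendsto_L1[OF v S e] and lw = mollify_tendsto_L1[OF w S e]
  have int: "integrable lborel (\<lambda>x. indicator S x * \<bar>v x - w x\<bar>)"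
    using integrable_mult_indicator[of S lborel "\<lambda>x. \<bar>v x - w x\<bar>"] v w S by simp
  have "?I \<le> (\<integral>x. indicator S x * \<bar>mollify (e n) v x - v x\<bar> \<partial>lborel) +
      (\<integral>x. indicator S x * \<bar>mollify (e n) w x - w x\<bar> \<partial>lborel)" for n
  proof -
    have "?I \<le> (\<integral>x. indicator S x * \<bar>mollify (e n) v x - v x\<bar> + indicator S x * \<bar>mollify (e n) w x - w x\<bar> \<partial>lborel)"
    proof (intro integral_mono int Bochner_Integration.integrable_add lv(2) lw(2))
      fix x
      show "indicator S x * \<bar>v x - w x\<bar> \<le>
         indicator S x * \<bar>mollify (e n) v x - v x\<bar> + indicator S x * \<bar>mollify (e n) w x - w x\<bar>"
        using eq[of x n] by (cases "x \<in> S") auto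
    qed
    also have "\<dots> = (\<integral>x. indicator S x * \<bar>mollify (e n) v x - v x\<bar> \<partial>lborel) +
      (\<integral>x. indicator S x * \<bar>mollify (e n) w x - w x\<bar> \<partial>lborel)"
      by (intro Bochner_Integration.integral_add lv(2) lw(2))
    finally show ?thesis .
  qed
  then have "?I \<le> 0 + 0"
    by (intro LIMSEQ_le_const[OF tendsto_add[OF lv(1) lw(1)]]) auto
  moreover have "0 \<le> ?I" by (intro integral_nonneg_AE) simp
  ultimately have "?I = 0" by simp
  then have "AE x in lborel. indicator S x * \<bar>v x - w x\<bar> = 0"
    using integral_nonneg_eq_0_iff_AE[OF int] by simp
  then show ?thesis by (rule AE_mp) (auto intro!: AE_I2)
qed

lemma integrable_abs_sum_power:
  fixes v :: "'n::finite \<Rightarrow> 'a \<Rightarrow> real"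
  assumes m: "\<And>i. v i \<in> borel_measurable M" and int: "\<And>i. integrable M (\<lambda>x. \<bar>v i x\<bar> ^ d)"
  shows "integrable M (\<lambda>x. \<bar>\<Sum>i\<in>UNIV. v i x\<bar> ^ d)"
proof (rule Bochner_Integration.integrable_bound)
  show "integrable M (\<lambda>x. real CARD('n) ^ d * (\<Sum>i\<in>UNIV. \<bar>v i x\<bar> ^ d))" using int by simp
  show "(\<lambda>x. \<bar>\<Sum>i\<in>UNIV. v i x\<bar> ^ d) \<in> borel_measurable M" using m by measurable
  show "AE x in M. norm (\<bar>\<Sum>i\<in>UNIV. v i x\<bar> ^ d) \<le> norm (real CARD('n) ^ d * (\<Sum>i\<in>UNIV. \<bar>v i x\<bar> ^ d))"
  proof (rule AE_I2)
    fix x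
    obtain k where k: "\<And>i. \<bar>v i x\<bar> \<le> \<bar>v k x\<bar>"
    proof -
      have "Max (range (\<lambda>i. \<bar>v i x\<bar>)) \<in> range (\<lambda>i. \<bar>v i x\<bar>)" by (intro Max_in) auto
      then obtain k where "Max (range (\<lambda>i. \<bar>v i x\<bar>)) = \<bar>v k x\<bar>" by (rule rangeE)
      then have "\<bar>v i x\<bar> \<le> \<bar>v k x\<bar>" for i
        using Max_ge[of "range (\<lambda>i. \<bar>v i x\<bar>)" "\<bar>v i x\<bar>"] by simp
      then show thesis using that by blast
    qed
    have "\<bar>\<Sum>i\<in>UNIV. v i x\<bar> \<le> (\<Sum>i\<in>UNIV. \<bar>v i x\<bar>)" by (rule sum_abs)
    also have "\<dots> \<le> real CARD('n) * \<bar>v k x\<bar>" using sum_bounded_above[of UNIV "\<lambda>i. \<bar>v i x\<bar>"] k by simp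
    finally have "\<bar>\<Sum>i\<in>UNIV. v i x\<bar> ^ d \<le> (real CARD('n) * \<bar>v k x\<bar>) ^ d" by (intro power_mono) auto
    also have "\<dots> \<le> real CARD('n) ^ d * (\<Sum>i\<in>UNIV. \<bar>v i x\<bar> ^ d)"
      unfolding power_mult_distrib
      by (intro mult_left_mono member_le_sum[of k UNIV "\<lambda>i. \<bar>v i x\<bar> ^ d"]) auto
    finally show "norm (\<bar>\<Sum>i\<in>UNIV. v i x\<bar> ^ d) \<le> norm (real CARD('n) ^ d * (\<Sum>i\<in>UNIV. \<bar>v i x\<bar> ^ d))"
      by (simp add: abs_mult sum_nonneg abs_of_nonneg)
  qed
qed

text \<open>The matrix \<open>H\<close> is assumed to consist of weak second derivatives, which are locally integrable; its local
integrability to the power \<open>n\<close>, the dimension, comes from the derivatives that membership in the Sobolev space provides, after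
the two are identified almost everywhere.  The functions \<open>v i j\<close> are Borel measurable and extended by \<open>0\<close>, so that
they can be mollified on the whole space.\<close>

lemma second_derivative_representatives:
  fixes u0 u :: "real^'n::finite \<Rightarrow> real" and H :: "real^'n \<Rightarrow> real^'n^'n"
  assumes W: "u0 \<in> sobolev_loc 2 (real CARD('n)) (ball 0 1)"
    and H: "\<And>i j. has_weak_deriv (ball 0 1) [i, j] u0 (\<lambda>x. H x $ i $ j)"
    and u: "continuous_on UNIV u" "\<And>y. y \<in> ball 0 1 \<Longrightarrow> u y = u0 y"
    and r: "0 < r" "r < 1"
  obtains v where "\<And>i j. integrable lborel (v i j)"
    "integrable lborel (\<lambda>x. \<bar>\<Sum>i\<in>UNIV. v i i x\<bar> ^ CARD('n))"
    "\<And>i j. AE x in lborel. x \<in> cball 0 r \<longrightarrow> v i j x = H x $ i $ j"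
    "\<And>e x i j. 0 < e \<Longrightarrow> cball x e \<subseteq> cball 0 r \<Longrightarrow> mollify_hess e u x $ i $ j = mollify e (v i j) x"
proof -
  define d where "d = real CARD('n)"
  have d: "d > 0" by (simp add: d_def)
  \<comment> \<open>The derivatives are compared on the smaller ball; on the larger one they must be known for the mollifications
    at points of the smaller ball.\<close>
  define r' where "r' = (1 + r) / 2"
  have r': "r < r'" "r' < 1" using r by (auto simp: r'_def)
  have U: "ball (0 :: real^'n) 1 \<in> sets lebesgue" by simp
  have K: "compact (cball (0 :: real^'n) r)" "cball (0::real^'n) r \<subseteq> ball 0 1"
    "compact (cball (0 :: real^'n) r')" "cball (0::real^'n) r' \<subseteq> ball 0 1"
    using r r' by auto
  have ex: "\<exists>v. integrable lborel v \<and> (AE x in lborel. v x = indicator (cball 0 r) x * H x $ i $ j) \<and>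
      integrable lborel (\<lambda>x. \<bar>v x\<bar> ^ CARD('n))" for i j
  proof -
    have H1: "(\<lambda>x. H x $ i $ j) \<in> Lp_loc 1 (ball 0 1)" using H by (simp add: has_weak_deriv_def)
    have "length [i, j] \<le> 2" by simp
    then obtain h where h: "h \<in> Lp_loc d (ball 0 1)" "has_weak_deriv (ball 0 1) [i, j] u0 h"
      using W unfolding sobolev_loc_def d_def by blast
    then have h1: "h \<in> Lp_loc 1 (ball 0 1)" by (simp add: has_weak_deriv_def)
    have d1: "(0::real) < 1" by simp
    obtain vH where vH: "vH \<in> borel_measurable borel" "AE x in lborel. vH x = indicator (cball 0 r') x * H x $ i $ j"
       "integrable lborel (\<lambda>x. \<bar>vH x\<bar> powr 1)"
      by (rule Lp_loc_borel_representative[OF H1 d1 U K(3,4)])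
    obtain vh where vh: "vh \<in> borel_measurable borel" "AE x in lborel. vh x = indicator (cball 0 r') x * h x"
       "integrable lborel (\<lambda>x. \<bar>vh x\<bar> powr 1)"
      by (rule Lp_loc_borel_representative[OF h1 d1 U K(3,4)])
    \<comment> \<open>Integrability to the power \<open>n\<close> is read off from \<open>v\<close> and integrability from \<open>v'\<close>; both represent the same
      function \<open>h\<close>.\<close>
    obtain v where v: "v \<in> borel_measurable borel" "AE x in lborel. v x = indicator (cball 0 r) x * h x"
       "integrable lborel (\<lambda>x. \<bar>v x\<bar> powr d)"
      by (rule Lp_loc_borel_representative[OF h(1) d U K(1,2)])
    obtain v' where v': "v' \<in> borel_measurable borel" "AE x in lborel. v' x = indicator (cball 0 r) x * h x"
       "integrable lborel (\<lambda>x. \<bar>v' x\<bar> powr 1)"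
      by (rule Lp_loc_borel_representative[OF h1 d1 U K(1,2)])
    have int: "integrable lborel vH" "integrable lborel vh" "integrable lborel v'"
      using vH(1,3) vh(1,3) v'(1,3) by (simp_all add: integrable_abs_iff)
    define e where "e n = (r' - r) / (real n + 1)" for n :: nat
    have e: "0 < e n" "e n \<le> r' - r" for n
      using r' by (auto simp: e_def divide_simps mult_left_mono)
    have elim: "e \<longlonglongrightarrow> 0"
      using tendsto_mult_right_zero[OF LIMSEQ_inverse_real_of_nat, of "r' - r"] by (simp add: e_def[abs_def] divide_inverse add.commute)
    have sub: "cball x (e n) \<subseteq> cball 0 r'" if "x \<in> cball 0 r" for x :: "real^'n" and n
    proof
      fix y assume "y \<in> cball x (e n)"
      then have "norm y \<le> norm x + e n" by (metis dist_commute dist_norm mem_cball norm_triangle_sub order_trans add_left_mono)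
      then show "y \<in> cball 0 r'" using that e(2)[of n] by simp
    qed
    have "AE x in lborel. x \<in> cball 0 r \<longrightarrow> vH x = vh x"
    proof (rule mollify_eq_imp_AE_eq[OF int(1,2) _ _ e(1) elim])
      fix n and x :: "real^'n" assume x: "x \<in> cball 0 r"
      note s = sub[OF x, of n]
      have ub: "u y = u0 y" if "y \<in> cball x (e n)" for y using that s K(4) u(2) by blast
      have "AE y in lborel. y \<in> cball x (e n) \<longrightarrow> vH y = H y $ i $ j"
        using vH(2) by (rule AE_mp) (use s in \<open>auto intro!: AE_I2 simp: indicator_def\<close>)
      from mollify_hess_eq_mollify_weak_deriv[OF H U u(1) ub vH(1) this e(1) order_trans[OF s K(4)]]
      have "mollify_hess (e n) u x $ i $ j = mollify (e n) vH x" .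
      moreover have "AE y in lborel. y \<in> cball x (e n) \<longrightarrow> vh y = h y"
        using vh(2) by (rule AE_mp) (use s in \<open>auto intro!: AE_I2 simp: indicator_def\<close>)
      from mollify_hess_eq_mollify_weak_deriv[OF h(2) U u(1) ub vh(1) this e(1) order_trans[OF s K(4)]]
      have "mollify_hess (e n) u x $ i $ j = mollify (e n) vh x" .
      ultimately show "mollify (e n) vH x = mollify (e n) vh x" by simp
    qed auto
    then have Hv: "AE x in lborel. v' x = indicator (cball 0 r) x * H x $ i $ j"
      using vH(2) vh(2) v'(2)
      by eventually_elim (use r' in \<open>auto simp: indicator_def split: if_splits\<close>)
    have "AE x in lborel. \<bar>v x\<bar> powr d = \<bar>v' x\<bar> ^ CARD('n)"
      using v(2) v'(2) by eventually_elim (auto simp: d_def powr_realpow')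
    then have "integrable lborel (\<lambda>x. \<bar>v' x\<bar> ^ CARD('n))"
      using v(1) v'(1) by (intro integrable_cong_AE_imp[OF v(3)]) simp_all
    then show ?thesis using int(3) Hv by blast
  qed
  define v where "v i j = (SOME v. integrable lborel v \<and>
      (AE x in lborel. v x = indicator (cball 0 r) x * H x $ i $ j) \<and>
      integrable lborel (\<lambda>x. \<bar>v x\<bar> ^ CARD('n)))" for i j
  have "integrable lborel (v i j) \<and>
      (AE x in lborel. v i j x = indicator (cball 0 r) x * H x $ i $ j) \<and>
      integrable lborel (\<lambda>x. \<bar>v i j x\<bar> ^ CARD('n))" for i j
    unfolding v_def by (rule someI_ex[OF ex])
  then have v: "\<And>i j. integrable lborel (v i j)"
    "\<And>i j. AE x in lborel. v i j x = indicator (cball 0 r) x * H x $ i $ j"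
    "\<And>i j. integrable lborel (\<lambda>x. \<bar>v i j x\<bar> ^ CARD('n))" by blast+
  have vH: "AE x in lborel. x \<in> cball 0 r \<longrightarrow> v i j x = H x $ i $ j" for i j
    using v(2)[of i j] by (rule AE_mp) (auto intro!: AE_I2)
  show thesis
  proof (rule that[of v])
    show "integrable lborel (v i j)" for i j by (rule v(1))
    show "integrable lborel (\<lambda>x. \<bar>\<Sum>i\<in>UNIV. v i i x\<bar> ^ CARD('n))"
      using v(1,3) by (intro integrable_abs_sum_power) auto
    show "AE x in lborel. x \<in> cball 0 r \<longrightarrow> v i j x = H x $ i $ j" for i j by (rule vH)
    fix e x i j assume e: "0 < e" and s: "cball x e \<subseteq> cball (0 :: real^'n) r"
    have ub: "u y = u0 y" if "y \<in> cball x e" for y using that s K(2) u(2) by blast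
    have vm: "v i j \<in> borel_measurable borel" using v(1)[of i j] by auto
    have "AE y in lborel. y \<in> cball x e \<longrightarrow> v i j y = H y $ i $ j"
      using vH[of i j] by (rule AE_mp) (use s in \<open>auto intro!: AE_I2\<close>)
    from mollify_hess_eq_mollify_weak_deriv[OF H U u(1) ub vm this e order_trans[OF s K(2)]]
    show "mollify_hess e u x $ i $ j = mollify e (v i j) x" .
  qed
qed

section \<open>The weighted Aleksandrov estimate\<close>

lemma psi_pos: "norm x < 1 \<Longrightarrow> psi x > 0"
  by (simp add: psi_def abs_square_less_1)

text \<open>The condition \<open>|p| \<le> m - p \<bullet> x1\<close> describes the dual body, with respect to \<open>x1\<close>, of the unit ball, scaled by \<open>m\<close>.
Squaring and completing the square shows that it is an ellipsoid with one semiaxis \<open>m / \<psi>(x1)\<close>, in the direction of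
\<open>x1\<close>, and all others \<open>m / sqrt \<psi>(x1)\<close>.  The affine map \<open>f\<close> below sends it onto the unit ball.\<close>

lemma polar_set_volume:
  fixes x1 :: "real^'n::finite"
  assumes x1: "norm x1 < 1" and m: "m > 0"
  defines "P \<equiv> {p. norm p + p \<bullet> x1 \<le> m}"
  shows "closed P"
    and "measure lborel (ball (0::real^'n) 1) * m ^ CARD('n) \<le> measure lborel P * psi x1 powr ((real CARD('n) + 1) / 2)"
proof -
  define s where "s = psi x1"
  define r where "r = norm x1"
  have s: "s > 0" "s = 1 - r\<^sup>2" using psi_pos[OF x1] by (auto simp: s_def psi_def r_def)
  have r: "0 \<le> r" "r < 1" using x1 by (auto simp: r_def)
  show "closed P" unfolding P_def by (intro closed_Collect_le continuous_intros)
  then have Pm: "P \<in> sets borel" by simp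
  have "norm p \<le> m / (1 - r)" if "p \<in> P" for p
  proof -
    have "- (p \<bullet> x1) \<le> norm p * r" using Cauchy_Schwarz_ineq2[of p x1] by (simp add: r_def)
    then have "norm p * (1 - r) \<le> m" using that by (simp add: P_def algebra_simps)
    then show ?thesis using r by (simp add: pos_le_divide_eq)
  qed
  then have "bounded P" by (auto simp: bounded_iff)
  then have Pfin: "emeasure lborel P < \<infinity>" by (rule emeasure_bounded_finite)
  obtain k :: 'n where True by simp
  have "norm (r *\<^sub>R axis k (1::real)) = norm x1" using r by (simp add: r_def)
  then obtain T :: "real^'n \<Rightarrow> real^'n" where T: "orthogonal_transformation T" "T (r *\<^sub>R axis k 1) = x1"
    by (rule orthogonal_transformation_exists)
  define R where "R = matrix T"
  have R: "orthogonal_matrix R" using T(1) by (simp add: R_def orthogonal_transformation_matrix)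
  have Tlin: "linear T" using T(1) by (simp add: orthogonal_transformation_def)
  have RT: "R *v x = T x" for x using Tlin by (simp add: R_def matrix_works)
  \<comment> \<open>In coordinates rotated by \<open>R\<close>, such that \<open>x1\<close> lies on the axis \<open>k\<close>, the ellipsoid has its centre at
    \<open>- m r / s\<close> on that axis; \<open>D\<close> rescales the semiaxes to \<open>1\<close> and the translation in \<open>f\<close> moves the centre to \<open>0\<close>.\<close>
  define D :: "real^'n^'n" where "D = diag (\<lambda>i. (sqrt s / m) * (if i = k then sqrt s else 1))"
  have D_mult: "(D *v q) $ i = (sqrt s / m) * (if i = k then sqrt s else 1) * q $ i" for q i
    by (simp add: D_def diag_def matrix_vector_mult_def if_distrib[of "\<lambda>x. x * _"] cong: if_cong)
  define A where "A = D ** transpose R"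
  define f where "f p = A *v p + r *\<^sub>R axis k 1" for p
  have f_deriv: "(f has_derivative (\<lambda>h. A *v h)) (at p)" for p
    unfolding f_def[abs_def]
    by (rule has_derivative_add_const, rule bounded_linear_imp_has_derivative, rule matrix_vector_mul_bounded_linear)
  have detA: "\<bar>det A\<bar> = s powr ((real CARD('n) + 1) / 2) / m ^ CARD('n)"
  proof -
    have "\<bar>det R\<bar> = 1" using det_orthogonal_matrix[OF R] by auto
    then have "\<bar>det A\<bar> = \<bar>det D\<bar>" by (simp add: A_def det_mul abs_mult det_transpose)
    also have "det D = (sqrt s / m) ^ CARD('n) * sqrt s"
      unfolding D_def det_diag prod.distrib by simp
    also have "\<bar>\<dots>\<bar> = sqrt s ^ (CARD('n) + 1) / m ^ CARD('n)"
      using s(1) m by (simp add: power_divide abs_mult)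
    also have "sqrt s ^ (CARD('n) + 1) = s powr ((real CARD('n) + 1) / 2)"
    proof -
      have "sqrt s ^ (CARD('n) + 1) = sqrt s powr real (CARD('n) + 1)" using s(1) by (subst powr_realpow) auto
      also have "\<dots> = s powr (1 / 2 * real (CARD('n) + 1))"
        using s(1) by (simp add: powr_half_sqrt[symmetric] powr_powr)
      finally show ?thesis by (simp add: add_divide_distrib add.commute)
    qed
    finally show ?thesis .
  qed
  have "ball 0 1 \<subseteq> f ` P"
  proof
    fix y :: "real^'n" assume "y \<in> ball 0 1"
    then have y: "norm y \<le> 1" by simp
    \<comment> \<open>The preimage of \<open>y\<close>, in rotated coordinates.\<close>
    define q :: "real^'n" where "q = (\<chi> i. (m / sqrt s) * (if i = k then (y $ k - r) / sqrt s else y $ i))"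
    have "f (R *v q) = y"
    proof -
      have "A ** R = D"
        using R by (simp add: A_def matrix_mul_assoc[symmetric] orthogonal_matrix_def)
      then have "A *v (R *v q) = D *v q" by (simp only: matrix_vector_mul_assoc)
      moreover have "D *v q + r *\<^sub>R axis k 1 = y"
        using s(1) m by (auto simp: vec_eq_iff D_mult q_def axis_def)
      ultimately show ?thesis by (simp add: f_def)
    qed
    moreover have "R *v q \<in> P"
    proof -
      have nR: "norm (R *v q) = norm q" using T(1) by (simp add: RT orthogonal_transformation_norm)
      have iR: "(R *v q) \<bullet> x1 = r * q $ k"
      proof -
        have "(R *v q) \<bullet> x1 = q \<bullet> (r *\<^sub>R axis k 1)"
          using T by (metis RT orthogonal_transformation_def)
        then show ?thesis by (simp add: inner_axis)
      qed
      have yk: "\<bar>y $ k\<bar> \<le> 1" using component_le_norm_cart[of y k] y by linarith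
      have ry: "0 \<le> 1 - r * y $ k"
      proof -
        have "r * y $ k \<le> r * 1" using r yk by (intro mult_left_mono) auto
        then show ?thesis using r by simp
      qed
      have qk: "q $ k = m / s * (y $ k - r)"
      proof -
        have "q $ k = m * (y $ k - r) / (sqrt s * sqrt s)" by (simp add: q_def)
        also have "sqrt s * sqrt s = s" using s(1) by simp
        finally show ?thesis by simp
      qed
      have rhs: "m - r * q $ k = (m / s) * (1 - r * y $ k)"
      proof -
        have "m - r * q $ k = (m / s) * (s - r * (y $ k - r))" using s(1) by (simp add: qk field_simps)
        then show ?thesis by (simp add: s(2) power2_eq_square algebra_simps)
      qed
      have norm_sq: "(norm z)\<^sup>2 = (\<Sum>i\<in>UNIV. (z $ i)\<^sup>2)" for z :: "real^'n"
        unfolding power2_norm_eq_inner inner_vec_def by (simp add: power2_eq_square)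
      have "(norm q)\<^sup>2 = (\<Sum>i\<in>UNIV. (q $ i)\<^sup>2)" by (rule norm_sq)
      also have "\<dots> = (q $ k)\<^sup>2 + (\<Sum>i\<in>UNIV - {k}. (q $ i)\<^sup>2)" by (intro sum.remove) auto
      also have "(\<Sum>i\<in>UNIV - {k}. (q $ i)\<^sup>2) = (m\<^sup>2 / s) * (\<Sum>i\<in>UNIV - {k}. (y $ i)\<^sup>2)"
        unfolding sum_distrib_left using s(1) by (intro sum.cong refl) (simp add: q_def power_mult_distrib power_divide)
      also have "(\<Sum>i\<in>UNIV - {k}. (y $ i)\<^sup>2) = (norm y)\<^sup>2 - (y $ k)\<^sup>2"
      proof -
        have "(norm y)\<^sup>2 = (\<Sum>i\<in>UNIV. (y $ i)\<^sup>2)" by (rule norm_sq)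
        also have "\<dots> = (y $ k)\<^sup>2 + (\<Sum>i\<in>UNIV - {k}. (y $ i)\<^sup>2)" by (intro sum.remove) auto
        finally show ?thesis by simp
      qed
      also have "(q $ k)\<^sup>2 = (m\<^sup>2 / s\<^sup>2) * (y $ k - r)\<^sup>2"
        using s(1) by (simp add: qk power_mult_distrib power_divide)
      also have "(m\<^sup>2 / s\<^sup>2) * (y $ k - r)\<^sup>2 + (m\<^sup>2 / s) * ((norm y)\<^sup>2 - (y $ k)\<^sup>2)
          \<le> (m\<^sup>2 / s\<^sup>2) * (y $ k - r)\<^sup>2 + (m\<^sup>2 / s) * (1 - (y $ k)\<^sup>2)"
        using s(1) y by (intro add_left_mono mult_left_mono) (auto simp: power_le_one)
      also have "\<dots> = (m\<^sup>2 / s\<^sup>2) * ((y $ k - r)\<^sup>2 + s * (1 - (y $ k)\<^sup>2))"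
        using s(1) by (simp add: power2_eq_square[of s] field_simps)
      also have "(y $ k - r)\<^sup>2 + s * (1 - (y $ k)\<^sup>2) = (1 - r * y $ k)\<^sup>2"
        unfolding s(2) by (simp add: power2_eq_square algebra_simps)
      also have "(m\<^sup>2 / s\<^sup>2) * (1 - r * y $ k)\<^sup>2 = (m - r * q $ k)\<^sup>2"
        unfolding rhs by (simp add: power_mult_distrib power_divide)
      finally have "(norm q)\<^sup>2 \<le> (m - r * q $ k)\<^sup>2" .
      moreover have "0 \<le> m - r * q $ k" unfolding rhs using ry s(1) m by simp
      ultimately have "norm q \<le> m - r * q $ k" by (rule power2_le_imp_le)
      then show ?thesis by (simp add: P_def nR iR)
    qed
    ultimately show "y \<in> f ` P" by (metis imageI)
  qed
  then have "measure lborel (ball (0::real^'n) 1) \<le> (\<integral>p. indicator P p * \<bar>det A\<bar> \<partial>lborel)"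
    using Pm Pfin f_deriv by (intro measure_image_le_integral_det[where f = f]) auto
  also have "\<dots> = measure lborel P * \<bar>det A\<bar>" by simp
  finally have "measure lborel (ball (0::real^'n) 1) \<le> measure lborel P * (s powr ((real CARD('n) + 1) / 2) / m ^ CARD('n))"
    unfolding detA .
  then show "measure lborel (ball (0::real^'n) 1) * m ^ CARD('n) \<le> measure lborel P * psi x1 powr ((real CARD('n) + 1) / 2)"
    using m by (simp add: s_def pos_le_divide_eq)
qed

text \<open>If \<open>- H\<close> is nonnegative definite, then \<open>- L0 u = tr (a (- H))\<close>, and the determinant inequality applies.  The
conventions for division agree with it: a positive numerator over \<open>det a = 0\<close> gives infinity, and a zero
numerator occurs only together with \<open>det (- H) = 0\<close>.\<close>

lemma det_nonneg_le_integrand: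
  fixes a H :: "real^'n::finite \<Rightarrow> real^'n^'n"
  assumes a: "sym_nonneg_definite (a x)" "trace (a x) > 0" and x: "x \<in> ball 0 1"
  shows "ennreal (det_nonneg (- H x)) \<le>
    ennreal (indicator {y \<in> ball 0 1. L0 a H y < 0} x * \<bar>L0 a H x\<bar> ^ CARD('n)) / ennreal (det (a x))"
proof (cases "sym_nonneg_definite (- H x)")
  case H: True
  have sym: "(- H x) $ j $ i = (- H x) $ i $ j" for i j
  proof -
    have "transpose (- H x) $ i $ j = (- H x) $ i $ j" using H by (simp only: sym_nonneg_definite_def)
    then show ?thesis by (simp only: transpose_def vec_lambda_beta)
  qed
  have t: "trace (a x ** - H x) = - L0 a H x"
  proof -
    have "trace (a x ** - H x) = (\<Sum>i\<in>UNIV. \<Sum>j\<in>UNIV. a x $ i $ j * (- H x) $ j $ i)"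
      by (simp add: trace_def matrix_matrix_mult_def)
    also have "\<dots> = (\<Sum>i\<in>UNIV. \<Sum>j\<in>UNIV. a x $ i $ j * (- H x) $ i $ j)"
      by (simp only: sym)
    also have "\<dots> = - L0 a H x" by (simp add: L0_def sum_negf)
    finally show ?thesis .
  qed
  have le: "det (a x) * det (- H x) \<le> (- L0 a H x) ^ CARD('n)" and nonneg: "0 \<le> - L0 a H x"
    using det_mult_le_trace_power[OF a(1) H] by (simp_all add: t)
  have dH: "det_nonneg (- H x) = det (- H x)" using H by (simp add: det_nonneg_def)
  show ?thesis
  proof (cases "L0 a H x = 0")
    case True
    then have "det (- H x) = 0" using det_eq_0_if_trace_mult_eq_0[OF a(1) H _ a(2)] t by simp
    then show ?thesis by (simp add: dH)
  next
    case False
    then have neg: "L0 a H x < 0" using nonneg by simp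
    then have rhs: "indicator {y \<in> ball 0 1. L0 a H y < 0} x * \<bar>L0 a H x\<bar> ^ CARD('n) = (- L0 a H x) ^ CARD('n)"
      using x by simp
    have pos: "(- L0 a H x) ^ CARD('n) > 0" using neg by simp
    show ?thesis
    proof (cases "det (a x) = 0")
      case True
      then show ?thesis unfolding rhs using pos neg by (simp add: ennreal_divide_zero)
    next
      case False
      then have d: "det (a x) > 0" using nonneg_definite_det_bounds(1)[OF a(1)] by simp
      have "det (- H x) \<le> (- L0 a H x) ^ CARD('n) / det (a x)"
        using le d by (simp add: pos_le_divide_eq mult.commute)
      then show ?thesis unfolding rhs dH using d pos by (subst divide_ennreal) (auto intro: ennreal_leI)
    qed
  qed
qed (simp add: det_nonneg_def)

text \<open>The constant \<open>c\<close> exceeds \<open>u0\<close> on the sphere, and \<open>x1\<close> maximizes \<open>(u0 - c) / \<psi>\<^sup>\<beta>\<close> over the set where \<open>u0 > c\<close>.  The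
contact points of the mollified functions lie in \<open>V = {u0 > c + M/4}\<close>, where by maximality
\<open>\<psi> \<ge> \<kappa> = (1/4) powr (1/\<beta>) * \<psi>(x1)\<close>.  The maximal quotient enters with the exact power \<open>n\<close>, without any factor
depending on \<open>x1\<close>, because \<open>n \<beta> + \<alpha> = (n + 1)/2\<close>.\<close>

lemma maximal_growth_bound:
  fixes a H :: "real^'n::finite \<Rightarrow> real^'n^'n" and u0 :: "real^'n \<Rightarrow> real"
  assumes a: "\<And>x. x \<in> ball 0 1 \<Longrightarrow> sym_nonneg_definite (a x) \<and> trace (a x) > 0"
    and W: "u0 \<in> sobolev_loc 2 (real CARD('n)) (ball 0 1)"
    and u0: "continuous_on (cball 0 1) u0"
    and H: "\<And>i j. has_weak_deriv (ball 0 1) [i, j] u0 (\<lambda>x. H x $ i $ j)"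
    and \<alpha>: "0 \<le> \<alpha>" "\<alpha> < (real CARD('n) + 1) / 2"
    and \<beta>: "\<beta> = (real CARD('n) + 1 - 2 * \<alpha>) / (2 * real CARD('n))"
    and bdry: "\<And>x. norm x = 1 \<Longrightarrow> u0 x < c"
    and x1: "norm x1 < 1" "u0 x1 = c + M" and M: "M > 0"
    and max: "\<And>x. norm x < 1 \<Longrightarrow> c < u0 x \<Longrightarrow> u0 x - c \<le> M / psi x1 powr \<beta> * psi x powr \<beta>"
  shows "ennreal (measure lborel (ball (0::real^'n) 1) * (1 / 2) ^ CARD('n) * (1 / 4) powr (\<alpha> / \<beta>)
      * (M / psi x1 powr \<beta>) ^ CARD('n)) \<le> weighted_integral \<alpha> a H"
proof -
  let ?n = "CARD('n)"
  have \<beta>0: "\<beta> > 0" using \<alpha> by (simp add: \<beta>)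
  \<comment> \<open>A continuous extension to the whole space, on which mollification is defined.\<close>
  define u where "u = u0 \<circ> closest_point (cball 0 1)"
  have u: "continuous_on UNIV u"
    unfolding u_def
    by (intro continuous_on_compose continuous_on_closest_point continuous_on_subset[OF u0])
       (auto intro!: closest_point_in_set simp del: mem_cball)
  have uu0: "u x = u0 x" if "norm x \<le> 1" for x
    using that by (simp add: u_def closest_point_self)

  \<comment> \<open>The compact set \<open>C\<close> avoids the sphere, hence lies in a smaller ball of radius \<open>r\<close>; between \<open>r\<close> and \<open>r'\<close> there
    is room for mollification.\<close>
  define C where "C = {x \<in> cball 0 1. c \<le> u0 x}"
  have "C = cball 0 1 \<inter> u0 -` {c..}" by (auto simp: C_def)
  then have "closed C" using continuous_closed_preimage[OF u0 closed_cball closed_atLeast] by simp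
  moreover have "bounded C" by (rule bounded_subset[OF bounded_cball[of 0 1]]) (auto simp: C_def)
  ultimately have "compact C" by (simp add: compact_eq_bounded_closed)
  moreover have "x1 \<in> C" using x1 M by (simp add: C_def)
  ultimately obtain z where z: "z \<in> C" "\<And>x. x \<in> C \<Longrightarrow> norm x \<le> norm z"
    using continuous_attains_sup[of C norm] by (auto intro: continuous_intros)
  have z1: "norm z < 1"
    using z(1) bdry[of z] by (cases "norm z = 1") (auto simp: C_def)
  define r where "r = (1 + norm z) / 2"
  have r: "0 < r" "r < 1" using z1 norm_ge_zero[of z] by (auto simp: r_def simp del: norm_ge_zero)
  have inr: "norm x < r" if "norm x \<le> 1" "c \<le> u0 x" for x
    using z(2)[of x] z1 that by (simp add: C_def r_def)
  define r' where "r' = (1 + r) / 2"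
  have r': "r < r'" "r' < 1" "0 < r'" using r by (auto simp: r'_def)
  have ub: "u y = u0 y" if "y \<in> ball 0 1" for y using uu0 that by simp
  obtain v where v: "\<And>i j. integrable lborel (v i j)"
    "integrable lborel (\<lambda>x. \<bar>\<Sum>i\<in>UNIV. v i i x\<bar> ^ ?n)"
    "\<And>i j. AE x in lborel. x \<in> cball 0 r' \<longrightarrow> v i j x = H x $ i $ j"
    "\<And>e x i j. 0 < e \<Longrightarrow> cball x e \<subseteq> cball 0 r' \<Longrightarrow> mollify_hess e u x $ i $ j = mollify e (v i j) x"
    using second_derivative_representatives[OF W H u ub r'(3,2)] by blast
  define \<eta> where "\<eta> = M / 16"
  have "\<eta> > 0" using M by (simp add: \<eta>_def)
  from mollify_uniform_limit[OF u bounded_cball this]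
  obtain e0 where e0: "e0 > 0"
    "\<And>e x. 0 < e \<Longrightarrow> e < e0 \<Longrightarrow> x \<in> cball 0 r \<Longrightarrow> \<bar>mollify e u x - u x\<bar> \<le> \<eta>" by metis
  define e1 where "e1 = min (e0 / 2) (r' - r)"
  have e1: "e1 > 0" "e1 < e0" "e1 \<le> r' - r" using e0 r' by (auto simp: e1_def)
  define e where "e n = e1 / (real n + 1)" for n :: nat
  have e: "0 < e n" "e n \<le> e1" for n
    using e1(1) by (auto simp: e_def divide_simps mult_left_mono)
  have elim: "e \<longlonglongrightarrow> 0"
    using tendsto_mult_right_zero[OF LIMSEQ_inverse_real_of_nat, of e1]
    by (simp add: e_def[abs_def] divide_inverse add.commute)
  define V where "V = {x \<in> ball 0 r. c + M / 4 < u x}"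
  have "open {x. c + M / 4 < u x}" using u by (intro open_Collect_less continuous_intros)
  moreover have "V = ball 0 r \<inter> {x. c + M / 4 < u x}" by (auto simp: V_def)
  ultimately have "open V" by (simp only: open_Int open_ball)
  then have Vm: "V \<in> sets borel" by simp
  have Vb: "bounded V" by (rule bounded_subset[OF bounded_ball[of 0 r]]) (auto simp: V_def)
  have V1: "norm x < 1" if "x \<in> V" for x using that r by (simp add: V_def)
  have hess: "mollify_hess (e n) u x $ i $ j = mollify (e n) (v i j) x" if "x \<in> V" for n x i j
  proof (rule v(4)[OF e(1)])
    show "cball x (e n) \<subseteq> cball 0 r'"
    proof
      fix y assume "y \<in> cball x (e n)"
      then have "norm y \<le> norm x + e n" by (metis dist_commute dist_norm mem_cball norm_triangle_sub order_trans add_left_mono)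
      then show "y \<in> cball 0 r'" using that e(2)[of n] e1(3) by (simp add: V_def)
    qed
  qed
  define P where "P = {p. norm p + p \<bullet> x1 \<le> M / 2}"
  have x1r: "norm x1 < r" using inr[of x1] x1 M by simp
  have contact: "P \<subseteq> mollify_grad (e n) u ` {x \<in> V. sym_nonneg_definite (- mollify_hess (e n) u x)}" for n
  proof
    fix p assume p: "p \<in> P"
    let ?U = "mollify (e n) u"
    have close: "\<bar>?U x - u x\<bar> \<le> M / 16" if "norm x \<le> r" for x
      using e0(2)[of "e n" x] e[of n] e1 that by (simp add: \<eta>_def)
    have "continuous_on (cball 0 r) (\<lambda>x. ?U x - p \<bullet> x)"
      using mollify_has_derivative[OF u e(1)]
      by (intro continuous_intros has_derivative_continuous_on) (auto intro: has_derivative_at_withinI)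
    then obtain x where x: "norm x \<le> r" and xmax: "\<And>y. norm y \<le> r \<Longrightarrow> ?U y - p \<bullet> y \<le> ?U x - p \<bullet> x"
      using continuous_attains_sup[of "cball 0 r" "\<lambda>x. ?U x - p \<bullet> x"] r by auto
    have "- (p \<bullet> x) \<le> norm p"
    proof -
      have "- (p \<bullet> x) \<le> norm p * norm x" using Cauchy_Schwarz_ineq2[of p x] by simp
      also have "\<dots> \<le> norm p * 1" using x r by (intro mult_left_mono) auto
      finally show ?thesis by simp
    qed
    then have "p \<bullet> x1 - p \<bullet> x \<le> M / 2" using p by (simp add: P_def)
    \<comment> \<open>Moving from \<open>x1\<close> to the maximum costs at most \<open>M/2\<close> for the linear term, and mollification \<open>M/16\<close> at each of the
      two points; this leaves more than \<open>M/4\<close>.\<close>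
    then have "u x \<ge> u x1 - M / 2 - M / 16 - M / 16"
      using xmax[of x1] close[OF x] close[of x1] x1r unfolding abs_le_iff by linarith
    then have ux: "c + M / 4 < u x" using uu0[of x1] x1 M by simp
    then have xr: "norm x < r" using inr[of x] uu0[of x] x r M by simp
    have xV: "x \<in> V" using xr ux by (simp add: V_def)
    have xb: "x \<in> ball 0 r" using xr by simp
    have m: "?U y - p \<bullet> y \<le> ?U x - p \<bullet> x" if "y \<in> ball 0 r" for y using xmax[of y] that by simp
    note so = second_order_necessary_condition[OF open_ball xb mollify_has_derivative[OF u e(1)]
        mollify_grad_has_derivative[OF u e(1)] m]
    have "v \<bullet> (- mollify_hess (e n) u x *v v) \<ge> 0" for v
    proof -
      have "- mollify_hess (e n) u x *v v = - (mollify_hess (e n) u x *v v)"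
        by (simp add: matrix_vector_mult_def vec_eq_iff sum_negf)
      then show ?thesis using so(2)[of v] by simp
    qed
    moreover have "transpose (- mollify_hess (e n) u x) = - mollify_hess (e n) u x"
      using transpose_mollify_hess[of "e n" u x] by (simp add: transpose_def vec_eq_iff)
    ultimately have "sym_nonneg_definite (- mollify_hess (e n) u x)" by (simp add: sym_nonneg_definite_def)
    then show "p \<in> mollify_grad (e n) u ` {x \<in> V. sym_nonneg_definite (- mollify_hess (e n) u x)}"
      using so(1) xV by blast
  qed
  have M2: "M / 2 > 0" using M by simp
  note vol = polar_set_volume[OF x1(1) M2, folded P_def]
  have Pm: "P \<in> sets borel" using vol(1) by simp
  define F where "F x = indicator V x * det_nonneg (\<chi> i j. - v i j x)" for x
  have Fint: "integrable lborel F" and PF: "measure lborel P \<le> (\<integral>x. F x \<partial>lborel)"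
    unfolding F_def[abs_def]
    using measure_gradient_image_limit[OF u v(1,2) Vb Vm e(1) elim hess Pm contact] by auto
  have F0: "0 \<le> F x" for x by (simp add: F_def det_nonneg_ge_0)

  define \<kappa> where "\<kappa> = (1 / 4) powr (1 / \<beta>) * psi x1"
  have p1: "psi x1 > 0" using psi_pos[OF x1(1)] .
  have \<kappa>0: "\<kappa> > 0" using p1 by (simp add: \<kappa>_def)
  have psi_V: "\<kappa> \<le> psi x" if x: "x \<in> V" for x
  proof (rule ccontr)
    assume neg: "\<not> \<kappa> \<le> psi x"
    have x_1: "norm x < 1" using V1[OF x] .
    have ux: "c + M / 4 < u0 x" using x uu0[of x] x_1 by (simp add: V_def)
    then have "c < u0 x" using M by linarith
    then have "M / 4 < M / psi x1 powr \<beta> * psi x powr \<beta>" using max[OF x_1] ux by linarith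
    then have "1 / 4 * psi x1 powr \<beta> < psi x powr \<beta>"
      using M p1 by (simp add: field_simps)
    also have "psi x powr \<beta> < \<kappa> powr \<beta>"
      using neg psi_pos[OF x_1] \<beta>0 by (intro powr_less_mono2) auto
    also have "\<kappa> powr \<beta> = 1 / 4 * psi x1 powr \<beta>"
      using p1 \<beta>0 by (simp add: \<kappa>_def powr_mult powr_powr)
    finally show False by simp
  qed

  have "ennreal (\<kappa> powr \<alpha> * measure lborel P) \<le> ennreal (\<kappa> powr \<alpha>) * ennreal (\<integral>x. F x \<partial>lborel)"
    using PF by (subst ennreal_mult[symmetric]) (auto intro!: ennreal_leI mult_left_mono integral_nonneg_AE simp: F0)
  also have "\<dots> = ennreal (\<kappa> powr \<alpha>) * (\<integral>\<^sup>+x. ennreal (F x) \<partial>lborel)"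
    using Fint F0 by (subst nn_integral_eq_integral) auto
  also have "\<dots> = (\<integral>\<^sup>+x. ennreal (\<kappa> powr \<alpha>) * ennreal (F x) \<partial>lborel)"
    using Fint by (subst nn_integral_cmult) auto
  also have "\<dots> \<le> (\<integral>\<^sup>+x. (ennreal (psi x powr \<alpha>) *
        (ennreal (indicator {y \<in> ball 0 1. L0 a H y < 0} x * \<bar>L0 a H x\<bar> ^ ?n) / ennreal (det (a x)))) * indicator (ball 0 1) x \<partial>lborel)"
  proof (rule nn_integral_mono_AE)
    have "AE x in lborel. \<forall>i\<in>UNIV. \<forall>j\<in>UNIV. x \<in> cball 0 r' \<longrightarrow> v i j x = H x $ i $ j"
      by (intro AE_finite_allI v(3)) auto
    then show "AE x in lborel. ennreal (\<kappa> powr \<alpha>) * ennreal (F x) \<le> (ennreal (psi x powr \<alpha>) *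
        (ennreal (indicator {y \<in> ball 0 1. L0 a H y < 0} x * \<bar>L0 a H x\<bar> ^ ?n) / ennreal (det (a x)))) * indicator (ball 0 1) x"
    proof (rule AE_mp, intro AE_I2 impI)
      fix x assume vH: "\<forall>i\<in>UNIV. \<forall>j\<in>UNIV. x \<in> cball 0 r' \<longrightarrow> v i j x = H x $ i $ j"
      show "ennreal (\<kappa> powr \<alpha>) * ennreal (F x) \<le> (ennreal (psi x powr \<alpha>) *
        (ennreal (indicator {y \<in> ball 0 1. L0 a H y < 0} x * \<bar>L0 a H x\<bar> ^ ?n) / ennreal (det (a x)))) * indicator (ball 0 1) x"
      proof (cases "x \<in> V")
        case True
        have xb: "x \<in> ball 0 1" using V1[OF True] by simp
        have "x \<in> cball 0 r'" using True r' by (simp add: V_def)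
        then have "(\<chi> i j. - v i j x) = - H x" using vH by (simp add: vec_eq_iff)
        then have Fx: "F x = det_nonneg (- H x)" using True by (simp add: F_def)
        have "ennreal (\<kappa> powr \<alpha>) \<le> ennreal (psi x powr \<alpha>)"
          using psi_V[OF True] \<kappa>0 \<alpha>(1) by (intro ennreal_leI powr_mono2) auto
        then show ?thesis
          using det_nonneg_le_integrand[of a x H] a[OF xb] xb unfolding Fx by (auto intro!: mult_mono)
      qed (simp add: F_def)
    qed
  qed
  also have "\<dots> = weighted_integral \<alpha> a H"
    unfolding weighted_integral_def by (subst nn_integral_restrict_space) (auto simp: nn_integral_completion)
  finally have 1: "ennreal (\<kappa> powr \<alpha> * measure lborel P) \<le> weighted_integral \<alpha> a H" .

  have "measure lborel (ball (0::real^'n) 1) * (1 / 2) ^ ?n * (1 / 4) powr (\<alpha> / \<beta>) * (M / psi x1 powr \<beta>) ^ ?n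
      \<le> \<kappa> powr \<alpha> * measure lborel P"
  proof -
    \<comment> \<open>Here the value of \<open>\<beta>\<close> enters.\<close>
    have e1: "(psi x1 powr \<beta>) ^ ?n = psi x1 powr ((real ?n + 1) / 2 - \<alpha>)"
    proof -
      have "(psi x1 powr \<beta>) ^ ?n = (psi x1 powr \<beta>) powr real ?n" using p1 by (subst powr_realpow) auto
      also have "\<dots> = psi x1 powr ((real ?n + 1) / 2 - \<alpha>)"
        unfolding powr_powr by (rule arg_cong[where f = "\<lambda>t. psi x1 powr t"]) (simp add: \<beta> field_simps)
      finally show ?thesis .
    qed
    have e2: "\<kappa> powr \<alpha> = (1 / 4) powr (\<alpha> / \<beta>) * psi x1 powr \<alpha>"
      using p1 by (simp add: \<kappa>_def powr_mult powr_powr)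
    have "measure lborel (ball (0::real^'n) 1) * (1 / 2) ^ ?n * (1 / 4) powr (\<alpha> / \<beta>) * (M / psi x1 powr \<beta>) ^ ?n
       = (measure lborel (ball (0::real^'n) 1) * (M / 2) ^ ?n) * ((1 / 4) powr (\<alpha> / \<beta>) / (psi x1 powr \<beta>) ^ ?n)"
      by (simp add: power_divide)
    also have "\<dots> \<le> (measure lborel P * psi x1 powr ((real ?n + 1) / 2)) * ((1 / 4) powr (\<alpha> / \<beta>) / (psi x1 powr \<beta>) ^ ?n)"
      by (intro mult_right_mono vol(2)) simp
    also have "\<dots> = measure lborel P * (1 / 4) powr (\<alpha> / \<beta>) * (psi x1 powr ((real ?n + 1) / 2) / psi x1 powr ((real ?n + 1) / 2 - \<alpha>))"
      unfolding e1 by simp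
    also have "psi x1 powr ((real ?n + 1) / 2) / psi x1 powr ((real ?n + 1) / 2 - \<alpha>) = psi x1 powr \<alpha>"
      by (simp add: powr_diff[symmetric])
    finally show ?thesis unfolding e2 by (simp add: mult_ac)
  qed
  then have "ennreal (measure lborel (ball (0::real^'n) 1) * (1 / 2) ^ ?n * (1 / 4) powr (\<alpha> / \<beta>) * (M / psi x1 powr \<beta>) ^ ?n)
      \<le> ennreal (\<kappa> powr \<alpha> * measure lborel P)" by (rule ennreal_leI)
  then show ?thesis using 1 by (rule order_trans)
qed

theorem theorem1p7:
  fixes \<alpha> \<beta> :: real
  assumes "CARD('n::finite) \<ge> 2"
    and "0 \<le> \<alpha>" and "\<alpha> < (real CARD('n) + 1) / 2"
    and "\<beta> = (real CARD('n) + 1 - 2 * \<alpha>) / (2 * real CARD('n))"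
  shows "\<exists>N::real. N > 0 \<and>
    (\<forall>(a :: real^'n \<Rightarrow> real^'n^'n) (u :: real^'n \<Rightarrow> real) (H :: real^'n \<Rightarrow> real^'n^'n).
       a \<in> borel_measurable (lebesgue_on (ball 0 1)) \<longrightarrow>
       (\<forall>x \<in> ball 0 1. sym_nonneg_definite (a x) \<and> trace (a x) > 0) \<longrightarrow>
       u \<in> sobolev_loc 2 (real CARD('n)) (ball 0 1) \<longrightarrow>
       continuous_on (cball 0 1) u \<longrightarrow>
       (\<forall>i j. has_weak_deriv (ball 0 1) [i, j] u (\<lambda>x. H x $ i $ j)) \<longrightarrow>
       (\<forall>x0 \<in> ball 0 1.
          ereal (u x0) \<le> ereal (SUP x \<in> frontier (ball 0 1). u x) +
            ereal (N * psi x0 powr \<beta>) *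
              enn2ereal (ennreal_powr (weighted_integral \<alpha> a H) (1 / real CARD('n)))))"
proof -
  let ?n = "CARD('n)"
  have \<beta>0: "\<beta> > 0" using assms by simp
  define k where "k = measure lborel (ball (0::real^'n) 1) * (1 / 2) ^ ?n * (1 / 4) powr (\<alpha> / \<beta>)"
  have k: "k > 0" by (simp add: k_def content_ball_pos)
  define N where "N = (1 / k) powr (1 / real ?n)"
  have N: "N > 0" using k by (simp add: N_def)
  show ?thesis
  proof (rule exI[of _ N], intro conjI N allI impI ballI)
    fix a :: "real^'n \<Rightarrow> real^'n^'n" and u :: "real^'n \<Rightarrow> real" and H :: "real^'n \<Rightarrow> real^'n^'n" and x0 :: "real^'n"
    assume a: "\<forall>x \<in> ball 0 1. sym_nonneg_definite (a x) \<and> trace (a x) > 0"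
      and W: "u \<in> sobolev_loc 2 (real ?n) (ball 0 1)"
      and u: "continuous_on (cball 0 1) u"
      and H: "\<forall>i j. has_weak_deriv (ball 0 1) [i, j] u (\<lambda>x. H x $ i $ j)"
      and "x0 \<in> ball 0 1"
    then have x0: "norm x0 < 1" by simp
    define m where "m = (SUP x \<in> frontier (ball 0 1). u x)"
    have bdry: "u x \<le> m" if "norm x = 1" for x
    proof -
      have "compact (u ` frontier (ball 0 1))"
        by (intro compact_continuous_image continuous_on_subset[OF u]) auto
      then have "bdd_above (u ` frontier (ball 0 1))" by (intro bounded_imp_bdd_above compact_imp_bounded)
      then show ?thesis unfolding m_def using that by (intro cSUP_upper) auto
    qed
    define w where "w = weighted_integral \<alpha> a H"
    have p0: "psi x0 > 0" using psi_pos[OF x0] .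
    have "ereal (u x0) \<le> ereal m + ereal (N * psi x0 powr \<beta>) * enn2ereal (ennreal_powr w (1 / real ?n))"
    proof (cases "w = top")
      case True
      have "N * psi x0 powr \<beta> > 0" using N p0 by simp
      then have inf: "ereal (N * psi x0 powr \<beta>) * enn2ereal (ennreal_powr w (1 / real ?n)) = \<infinity>"
        using True N p0 by (simp add: ennreal_powr_def)
      show ?thesis unfolding inf by simp
    next
      case False
      define I where "I = enn2real w"
      have I: "w = ennreal I" "0 \<le> I" using False by (simp_all add: I_def less_top)
      have rhs: "enn2ereal (ennreal_powr w (1 / real ?n)) = ereal (I powr (1 / real ?n))"
        using False by (simp add: ennreal_powr_def I_def enn2ereal_ennreal)
      have "u x0 \<le> m + N * psi x0 powr \<beta> * I powr (1 / real ?n)"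
      proof (cases "u x0 \<le> m")
        case True
        have "0 \<le> N * psi x0 powr \<beta> * I powr (1 / real ?n)" using N by simp
        then show ?thesis using True by linarith
      next
        case above: False
        show ?thesis
        proof (rule field_le_epsilon)
          fix \<epsilon> :: real assume \<epsilon>: "\<epsilon> > 0"
          \<comment> \<open>Lifting the boundary value by \<open>\<delta>\<close> makes \<open>u - c\<close> negative on the sphere, so that the maximum of the
            quotient is attained inside the ball; \<open>\<delta>\<close> stays below \<open>u x0 - m\<close> to keep \<open>x0\<close> admissible.\<close>
          define \<delta> where "\<delta> = min \<epsilon> ((u x0 - m) / 2)"
          have "\<delta> \<le> (u x0 - m) / 2" unfolding \<delta>_def by (rule min.cobounded2)
          then have \<delta>: "\<delta> > 0" "\<delta> \<le> \<epsilon>" "m + \<delta> < u x0" using \<epsilon> above by (auto simp: \<delta>_def)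
          define c where "c = m + \<delta>"
          have bc: "u x < c" if "norm x = 1" for x using bdry[OF that] \<delta> by (simp add: c_def)
          define S where "S = {x \<in> cball 0 1. c \<le> u x}"
          have "S = cball 0 1 \<inter> u -` {c..}" by (auto simp: S_def)
          then have "closed S" using continuous_closed_preimage[OF u closed_cball closed_atLeast] by simp
          moreover have "bounded S" by (rule bounded_subset[OF bounded_cball[of 0 1]]) (auto simp: S_def)
          ultimately have S: "compact S" by (simp add: compact_eq_bounded_closed)
          have S1: "norm x < 1" if "x \<in> S" for x
            using that bc[of x] by (cases "norm x = 1") (auto simp: S_def)
          have x0S: "x0 \<in> S" using x0 \<delta> by (simp add: S_def c_def)
          have "psi x > 0" if "x \<in> S" for x using psi_pos S1[OF that] by blast
          then have psi_S: "psi x \<noteq> 0" if "x \<in> S" for x using that by (simp add: less_imp_neq[symmetric])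
          have "continuous_on S psi" unfolding psi_def[abs_def] by (intro continuous_intros)
          then have "continuous_on S (\<lambda>x. psi x powr \<beta>)"
            using psi_S by (intro continuous_on_powr continuous_on_const) auto
          moreover have "continuous_on S (\<lambda>x. u x - c)"
            by (intro continuous_intros continuous_on_subset[OF u]) (auto simp: S_def)
          ultimately have "continuous_on S (\<lambda>x. (u x - c) / psi x powr \<beta>)"
            using psi_S by (intro continuous_on_divide) auto
          then have "\<exists>x1\<in>S. \<forall>x\<in>S. (u x - c) / psi x powr \<beta> \<le> (u x1 - c) / psi x1 powr \<beta>"
            using x0S by (intro continuous_attains_sup[OF S]) auto
          then obtain x1 where x1: "x1 \<in> S" and
            max: "\<And>x. x \<in> S \<Longrightarrow> (u x - c) / psi x powr \<beta> \<le> (u x1 - c) / psi x1 powr \<beta>"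
            by blast
          define M where "M = u x1 - c"
          define K where "K = M / psi x1 powr \<beta>"
          have p1: "psi x1 > 0" using psi_pos S1[OF x1] by blast
          have le: "u x - c \<le> K * psi x powr \<beta>" if "x \<in> S" for x
            using max[OF that] psi_pos[OF S1[OF that]] by (simp add: K_def M_def pos_divide_le_eq)
          have "0 < (u x0 - c) / psi x0 powr \<beta>" using \<delta> p0 by (simp add: c_def)
          also have "\<dots> \<le> K" using max[OF x0S] by (simp add: K_def M_def)
          finally have K: "K > 0" .
          then have M: "M > 0" using p1 by (simp add: K_def zero_less_divide_iff)
          have "ennreal (k * K ^ ?n) \<le> w"
            unfolding k_def K_def w_def
          proof (rule maximal_growth_bound[OF _ W u _ assms(2,3,4) bc S1[OF x1] _ M])
            show "u x - c \<le> M / psi x1 powr \<beta> * psi x powr \<beta>" if "norm x < 1" "c < u x" for x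
              using le[of x] that by (simp add: S_def K_def)
          qed (use a H in \<open>simp_all add: M_def\<close>)
          then have "k * K ^ ?n \<le> I" using I by simp
          then have "K ^ ?n \<le> 1 / k * I" using k by (simp add: field_simps)
          then have "(K ^ ?n) powr (1 / real ?n) \<le> (1 / k * I) powr (1 / real ?n)"
            using K by (intro powr_mono2) auto
          moreover have "(K ^ ?n) powr (1 / real ?n) = K"
            using K by (simp add: powr_realpow[symmetric] powr_powr)
          moreover have "(1 / k * I) powr (1 / real ?n) = N * I powr (1 / real ?n)"
            unfolding N_def by (rule powr_mult)
          ultimately have "K \<le> N * I powr (1 / real ?n)" by simp
          then have "K * psi x0 powr \<beta> \<le> (N * I powr (1 / real ?n)) * psi x0 powr \<beta>"
            by (intro mult_right_mono) auto
          then have "u x0 - c \<le> N * psi x0 powr \<beta> * I powr (1 / real ?n)"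
            using le[OF x0S] by (simp add: mult_ac)
          then show "u x0 \<le> m + N * psi x0 powr \<beta> * I powr (1 / real ?n) + \<epsilon>"
            using \<delta> by (simp add: c_def)
        qed
      qed
      then show ?thesis unfolding rhs by simp
    qed
    then show "ereal (u x0) \<le> ereal (SUP x \<in> frontier (ball 0 1). u x) +
            ereal (N * psi x0 powr \<beta>) * enn2ereal (ennreal_powr (weighted_integral \<alpha> a H) (1 / real ?n))"
      by (simp add: m_def w_def)
  qed
qed

end
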